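(* Let $P$ be a simple polygon. Then the human can catch the puppy on $P$, starting from any initial configuration.
   Context: The track is the boundary of $P$. A human and a puppy are points on the track. The human walks along the track at bounded speed and may change direction. The puppy, with unbounded speed and while the human is stationary, runs along the track in a direction in which its Euclidean straight-line distance to the human decreases, until it reaches a point where this distance is locally minimal (if both directions decrease the distance it picks either); when at such a point, the puppy stays until the human moves, and then moves along the track so as to remain at a local minimum until forced to run again. (At a vertex the puppy's direction of motion is tracked: a puppy at a vertex faces along one of the incident edges or turns between them.) The human catches the puppy when their positions coincide. *)

theory Defs
  imports "HOL-Analysis.Analysis"
begin

fun polyline :: "complex list \<Rightarrow> real \<Rightarrow> complex" where
  "polyline [] = linepath 0 0"
| "polyline [v] = linepath v v"
| "polyline [v, w] = linepath v w"
| "polyline (v # w # u # vs) = linepath v w +++ polyline (w # u # vs)"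

definition polygon_path :: "complex list \<Rightarrow> real \<Rightarrow> complex" where
  "polygon_path vs = polyline (vs @ [hd vs])"

definition simple_polygon :: "complex list \<Rightarrow> bool" where
  "simple_polygon vs \<longleftrightarrow> length vs \<ge> 3 \<and> simple_path (polygon_path vs)"

text \<open>Positions on the track are given by real parameters; the track is traversed
  periodically (parameter s and s+1 give the same point).  Using a real (lifted)
  parameter lets us speak about moving ``along the track in a direction''.\<close>
definition track :: "complex list \<Rightarrow> real \<Rightarrow> complex" where
  "track vs s = polygon_path vs (frac s)"

text \<open>phi s is the Euclidean distance from the human to the track point of parameter s.\<close>
definition locmin :: "(real \<Rightarrow> real) \<Rightarrow> real \<Rightarrow> bool" where
  "locmin phi a \<longleftrightarrow> (\<exists>e>0. \<forall>s. \<bar>s - a\<bar> < e \<longrightarrow> phi a \<le> phi s)"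

definition puppy_run :: "(real \<Rightarrow> real) \<Rightarrow> real \<Rightarrow> real \<Rightarrow> bool" where
  "puppy_run phi a b \<longleftrightarrow>
     (b = a \<and> locmin phi a)
   \<or> (a < b \<and> (\<forall>u v. a \<le> u \<and> u < v \<and> v \<le> b \<longrightarrow> phi v < phi u) \<and> locmin phi b)
   \<or> (b < a \<and> (\<forall>u v. b \<le> u \<and> u < v \<and> v \<le> a \<longrightarrow> phi u < phi v) \<and> locmin phi b)"

definition dist_fun :: "(real \<Rightarrow> complex) \<Rightarrow> real \<Rightarrow> real \<Rightarrow> real" where
  "dist_fun G h = (\<lambda>s. dist (G h) (G s))"

text \<open>A (monotone) human move: the human walks at constant speed from parameter x to
  x + d during time [0,1], i.e. is at x + t*d at time t.  A puppy response to it, with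
  puppy initially at q, is a trajectory p on [0,1] which is at a local minimum at all
  times, is right-continuous, and whose only changes other than continuous tracking
  of a local minimum are forced runs (from its left limit), including an initial run
  at time 0 from q.\<close>
definition puppy_response ::
  "(real \<Rightarrow> complex) \<Rightarrow> real \<Rightarrow> real \<Rightarrow> real \<Rightarrow> (real \<Rightarrow> real) \<Rightarrow> bool" where
  "puppy_response G x d q p \<longleftrightarrow>
     (\<forall>t\<in>{0..1}. locmin (dist_fun G (x + t * d)) (p t))
   \<and> (\<forall>t\<in>{0..<1}. (p \<longlongrightarrow> p t) (at_right t))
   \<and> (\<forall>t\<in>{0<..1}. \<exists>l. (p \<longlongrightarrow> l) (at_left t) \<and> puppy_run (dist_fun G (x + t * d)) l (p t))
   \<and> puppy_run (dist_fun G x) q (p 0)"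

text \<open>Configurations (human parameter x, puppy parameter q) from which the human can
  force a catch within finitely many moves, adaptively choosing each move after seeing
  the puppy's reaction, against every admissible puppy behaviour.\<close>
inductive human_wins :: "(real \<Rightarrow> complex) \<Rightarrow> real \<Rightarrow> real \<Rightarrow> bool" for G where
  caught: "G x = G q \<Longrightarrow> human_wins G x q"
| move: "(\<exists>p. puppy_response G x d q p) \<Longrightarrow>
         (\<forall>p. puppy_response G x d q p \<longrightarrow>
              (\<exists>t\<in>{0..1}. G (x + t * d) = G (p t)) \<or> human_wins G (x + d) (p 1))
         \<Longrightarrow> human_wins G x q"

end

theory Submission
  imports Defs
begin

text \<open>
  A configuration is a pair (human parameter, puppy parameter). If the human could not win, the
  stable configurations from which it loses would form a trap: a set closed under all responses
  of the puppy in which no catch ever happens. For a fixed human position consider the topmost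
  trapped puppy position in the strip between the human and the human one lap later. Just above
  it the distance increases with the puppy parameter, and wherever the top jumps, the puppy has
  just run down to it; hence there is a continuous curve above the trap along which moving the
  puppy ahead by a small fixed amount increases its distance to the human. Symmetrically, there
  is a curve below the trap along which this decreases the distance.

  Two such curves cannot exist for a simple closed curve. If two human positions, one on each
  curve, share the puppy position, then they lie on different sides of the perpendicular bisector
  of the puppy position and the advanced puppy position, so their chord makes an acute angle with
  the corresponding chord of the curve. Lifting the directions of all chords continuously and
  using that seen from an extreme point of the curve all chords point into an open half plane, one
  finds that along pairs of human positions with a common puppy position this angle would have to
  change by an odd multiple of a full turn.
\<close>

section \<open>Chords of a simple closed curve\<close>

text \<open>\<open>human_wins\<close> admits a move only if the puppy has some response to it, so a
  trap says something only about moves known to be answerable. Responses are constructed for short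
  moves that start or end at a prescribed human position. Moves away from a position bound the top
  of the trap nearby from below, and moves towards it bound the top from above.

  The top is merely lower semicontinuous and the distance has corners, so the curve runs in the gap
  between the top and the next peak of the distance, and the sign of a derivative is replaced by a
  comparison of two puppy positions a fixed \<open>e\<close> apart. The crux is that one
  \<open>e\<close> serves all human positions; there it matters that peaks sit at vertices and that
  consecutive edges do not fold back.

  The odd number of turns comes from reversing chords: passing from the pair (a, b) to (b, a + 1)
  changes the lifted direction by an odd multiple of pi, the same one everywhere. The parity of the
  number of turns is read off from the sign of the cosine of half the angle.\<close>

lemma connected_avoids_angle:
  fixes f :: "'a::topological_space \<Rightarrow> real"
  assumes "connected S" "continuous_on S f"
    and avoid: "\<And>z k. z \<in> S \<Longrightarrow> f z \<noteq> b + 2 * pi * of_int k"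
  shows "\<exists>k::int. \<forall>z\<in>S. b + 2 * pi * of_int k < f z \<and> f z < b + 2 * pi * of_int (k + 1)"
proof (cases "S = {}")
  case False
  then obtain z0 where z0: "z0 \<in> S" by blast
  define k where "k = \<lfloor>(f z0 - b) / (2 * pi)\<rfloor>"
  have "of_int k \<le> (f z0 - b) / (2 * pi)" "(f z0 - b) / (2 * pi) < of_int k + 1"
    unfolding k_def by linarith+
  then have lo: "b + 2 * pi * of_int k \<le> f z0" and hi: "f z0 < b + 2 * pi * of_int (k + 1)"
    by (simp_all add: field_simps)
  have conn: "connected (f ` S)" using assms by (simp add: connected_continuous_image)
  have no: "b + 2 * pi * of_int j \<notin> f ` S" for j by (metis avoid imageE)
  have "b + 2 * pi * of_int k < f z \<and> f z < b + 2 * pi * of_int (k + 1)" if "z \<in> S" for z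
  proof (intro conjI; rule ccontr)
    assume "\<not> b + 2 * pi * of_int k < f z"
    then have "b + 2 * pi * of_int k \<in> f ` S"
      using connectedD_interval[OF conn, of "f z" "f z0"] that z0 lo by force
    then show False using no by blast
  next
    assume "\<not> f z < b + 2 * pi * of_int (k + 1)"
    then have "b + 2 * pi * of_int (k + 1) \<in> f ` S"
      using connectedD_interval[OF conn, of "f z0" "f z"] that z0 hi by force
    then show False using no by blast
  qed
  then show ?thesis by blast
qed auto

text \<open>Without a common zero, \<open>h + i psi\<close> has a continuous argument on the convex
  triangle. From \<open>(a, b)\<close> to \<open>(b, b)\<close> it passes from the left to the right
  half plane. Along the left side and the diagonal it avoids the negative imaginary axis, along the
  top the positive one, so the argument would decrease along one route and increase along the
  other.\<close>

lemma triangle_common_zero: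
  fixes h psi :: "real \<times> real \<Rightarrow> real" and a b :: real
  defines "T \<equiv> {(s, t). a \<le> s \<and> s \<le> t \<and> t \<le> b}"
  assumes "a < b" and conth: "continuous_on T h" and contp: "continuous_on T psi"
    and diag: "\<And>s. s \<in> {a..b} \<Longrightarrow> h (s, s) > 0"
    and corner: "h (a, b) < 0"
    and left: "\<And>t. t \<in> {a..b} \<Longrightarrow> h (a, t) = 0 \<Longrightarrow> psi (a, t) > 0"
    and top: "\<And>s. s \<in> {a..b} \<Longrightarrow> h (s, b) = 0 \<Longrightarrow> psi (s, b) < 0"
  shows "\<exists>z\<in>T. h z = 0 \<and> psi z = 0"
proof (rule ccontr)
  assume neg: "\<not> ?thesis"
  define F where "F z = Complex (h z) (psi z)" for z
  have "convex T"
    unfolding T_def convex_alt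
  proof (clarsimp, intro conjI)
    fix s t s' t' u :: real
    assume *: "a \<le> s" "s \<le> t" "t \<le> b" "a \<le> s'" "s' \<le> t'" "t' \<le> b" "0 \<le> u" "u \<le> 1"
    have "(1 - u) * a + u * a \<le> (1 - u) * s + u * s'"
      using * by (intro add_mono mult_left_mono) auto
    then show "a \<le> (1 - u) * s + u * s'" by (simp add: algebra_simps)
    show "(1 - u) * s + u * s' \<le> (1 - u) * t + u * t'"
      using * by (intro add_mono mult_left_mono) auto
    have "(1 - u) * t + u * t' \<le> (1 - u) * b + u * b"
      using * by (intro add_mono mult_left_mono) auto
    then show "(1 - u) * t + u * t' \<le> b" by (simp add: algebra_simps)
  qed
  moreover have "continuous_on T F"
    unfolding F_def complex_eq by (intro continuous_intros conth contp)
  moreover have "F z \<noteq> 0" if "z \<in> T" for z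
    using neg that by (auto simp: F_def complex_eq_iff)
  ultimately obtain g where contg: "continuous_on T g" and g: "\<And>z. z \<in> T \<Longrightarrow> F z = exp (g z)"
    using continuous_logarithm_on_contractible convex_imp_contractible by blast
  define th where "th z = Im (g z)" for z
  have contth: "continuous_on T th" unfolding th_def by (intro continuous_intros contg)
  have h: "h z = exp (Re (g z)) * cos (th z)" and p: "psi z = exp (Re (g z)) * sin (th z)"
    if "z \<in> T" for z
    using g[OF that] by (auto simp: F_def th_def complex_eq_iff Re_exp Im_exp)
  define L where "L = (\<lambda>t. (a, t)) ` {a..b} \<union> (\<lambda>s. (s, s)) ` {a..b}"
  define U where "U = (\<lambda>s. (s, b)) ` {a..b}"
  have LT: "L \<subseteq> T" and UT: "U \<subseteq> T" using \<open>a < b\<close> by (auto simp: L_def U_def T_def)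
  have "connected L"
    unfolding L_def
  proof (intro connected_Un connected_continuous_image continuous_intros)
    have "(a, a) \<in> (\<lambda>t. (a, t)) ` {a..b} \<inter> (\<lambda>s. (s, s)) ` {a..b}" using \<open>a < b\<close> by auto
    then show "(\<lambda>t. (a, t)) ` {a..b} \<inter> (\<lambda>s. (s, s)) ` {a..b} \<noteq> {}" by blast
  qed auto
  have "connected U"
    unfolding U_def by (intro connected_continuous_image continuous_intros) auto
  have c: "(a, b) \<in> L" "(a, b) \<in> U" "(b, b) \<in> L" "(b, b) \<in> U"
    using \<open>a < b\<close> by (auto simp: L_def U_def)
  have bb: "cos (th (b, b)) > 0" and ab: "cos (th (a, b)) < 0"
    using diag[of b] corner h[of "(b, b)"] h[of "(a, b)"] c LT \<open>a < b\<close>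
    by (auto simp: zero_less_mult_iff mult_less_0_iff)
  have avoidL: "th z \<noteq> - pi / 2 + 2 * pi * of_int k" if "z \<in> L" for z k
  proof
    assume e: "th z = - pi / 2 + 2 * pi * of_int k"
    have "cos (th z) = cos (- pi / 2)" "sin (th z) = sin (- pi / 2)"
      unfolding e using sin.periodic_simps(1) 
      by (metis add.commute cos_int_2pin cos_add sin_add sin_int_2pin mult_1 mult_zero_left mult_1_right mult_zero_right diff_zero add_0 add_0_right)+
    moreover have zT: "z \<in> T" using that LT by auto
    ultimately have "h z = 0" "psi z < 0" using h[OF zT] p[OF zT] by auto
    then show False using that diag left unfolding L_def by force
  qed
  obtain k where k: "\<And>z. z \<in> L \<Longrightarrow> - pi / 2 + 2 * pi * of_int k < th z \<and> th z < - pi / 2 + 2 * pi * of_int (k + 1)"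
    using connected_avoids_angle[OF \<open>connected L\<close> continuous_on_subset[OF contth LT] avoidL] by blast
  have avoidU: "th z \<noteq> pi / 2 + 2 * pi * of_int k" if "z \<in> U" for z k
  proof
    assume e: "th z = pi / 2 + 2 * pi * of_int k"
    have "cos (th z) = cos (pi / 2)" "sin (th z) = sin (pi / 2)"
      unfolding e 
      by (metis add.commute cos_int_2pin cos_add sin_add sin_int_2pin mult_1 mult_zero_left mult_1_right mult_zero_right diff_zero add_0 add_0_right)+
    moreover have zT: "z \<in> T" using that UT by auto
    ultimately have "h z = 0" "psi z > 0" using h[OF zT] p[OF zT] by auto
    then show False using that top unfolding U_def by force
  qed
  obtain j where j: "\<And>z. z \<in> U \<Longrightarrow> pi / 2 + 2 * pi * of_int j < th z \<and> th z < pi / 2 + 2 * pi * of_int (j + 1)"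
    using connected_avoids_angle[OF \<open>connected U\<close> continuous_on_subset[OF contth UT] avoidU] by blast
  have red: "cos (x - 2 * pi * of_int i) = cos x" for x and i :: int
    using cos_int_2pin sin_int_2pin by (simp add: cos_diff)
  have L1: "th (a, b) - 2 * pi * of_int k > pi / 2"
  proof (rule ccontr)
    assume "\<not> ?thesis"
    then have "cos (th (a, b) - 2 * pi * of_int k) \<ge> 0" using k[OF c(1)] by (intro cos_ge_zero) auto
    then show False using ab red by simp
  qed
  have L2: "th (b, b) - 2 * pi * of_int k < pi / 2"
  proof (rule ccontr)
    assume *: "\<not> ?thesis"
    have "cos (th (b, b) - 2 * pi * of_int k - pi) \<ge> 0"
      using k[OF c(3)] * by (intro cos_ge_zero) (auto simp: algebra_simps)
    then show False using bb red by simp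
  qed
  have U1: "th (a, b) - 2 * pi * of_int j < 3 * pi / 2"
  proof (rule ccontr)
    assume *: "\<not> ?thesis"
    have "cos (th (a, b) - 2 * pi * of_int (j + 1)) \<ge> 0"
      using j[OF c(2)] * by (intro cos_ge_zero) (auto simp: algebra_simps)
    then show False using ab red[of "th (a, b)" "j + 1"] by simp
  qed
  have U2: "th (b, b) - 2 * pi * of_int j > 3 * pi / 2"
  proof (rule ccontr)
    assume *: "\<not> ?thesis"
    have "cos (th (b, b) - 2 * pi * of_int j - pi) \<ge> 0"
      using j[OF c(4)] * by (intro cos_ge_zero) (auto simp: algebra_simps)
    then show False using bb red by simp
  qed
  \<comment> \<open>\<open>L1\<close> and \<open>L2\<close> give
    \<open>th (b, b) < th (a, b)\<close>; \<open>U1\<close> and \<open>U2\<close> give the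
    reverse.\<close>
  show False using L1 L2 U1 U2 by linarith
qed

lemma cos_pos_imp_less_pi_half:
  assumes "\<bar>x\<bar> < 3 * pi / 2" "cos x > 0"
  shows "\<bar>x\<bar> < pi / 2"
proof (rule ccontr)
  assume "\<not> ?thesis"
  then have "cos (\<bar>x\<bar> - pi) \<ge> 0" using assms by (intro cos_ge_zero) auto
  then show False using assms by simp
qed

lemma connected_cos_pos:
  fixes f :: "'a::topological_space \<Rightarrow> real"
  assumes "connected S" "continuous_on S f" and pos: "\<And>z. z \<in> S \<Longrightarrow> cos (f z) > 0"
  shows "\<exists>k::int. \<forall>z\<in>S. \<bar>f z - 2 * pi * of_int k\<bar> < pi / 2"
proof -
  have cos_int: "cos (x - 2 * pi * of_int i) = cos x" for x and i :: int
    using cos_int_2pin sin_int_2pin by (simp add: cos_diff)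
  have "f z \<noteq> - pi + 2 * pi * of_int k" if "z \<in> S" for z k
  proof
    assume e: "f z = - pi + 2 * pi * of_int k"
    have "cos (f z) = -1" unfolding e using cos_int_2pin sin_int_2pin by (simp add: cos_diff)
    then show False using pos[OF that] by simp
  qed
  then obtain k where k: "\<And>z. z \<in> S \<Longrightarrow> - pi + 2 * pi * of_int k < f z \<and> f z < - pi + 2 * pi * of_int (k + 1)"
    using connected_avoids_angle[OF assms(1,2)] by blast
  have "\<bar>f z - 2 * pi * of_int k\<bar> < pi / 2" if "z \<in> S" for z
  proof (rule cos_pos_imp_less_pi_half)
    have "\<bar>f z - 2 * pi * of_int k\<bar> < pi"
      using k[OF that] by (simp add: abs_less_iff algebra_simps)
    then show "\<bar>f z - 2 * pi * of_int k\<bar> < 3 * pi / 2" using pi_gt_zero by linarith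
  qed (use pos that cos_int in simp)
  then show ?thesis by blast
qed

text \<open>A rough bound at a single point pins down the multiple of \<open>2 * pi\<close>: it is
  smaller than a full turn, hence zero.\<close>

lemma connected_cos_pos':
  fixes f :: "'a::topological_space \<Rightarrow> real"
  assumes "connected S" "continuous_on S f" "\<And>z. z \<in> S \<Longrightarrow> cos (f z) > 0"
    and z0: "z0 \<in> S" "\<bar>f z0\<bar> < pi" and "z \<in> S"
  shows "\<bar>f z\<bar> < pi / 2"
proof -
  obtain k :: int where k: "\<And>z. z \<in> S \<Longrightarrow> \<bar>f z - 2 * pi * of_int k\<bar> < pi / 2"
    using connected_cos_pos[OF assms(1-3)] by blast
  have "\<bar>2 * pi * of_int k\<bar> < 2 * pi" using k[OF z0(1)] z0(2) by linarith
  then have "\<bar>real_of_int k\<bar> < 1" by (simp add: abs_mult)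
  then have "k = 0" by linarith
  then show ?thesis using k[OF \<open>z \<in> S\<close>] by simp
qed

text \<open>Meant for a function \<open>B\<close> of the direction of a chord, which need not have a
  limit where the chord shrinks to a point. It stays bounded, so a factor \<open>k\<close> vanishing
  there restores continuity.\<close>

lemma continuous_on_mult_bounded:
  fixes k B :: "'a::topological_space \<Rightarrow> real"
  assumes k: "continuous_on T k" and B: "continuous_on {z \<in> T. k z \<noteq> 0} B"
    and bd: "\<And>z. z \<in> T \<Longrightarrow> \<bar>B z\<bar> \<le> 1"
  shows "continuous_on T (\<lambda>z. k z * B z)"
  unfolding continuous_on_def
proof
  fix z assume z: "z \<in> T"
  have kz: "(k \<longlongrightarrow> k z) (at z within T)" using k z by (auto simp: continuous_on_def)
  show "((\<lambda>z. k z * B z) \<longlongrightarrow> k z * B z) (at z within T)"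
  proof (cases "k z = 0")
    case True
    have "((\<lambda>z. k z * B z) \<longlongrightarrow> 0) (at z within T)"
    proof (rule Lim_null_comparison)
      show "\<forall>\<^sub>F y in at z within T. norm (k y * B y) \<le> \<bar>k y\<bar>"
        using bd by (auto simp: eventually_at_filter abs_mult mult_left_le intro!: always_eventually)
      show "((\<lambda>y. \<bar>k y\<bar>) \<longlongrightarrow> 0) (at z within T)" using tendsto_rabs[OF kz] True by simp
    qed
    then show ?thesis using True by simp
  next
    case False
    obtain A where A: "open A" "A \<inter> T = k -` (- {0}) \<inter> T"
      using k[unfolded continuous_on_open_invariant] by (metis open_Compl closed_singleton)
    have "at z within T = at z within {z \<in> T. k z \<noteq> 0}"
      by (rule at_within_nhd[of z A]) (use A z False in auto)
    moreover have "(B \<longlongrightarrow> B z) (at z within {z \<in> T. k z \<noteq> 0})"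
      using B z False by (auto simp: continuous_on_def)
    ultimately show ?thesis using kz by (intro tendsto_mult) auto
  qed
qed

section \<open>Lifted directions of the chords of a closed curve\<close>

locale closed_curve =
  fixes G :: "real \<Rightarrow> complex"
  assumes cont: "continuous_on UNIV G"
    and periodic: "G (s + 1) = G s"
    and inj: "G s = G t \<Longrightarrow> s - t \<in> \<int>"
begin

lemma periodic_int: "G (s + of_int k) = G s"
proof -
  have *: "G (s + real n) = G s" for n s
  proof (induction n)
    case (Suc n)
    then show ?case using periodic[of "s + real n"] by (simp add: ac_simps)
  qed simp
  show ?thesis
  proof (cases "k \<ge> 0")
    case True
    then show ?thesis using *[of s "nat k"] by simp
  next
    case False
    then show ?thesis using *[of "s + of_int k" "nat (- k)"] by simp
  qed
qed

lemma neq: "a < b \<Longrightarrow> b < a + 1 \<Longrightarrow> G a \<noteq> G b"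
proof
  assume "a < b" "b < a + 1" "G a = G b"
  then obtain k where "b - a = of_int k" using inj[of b a] Ints_cases by metis
  then have "0 < real_of_int k" "real_of_int k < 1" using \<open>a < b\<close> \<open>b < a + 1\<close> by linarith+
  then have "0 < k" "k < 1" by simp_all
  then show False by linarith
qed

lemma cont_comp[continuous_intros]: "continuous_on S f \<Longrightarrow> continuous_on S (\<lambda>x. G (f x))"
  by (rule continuous_on_compose2[OF cont]) auto

text \<open>\<open>w a b\<close> is a continuous argument of the chord from \<open>G a\<close> to
  \<open>G b\<close>. It exists because the strip of pairs with \<open>a < b < a + 1\<close> is
  convex and no chord vanishes there. The pair \<open>(b, a + 1)\<close> spans the opposite chord,
  which explains the odd multiple of pi in the last property.\<close>

lemma chord_angle:
  obtains w :: "real \<Rightarrow> real \<Rightarrow> real" and l :: int where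
    "\<And>S f g. continuous_on S f \<Longrightarrow> continuous_on S g \<Longrightarrow> (\<And>z. z \<in> S \<Longrightarrow> f z < g z \<and> g z < f z + 1) \<Longrightarrow>
        continuous_on S (\<lambda>z::real \<times> real. w (f z) (g z))"
    "\<And>a b c d. a < b \<Longrightarrow> b < a + 1 \<Longrightarrow> c < d \<Longrightarrow> d < c + 1 \<Longrightarrow>
        (G b - G a) \<bullet> (G d - G c) = norm (G b - G a) * norm (G d - G c) * cos (w a b - w c d)"
    "\<And>a b u. a < b \<Longrightarrow> b < a + 1 \<Longrightarrow>
        (G b - G a) \<bullet> u = norm (G b - G a) * norm u * cos (w a b - Arg u)"
    "\<And>a b. a < b \<Longrightarrow> b < a + 1 \<Longrightarrow> w b (a + 1) = w a b + pi + 2 * pi * of_int l"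
proof -
  define S where "S = {z::real \<times> real. fst z < snd z \<and> snd z < fst z + 1}"
  define F where "F z = G (snd z) - G (fst z)" for z
  have "convex S"
  proof -
    have "S = {z. inner (1, -1) z < 0} \<inter> {z. inner (-1, 1) z < 1}"
      by (auto simp: S_def inner_prod_def)
    then show ?thesis by (simp only:) (intro convex_Int convex_halfspace_lt)
  qed
  have contF: "continuous_on S F" unfolding F_def by (intro continuous_intros)
  have "F z \<noteq> 0" if "z \<in> S" for z using neq[of "fst z" "snd z"] that by (auto simp: F_def S_def)
  then obtain g where contg: "continuous_on S g" and g: "\<And>z. z \<in> S \<Longrightarrow> F z = exp (g z)"
    using continuous_logarithm_on_contractible[OF contF convex_imp_contractible[OF \<open>convex S\<close>]] by blast
  define w where "w a b = Im (g (a, b))" for a b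
  have w: "G b - G a = norm (G b - G a) * cis (w a b)" if "a < b" "b < a + 1" for a b
  proof -
    have "G b - G a = exp (g (a, b))" using g[of "(a, b)"] that by (auto simp: S_def F_def)
    then show ?thesis by (simp add: w_def norm_mult exp_eq_polar[of "g (a, b)"])
  qed
  have inner_cis: "(of_real r * cis x) \<bullet> (of_real s * cis y) = r * s * cos (x - y)" for r s x y
    by (simp add: inner_complex_def cos_diff algebra_simps)
  have contw: "continuous_on A (\<lambda>z::real \<times> real. w (f z) (g' z))"
    if "continuous_on A f" "continuous_on A g'" "\<And>z. z \<in> A \<Longrightarrow> f z < g' z \<and> g' z < f z + 1" for A f g'
  proof -
    have "continuous_on A (\<lambda>z. g (f z, g' z))"
      by (rule continuous_on_compose2[OF contg]) (use that in \<open>auto intro!: continuous_intros simp: S_def\<close>)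
    then show ?thesis unfolding w_def by (intro continuous_intros)
  qed
  have half: "\<exists>k::int. w b (a + 1) - w a b = pi + 2 * pi * of_int k" if "a < b" "b < a + 1" for a b
  proof -
    have "G (a + 1) - G b = - (G b - G a)" using periodic by simp
    moreover have "norm (G (a + 1) - G b) = norm (G b - G a)" using periodic by (simp add: norm_minus_commute)
    moreover have "norm (G b - G a) \<noteq> 0" using neq[OF that] by auto
    ultimately have "cis (w b (a + 1)) = - cis (w a b)"
      using w[OF that] w[of b "a + 1"] that by (metis add_strict_right_mono mult_cancel_left mult_minus_right of_real_eq_0_iff)
    then have "cis (w b (a + 1) - w a b - pi) = 1"
      by (metis cis_divide cis_neq_zero cis_pi divide_minus1 divide_self_if minus_divide_left minus_minus)
    then have "cos (w b (a + 1) - w a b - pi) = 1" by (simp add: complex_eq_iff)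
    then obtain k :: int where "w b (a + 1) - w a b - pi = of_int k * 2 * pi"
      by (metis cos_one_2pi_int)
    then show ?thesis by (intro exI[of _ k]) (simp add: algebra_simps)
  qed
  \<comment> \<open>A difference that is always an odd multiple of pi avoids the multiples of
    \<open>2 * pi\<close>. On the connected strip it stays between two consecutive ones, where there
    is only one odd multiple; so \<open>l\<close> does not depend on the pair.\<close>
  have "continuous_on S (\<lambda>z. w (snd z) (fst z + 1) - w (fst z) (snd z))"
    by (intro continuous_intros contw) (auto simp: S_def)
  moreover have "w (snd z) (fst z + 1) - w (fst z) (snd z) \<noteq> 0 + 2 * pi * of_int k" if "z \<in> S" for z k
  proof
    assume *: "w (snd z) (fst z + 1) - w (fst z) (snd z) = 0 + 2 * pi * of_int k"
    have "fst z < snd z" "snd z < fst z + 1" using that by (auto simp: S_def)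
    from half[OF this] obtain j :: int where "w (snd z) (fst z + 1) - w (fst z) (snd z) = pi + 2 * pi * of_int j"
      by blast
    then have "pi * (1 + 2 * of_int j - 2 * of_int k) = 0" using * by (simp add: algebra_simps)
    then have "1 + 2 * of_int j - 2 * of_int k = (0::real)" by simp
    then have "1 + 2 * j - 2 * k = 0" by linarith
    then show False by presburger
  qed
  ultimately obtain l where l: "\<And>z. z \<in> S \<Longrightarrow> 0 + 2 * pi * of_int l < w (snd z) (fst z + 1) - w (fst z) (snd z)
      \<and> w (snd z) (fst z + 1) - w (fst z) (snd z) < 0 + 2 * pi * of_int (l + 1)"
    using connected_avoids_angle[OF convex_connected[OF \<open>convex S\<close>]] by blast
  show thesis
  proof (rule that[of w l])
    fix a b c d :: real
    assume *: "a < b" "b < a + 1" "c < d" "d < c + 1"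
    show "(G b - G a) \<bullet> (G d - G c) = norm (G b - G a) * norm (G d - G c) * cos (w a b - w c d)"
      by (subst w[OF *(1,2)], subst w[OF *(3,4)]) (simp only: inner_cis)
  next
    fix a b :: real and u
    assume *: "a < b" "b < a + 1"
    have u: "u = of_real (norm u) * cis (Arg u)" using rcis_cmod_Arg[of u] by (simp add: rcis_def)
    show "(G b - G a) \<bullet> u = norm (G b - G a) * norm u * cos (w a b - Arg u)"
      by (subst w[OF *(1,2)], subst u) (simp only: inner_cis)
  next
    fix a b :: real
    assume *: "a < b" "b < a + 1"
    then obtain k where k: "w b (a + 1) - w a b = pi + 2 * pi * of_int k" using half by blast
    have "2 * pi * of_int l < pi + 2 * pi * of_int k" "pi + 2 * pi * of_int k < 2 * pi * of_int (l + 1)"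
      using l[of "(a, b)"] k * by (auto simp: S_def)
    then have "2 * pi * of_int l < 2 * pi * (of_int k + 1/2)" "2 * pi * (of_int k + 1/2) < 2 * pi * of_int (l + 1)"
      by (simp_all add: algebra_simps)
    then have "of_int l < real_of_int k + 1/2" "real_of_int k + 1/2 < of_int (l + 1)"
      by simp_all
    then have "k = l" by linarith
    then show "w b (a + 1) = w a b + pi + 2 * pi * of_int l" using k by simp
  qed (use contw in blast)
qed

text \<open>Take a point farthest from the origin: twice the inner product equals
  \<open>norm (G y) ^ 2 - norm (G c) ^ 2 - norm (G y - G c) ^ 2\<close>.\<close>

lemma exposed_point:
  obtains c where "0 \<le> c" "c \<le> 1" "\<And>y. c < y \<Longrightarrow> y < c + 1 \<Longrightarrow> (G y - G c) \<bullet> G c < 0"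
proof -
  have "continuous_on {0..1} (\<lambda>x. norm (G x))" by (intro continuous_intros)
  then obtain c where c: "c \<in> {0..1}" and max: "\<And>y. y \<in> {0..1} \<Longrightarrow> norm (G y) \<le> norm (G c)"
    using continuous_attains_sup[of "{0..1::real}" "\<lambda>x. norm (G x)"] by fastforce
  show thesis
  proof (rule that[of c])
    fix y assume y: "c < y" "y < c + 1"
    have "norm (G y) = norm (G (frac y))" using periodic_int[of y "- \<lfloor>y\<rfloor>"] by (simp add: frac_def)
    then have "norm (G y) \<le> norm (G c)" using max[of "frac y"] by (simp add: frac_lt_1 less_imp_le)
    then have "G y \<bullet> G y \<le> G c \<bullet> G c" by (simp add: norm_le)
    moreover have "0 < (G y - G c) \<bullet> (G y - G c)" using neq[OF y] by auto
    ultimately show "(G y - G c) \<bullet> G c < 0" by (simp add: inner_diff inner_commute)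
  qed (use c in auto)
qed

text \<open>In the configuration diagram (human parameter against puppy parameter) the graph of
  p2 lies in the region where the puppy is pulled backwards, that of p1 in the region where
  it is pulled forwards.\<close>

lemma no_crossing_curves:
  assumes "0 < e" and c1: "continuous_on {-1..2} p1" and c2: "continuous_on {-1..2} p2"
    and p: "\<And>x. x \<in> {-1..2} \<Longrightarrow> x < p1 x \<and> p1 x < p2 x \<and> p2 x + e < x + 1"
    and d1: "\<And>x. x \<in> {-1..2} \<Longrightarrow> dist (G x) (G (p1 x + e)) < dist (G x) (G (p1 x))"
    and d2: "\<And>x. x \<in> {-1..2} \<Longrightarrow> dist (G x) (G (p2 x)) < dist (G x) (G (p2 x + e))"
  shows False
proof -
  obtain w l where
    cw: "\<And>S f g. continuous_on S f \<Longrightarrow> continuous_on S g \<Longrightarrow> (\<And>z. z \<in> S \<Longrightarrow> f z < g z \<and> g z < f z + 1) \<Longrightarrow>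
        continuous_on S (\<lambda>z::real \<times> real. w (f z) (g z))"
    and ww: "\<And>a b c d. a < b \<Longrightarrow> b < a + 1 \<Longrightarrow> c < d \<Longrightarrow> d < c + 1 \<Longrightarrow>
        (G b - G a) \<bullet> (G d - G c) = norm (G b - G a) * norm (G d - G c) * cos (w a b - w c d)"
    and wu: "\<And>a b u. a < b \<Longrightarrow> b < a + 1 \<Longrightarrow>
        (G b - G a) \<bullet> u = norm (G b - G a) * norm u * cos (w a b - Arg u)"
    and wl: "\<And>a b. a < b \<Longrightarrow> b < a + 1 \<Longrightarrow> w b (a + 1) = w a b + pi + 2 * pi * of_int l"
    using chord_angle by blast
  obtain c where c: "0 \<le> c" "c \<le> 1" and exp: "\<And>y. c < y \<Longrightarrow> y < c + 1 \<Longrightarrow> (G y - G c) \<bullet> G c < 0"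
    using exposed_point by blast
  \<comment> \<open>\<open>cw\<close> speaks of functions of two real variables; a dummy second
    coordinate transfers it to one variable.\<close>
  have cw1: "continuous_on S (\<lambda>z. w (f z) (g z))"
    if "continuous_on S f" "continuous_on S g" "\<And>z. z \<in> S \<Longrightarrow> f z < g z \<and> g z < f z + 1"
    for S :: "real set" and f g
  proof -
    have "continuous_on (S \<times> {0}) (\<lambda>z::real \<times> real. w (f (fst z)) (g (fst z)))"
      by (rule cw) (auto intro!: that(3) continuous_on_compose2[OF that(1)] continuous_on_compose2[OF that(2)] continuous_intros)
    then have "continuous_on S (\<lambda>x. (\<lambda>z::real \<times> real. w (f (fst z)) (g (fst z))) (x, 0))"
      by (rule continuous_on_compose2) (auto intro!: continuous_intros)
    then show ?thesis by simp
  qed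
  have cos_int: "cos (x + 2 * pi * of_int i) = cos x" for x and i :: int
    using cos_int_2pin sin_int_2pin by (simp add: cos_add)
  have ww_pos: "cos (w a b - w c d) > 0 \<longleftrightarrow> (G b - G a) \<bullet> (G d - G c) > 0"
    if "a < b" "b < a + 1" "c < d" "d < c + 1" for a b c d
    using ww[OF that] neq[OF that(1,2)] neq[OF that(3,4)] by (auto simp: zero_less_mult_iff mult_less_0_iff)
  have "e < 1" using p[of 0] by auto
  have bisector: "(dist X Q)\<^sup>2 - (dist X P)\<^sup>2 = (Q - P) \<bullet> (Q - X) + (Q - P) \<bullet> (P - X)" for X P Q :: complex
    by (simp add: dist_norm power2_norm_eq_inner algebra_simps inner_commute)
  have QX: "(Q - X) \<bullet> (Q - P) > 0" if "dist X P < dist X Q" for X P Q :: complex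
  proof -
    have "(dist X P)\<^sup>2 < (dist X Q)\<^sup>2" using that by (intro power_strict_mono) auto
    then have "0 < (Q - P) \<bullet> (Q - X) + (Q - P) \<bullet> (P - X)" using bisector[of X Q P] by linarith
    moreover have "(Q - P) \<bullet> (P - X) = (Q - P) \<bullet> (Q - X) - (Q - P) \<bullet> (Q - P)"
      by (simp add: algebra_simps)
    moreover have "0 \<le> (Q - P) \<bullet> (Q - P)" by simp
    ultimately show ?thesis by (subst inner_commute) linarith
  qed
  have chord: "(Y - X) \<bullet> (Q - P) > 0" if "dist X P < dist X Q" "dist Y Q < dist Y P" for X Y P Q :: complex
  proof -
    have "(dist X P)\<^sup>2 < (dist X Q)\<^sup>2" "(dist Y Q)\<^sup>2 < (dist Y P)\<^sup>2"
      using that by (intro power_strict_mono; simp)+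
    then have "0 < (Q - P) \<bullet> (Q - X) + (Q - P) \<bullet> (P - X) - ((Q - P) \<bullet> (Q - Y) + (Q - P) \<bullet> (P - Y))"
      using bisector[of X Q P] bisector[of Y Q P] by linarith
    also have "\<dots> = 2 * ((Y - X) \<bullet> (Q - P))" by (simp add: algebra_simps inner_commute)
    finally show ?thesis by simp
  qed

  \<comment> \<open>\<open>th\<close> is a lift of the direction opposite to \<open>G c\<close>, the
    axis of the half plane containing all chords from \<open>G c\<close>. Reversing chords with
    \<open>wl\<close> carries the bound over to chords that end at \<open>c\<close> or touch
    \<open>c + 1\<close>.\<close>
  obtain th where th: "\<And>y. c < y \<Longrightarrow> y < c + 1 \<Longrightarrow> \<bar>w c y - th\<bar> < pi / 2"
  proof -
    have "cos (w c y - Arg (G c) - pi) > 0" if "y \<in> {c<..<c + 1}" for y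
      using wu[of c y "G c"] exp[of y] that by (auto simp: mult_less_0_iff)
    moreover have "continuous_on {c<..<c + 1} (\<lambda>y. w c y - Arg (G c) - pi)"
      by (intro continuous_intros cw1) auto
    ultimately obtain k :: int where "\<forall>y\<in>{c<..<c + 1}. \<bar>w c y - Arg (G c) - pi - 2 * pi * of_int k\<bar> < pi / 2"
      using connected_cos_pos[of "{c<..<c + 1}" "\<lambda>y. w c y - Arg (G c) - pi"] by fastforce
    then show thesis by (intro that[of "Arg (G c) + pi + 2 * pi * of_int k"]) (auto simp: algebra_simps)
  qed
  have th2: "\<bar>w y c - (th - pi - 2 * pi * of_int l)\<bar> < pi / 2" if "c - 1 < y" "y < c" for y
    using wl[of y c] th[of "y + 1"] that by (auto simp: algebra_simps)
  have th3: "\<bar>w s (c + 1) - (th + pi + 2 * pi * of_int l)\<bar> < pi / 2" if "c < s" "s < c + 1" for s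
    using wl[of c s] th[of s] that by (auto simp: algebra_simps)
  have th4: "\<bar>w (c + 1) q - (th + 2 * pi + 4 * pi * of_int l)\<bar> < pi / 2" if "c + 1 < q" "q < c + 2" for q
    using wl[of c "q - 1"] wl[of "q - 1" "c + 1"] th[of "q - 1"] that by (auto simp: algebra_simps)

  \<comment> \<open>The left half of the window provides human positions whose puppy position is
    exactly \<open>c\<close>, the right half carries the triangle below. As \<open>c\<close> lies in
    \<open>{0..1}\<close>, the window fits into \<open>{-1..2}\<close>.\<close>
  define I where "I = {c - 1..c + 1}"
  have I: "I \<subseteq> {-1..2}" "connected I" using c by (auto simp: I_def)
  note p = p[OF subsetD[OF I(1)]] and d1 = d1[OF subsetD[OF I(1)]] and d2 = d2[OF subsetD[OF I(1)]]
    and [continuous_intros] = continuous_on_subset[OF c1 I(1)] continuous_on_subset[OF c2 I(1)]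

  have c': "continuous_on {c - 1..c} p1" "continuous_on {c - 1..c} p2"
    using c by (auto intro!: continuous_on_subset[OF c1] continuous_on_subset[OF c2])

  \<comment> \<open>The chord from the human to the advanced puppy position makes an acute angle
    with the short chord between the two puppy positions. The lift is fixed where the advanced
    position is \<open>c\<close>, since both chords end there.\<close>
  have A: "\<bar>w x (p2 x + e) - w (p2 x) (p2 x + e)\<bar> < pi / 2" if "x \<in> I" for x
  proof -
    have "\<exists>x\<ge>c - 1. x \<le> c \<and> p2 x + e = c"
      by (rule IVT') (use p[of "c - 1"] p[of c] \<open>0 < e\<close> in
          \<open>auto simp: I_def intro!: continuous_intros c'\<close>)
    then obtain x0 where x0: "c - 1 \<le> x0" "x0 \<le> c" "p2 x0 + e = c" by blast
    have "x0 \<in> I" using x0 by (auto simp: I_def)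
    show ?thesis
    proof (rule connected_cos_pos'[OF I(2) _ _ \<open>x0 \<in> I\<close> _ that])
      show "continuous_on I (\<lambda>x. w x (p2 x + e) - w (p2 x) (p2 x + e))"
        by (intro continuous_intros cw1) (use p \<open>0 < e\<close> \<open>e < 1\<close> in force)+
      show "0 < cos (w x (p2 x + e) - w (p2 x) (p2 x + e))" if "x \<in> I" for x
        using ww_pos[of x "p2 x + e" "p2 x" "p2 x + e"] QX[OF d2[OF that]] p[OF that] \<open>0 < e\<close> \<open>e < 1\<close> by auto
      have "c - 1 < x0" "x0 < c" using p[OF \<open>x0 \<in> I\<close>] x0 \<open>0 < e\<close> by auto
      then have "\<bar>w x0 c - (th - pi - 2 * pi * of_int l)\<bar> < pi / 2" by (rule th2)
      moreover have "p2 x0 < c" "c - 1 < p2 x0" using x0 \<open>0 < e\<close> \<open>e < 1\<close> by auto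
      then have "\<bar>w (p2 x0) c - (th - pi - 2 * pi * of_int l)\<bar> < pi / 2" by (intro th2)
      ultimately show "\<bar>w x0 (p2 x0 + e) - w (p2 x0) (p2 x0 + e)\<bar> < pi" unfolding x0(3) by linarith
    qed
  qed

  \<comment> \<open>On \<open>p1\<close> the chord from the human to the puppy makes an obtuse angle
    with the short chord. The lift is fixed where the puppy is at \<open>c\<close>: one chord ends
    and the other starts there.\<close>
  have C: "\<bar>w (p1 x) (p1 x + e) - w x (p1 x) - 2 * pi * of_int l - pi\<bar> < pi / 2" if "x \<in> I" for x
  proof -
    have "\<exists>x\<ge>c - 1. x \<le> c \<and> p1 x = c"
      by (rule IVT') (use p[of "c - 1"] p[of c] \<open>0 < e\<close> in
          \<open>auto simp: I_def intro!: continuous_intros c'\<close>)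
    then obtain x0 where x0: "c - 1 \<le> x0" "x0 \<le> c" "p1 x0 = c" by blast
    have "x0 \<in> I" using x0 by (auto simp: I_def)
    show ?thesis
    proof (rule connected_cos_pos'[OF I(2) _ _ \<open>x0 \<in> I\<close> _ that])
      show "continuous_on I (\<lambda>x. w (p1 x) (p1 x + e) - w x (p1 x) - 2 * pi * of_int l - pi)"
        by (intro continuous_intros cw1) (use p \<open>0 < e\<close> \<open>e < 1\<close> in force)+
      show "0 < cos (w (p1 x) (p1 x + e) - w x (p1 x) - 2 * pi * of_int l - pi)" if "x \<in> I" for x
      proof -
        have "x < p1 x" "p1 x < x + 1" using p[OF that] \<open>0 < e\<close> by auto
        have "(G (p1 x) - G x) \<bullet> (G (p1 x + e) - G (p1 x)) < 0"
          using QX[OF d1[OF that]] by (simp add: algebra_simps inner_commute)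
        then have "cos (w x (p1 x) - w (p1 x) (p1 x + e)) < 0"
          using ww[OF \<open>x < p1 x\<close> \<open>p1 x < x + 1\<close>, of "p1 x" "p1 x + e"] \<open>0 < e\<close> \<open>e < 1\<close>
          by (auto simp: mult_less_0_iff)
        moreover have "w (p1 x) (p1 x + e) - w x (p1 x) - 2 * pi * of_int l - pi
            = - (w x (p1 x) - w (p1 x) (p1 x + e) + pi + 2 * pi * of_int l)" by simp
        ultimately show ?thesis by (simp only: cos_minus cos_int) simp
      qed
      have "c - 1 < x0" "x0 < c" using p[OF \<open>x0 \<in> I\<close>] x0 \<open>0 < e\<close> by auto
      then have "\<bar>w x0 c - (th - pi - 2 * pi * of_int l)\<bar> < pi / 2" by (rule th2)
      moreover have "\<bar>w c (c + e) - th\<bar> < pi / 2" using \<open>0 < e\<close> \<open>e < 1\<close> by (intro th) auto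
      ultimately show "\<bar>w (p1 x0) (p1 x0 + e) - w x0 (p1 x0) - 2 * pi * of_int l - pi\<bar> < pi"
        unfolding x0(3) by linarith
    qed
  qed

  define T where "T = {(s, t). c \<le> s \<and> s \<le> t \<and> t \<le> c + 1}"
  \<comment> \<open>A zero \<open>(s, t)\<close> is a pair of human positions, \<open>s\<close> on
    the second and \<open>t\<close> on the first curve, with a common puppy position.\<close>
  define h where "h z = p2 (fst z) - p1 (snd z)" for z
  \<comment> \<open>Vanishes on the diagonal and at the corner \<open>(c, c + 1)\<close>, exactly
    where \<open>s\<close> and \<open>t\<close> do not span a chord.\<close>
  define k where "k z = (snd z - fst z) * (1 - (snd z - fst z))" for z :: "real \<times> real"
  \<comment> \<open>At the zeros of \<open>h\<close> the full angle is within \<open>pi / 2\<close>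
    of a whole number of turns; the sign of \<open>B\<close> is the parity of that number.\<close>
  define B where "B z = cos ((w (fst z) (snd z) - w (p2 (fst z)) (p2 (fst z) + e)) / 2)" for z
  define psi where "psi z = k z * B z" for z
  have TI: "fst ` T \<subseteq> I" "snd ` T \<subseteq> I" by (auto simp: T_def I_def)
  have comp: "continuous_on T (\<lambda>z. p2 (fst z))" "continuous_on T (\<lambda>z. p1 (snd z))"
    using TI by (auto intro!: continuous_intros continuous_on_compose2[OF c1] continuous_on_compose2[OF c2]
        dest: subsetD[OF I(1)])
  have "continuous_on T h" unfolding h_def by (intro continuous_intros comp)
  moreover have "continuous_on T psi"
    unfolding psi_def
  proof (rule continuous_on_mult_bounded)
    show "continuous_on T k" unfolding k_def by (intro continuous_intros)
    have "fst z < snd z \<and> snd z < fst z + 1" if "z \<in> T" "k z \<noteq> 0" for z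
      using that by (cases z) (auto simp: T_def k_def order.order_iff_strict)
    then show "continuous_on {z \<in> T. k z \<noteq> 0} B"
      unfolding B_def using \<open>0 < e\<close> \<open>e < 1\<close>
      by (intro continuous_intros cw continuous_on_subset[OF comp(1)]) auto
  qed (simp add: B_def)
  moreover have "h (s, s) > 0" if "s \<in> {c..c + 1}" for s
    using p[of s] that by (auto simp: h_def I_def)
  moreover have "h (c, c + 1) < 0"
    using p[of c] p[of "c + 1"] \<open>0 < e\<close> by (auto simp: h_def I_def)
  moreover have zeros: "s < t \<and> t < s + 1 \<and> t < p2 s \<and> p2 s + e < s + 1 \<and> k (s, t) > 0 \<and>
      0 < cos (w s t - w (p2 s) (p2 s + e))"
    if "(s, t) \<in> T" "h (s, t) = 0" for s t
  proof -
    have st: "s \<in> I" "t \<in> I" using that TI by force+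
    have *: "p2 s = p1 t" using that by (simp add: h_def)
    have "s \<noteq> t" using p[OF st(1)] * by auto
    then have "s < t" using that by (auto simp: T_def)
    have "t < p2 s" "p2 s + e < s + 1" using p[OF st(2)] p[OF st(1)] * by auto
    have "0 < (G t - G s) \<bullet> (G (p2 s + e) - G (p2 s))"
      using chord[OF d2[OF st(1)] d1[OF st(2), folded *]] .
    then show ?thesis
      using ww_pos[of s t "p2 s" "p2 s + e"] \<open>s < t\<close> \<open>t < p2 s\<close> \<open>p2 s + e < s + 1\<close> \<open>0 < e\<close> \<open>e < 1\<close>
      by (auto simp: k_def)
  qed
  \<comment> \<open>Chords starting at \<open>c\<close> are within \<open>pi / 2\<close> of
    \<open>th\<close>. Together with \<open>A\<close> this bounds the angle by
    \<open>3 * pi / 2\<close>, which leaves zero turns.\<close>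
  have "psi (c, t) > 0" if "t \<in> {c..c + 1}" "h (c, t) = 0" for t
  proof -
    have T: "(c, t) \<in> T" using that by (auto simp: T_def)
    note z = zeros[OF T that(2)]
    have "\<bar>w c (p2 c + e) - w (p2 c) (p2 c + e)\<bar> < pi / 2" by (rule A) (auto simp: I_def)
    moreover have "\<bar>w c (p2 c + e) - th\<bar> < pi / 2" "\<bar>w c t - th\<bar> < pi / 2"
      using z \<open>0 < e\<close> th[of "p2 c + e"] th[of t] by linarith+
    ultimately have "\<bar>w c t - w (p2 c) (p2 c + e)\<bar> < 3 * pi / 2" by linarith
    then have "\<bar>w c t - w (p2 c) (p2 c + e)\<bar> < pi / 2" using z by (intro cos_pos_imp_less_pi_half) auto
    moreover have "- (pi / 2) < d / 2 \<and> d / 2 < pi / 2" if "\<bar>d\<bar> < pi / 2" for d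
      using that pi_gt_zero by linarith
    ultimately have "cos ((w c t - w (p2 c) (p2 c + e)) / 2) > 0" using cos_gt_zero_pi by blast
    then have "B (c, t) > 0" by (simp add: B_def)
    then show ?thesis using z by (simp add: psi_def)
  qed
  moreover have "psi (s, c + 1) < 0" if "s \<in> {c..c + 1}" "h (s, c + 1) = 0" for s
  proof -
    have T: "(s, c + 1) \<in> T" using that by (auto simp: T_def)
    note z = zeros[OF T that(2)]
    have *: "p2 s = p1 (c + 1)" using that by (simp add: h_def)
    have 1: "\<bar>w (p2 s) (p2 s + e) - w (c + 1) (p2 s) - 2 * pi * of_int l - pi\<bar> < pi / 2"
      using C[of "c + 1"] unfolding * by (auto simp: I_def)
    have 2: "\<bar>w (c + 1) (p2 s) - (th + 2 * pi + 4 * pi * of_int l)\<bar> < pi / 2"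
      using z that \<open>0 < e\<close> by (intro th4) auto
    have 3: "\<bar>w s (c + 1) - (th + pi + 2 * pi * of_int l)\<bar> < pi / 2"
      using z that by (intro th3) auto
    \<comment> \<open>By \<open>C\<close>, \<open>th3\<close> and \<open>th4\<close> the angle is
      within \<open>3 * pi / 2\<close> of \<open>- 2 * pi * (2 * l + 1)\<close>, an odd number of
      turns whatever \<open>l\<close> is.\<close>
    define X where "X = w s (c + 1) - w (p2 s) (p2 s + e) + 2 * pi * of_int (2 * l + 1)"
    have X: "X = w s (c + 1) - w (p2 s) (p2 s + e) + 4 * (pi * of_int l) + 2 * pi"
      by (simp add: X_def algebra_simps)
    have "\<bar>X\<bar> < 3 * pi / 2" using 1 2 3 X by linarith
    moreover have "cos X > 0" unfolding X_def cos_int using z by simp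
    ultimately have "\<bar>X\<bar> < pi / 2" by (rule cos_pos_imp_less_pi_half)
    then have "- (pi / 2) < X / 2" "X / 2 < pi / 2"
      using pi_gt_zero by linarith+
    then have "cos (X / 2) > 0" by (rule cos_gt_zero_pi)
    moreover have "(w s (c + 1) - w (p2 s) (p2 s + e)) / 2 = X / 2 - pi + 2 * pi * of_int (- l)"
      by (simp add: X_def field_simps)
    ultimately have "B (s, c + 1) < 0" unfolding B_def by (simp only: fst_conv snd_conv cos_int) simp
    then show ?thesis using z by (simp add: psi_def mult_pos_neg)
  qed
  ultimately obtain z where z: "z \<in> T" "h z = 0" "psi z = 0"
    using triangle_common_zero[of c "c + 1" h psi] unfolding T_def by auto
  obtain s t where st: "z = (s, t)" by (cases z)
  note z' = zeros[OF z(1,2)[unfolded st]]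
  \<comment> \<open>A positive cosine of the angle keeps the cosine of its half away from zero, so
    \<open>psi\<close> has no zero among the zeros of \<open>h\<close>.\<close>
  have cos_half: "cos d = 2 * (cos (d / 2))\<^sup>2 - 1" for d :: real
    using cos_double_cos[of "d / 2"] by simp
  have "cos (w s t - w (p2 s) (p2 s + e)) = 2 * (B (s, t))\<^sup>2 - 1"
    unfolding B_def fst_conv snd_conv by (rule cos_half)
  then have "B (s, t) \<noteq> 0" using z' by auto
  then show False using z z' by (auto simp: st psi_def)
qed

end

section \<open>Distance to a point along a piecewise linear curve\<close>

text \<open>Piecewise linearity is expressed by a linear piece on either side of every parameter.
  This form names no vertices and is preserved when the track is reversed.\<close>

locale pl_track = closed_curve +
  assumes pl: "\<exists>b c u v. b < a \<and> a < c \<and> (\<forall>s\<in>{b..a}. G s = G a + (s - a) *\<^sub>R u)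
    \<and> (\<forall>s\<in>{a..c}. G s = G a + (s - a) *\<^sub>R v)"
begin

abbreviation phi :: "real \<Rightarrow> real \<Rightarrow> real" where "phi \<equiv> dist_fun G"

definition seg :: "real \<Rightarrow> real \<Rightarrow> complex \<Rightarrow> bool" where
  "seg a b v \<longleftrightarrow> a < b \<and> v \<noteq> 0 \<and> (\<forall>s\<in>{a..b}. \<forall>t\<in>{a..b}. G t - G s = (t - s) *\<^sub>R v)"

definition inc :: "real \<Rightarrow> real \<Rightarrow> real \<Rightarrow> bool" where
  "inc x a b \<longleftrightarrow> (\<forall>u v. a \<le> u \<and> u < v \<and> v \<le> b \<longrightarrow> phi x u < phi x v)"

definition dec :: "real \<Rightarrow> real \<Rightarrow> real \<Rightarrow> bool" where
  "dec x a b \<longleftrightarrow> (\<forall>u v. a \<le> u \<and> u < v \<and> v \<le> b \<longrightarrow> phi x v < phi x u)"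

text \<open>Up to a positive factor, the derivative of the squared distance at \<open>p\<close> in direction \<open>v\<close>.\<close>
definition slope :: "real \<Rightarrow> real \<Rightarrow> complex \<Rightarrow> real" where
  "slope x p v = (G p - G x) \<bullet> v"

lemma cont_phi[continuous_intros]: "continuous_on S f \<Longrightarrow> continuous_on S (\<lambda>z. phi x (f z))"
  unfolding dist_fun_def by (intro continuous_intros)

lemma tendsto_G: "(f \<longlongrightarrow> l) F \<Longrightarrow> ((\<lambda>z. G (f z)) \<longlongrightarrow> G l) F"
  by (rule isCont_tendsto_compose[of l G]) (use cont in \<open>auto simp: continuous_on_eq_continuous_at\<close>)

lemma tendsto_slope:
  "(f \<longlongrightarrow> x) F \<Longrightarrow> (g \<longlongrightarrow> p) F \<Longrightarrow> ((\<lambda>z. slope (f z) (g z) v) \<longlongrightarrow> slope x p v) F"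
  unfolding slope_def by (intro tendsto_intros tendsto_G)

lemma eventually_slope_neg: "slope x p v < 0 \<Longrightarrow> \<forall>\<^sub>F y in nhds x. slope y p v < 0"
  by (erule order_tendstoD(2)[rotated]) (intro tendsto_slope tendsto_const filterlim_ident)

lemma segs_at:
  obtains b c u v where "seg b a u" "seg a c v"
proof -
  obtain b c u v where bc: "b < a \<and> a < c \<and> (\<forall>s\<in>{b..a}. G s = G a + (s - a) *\<^sub>R u)
    \<and> (\<forall>s\<in>{a..c}. G s = G a + (s - a) *\<^sub>R v)" using pl[of a] by (elim exE) (rule that)
  note * = bc[THEN conjunct1] bc[THEN conjunct2, THEN conjunct1]
    bc[THEN conjunct2, THEN conjunct2, THEN conjunct1] bc[THEN conjunct2, THEN conjunct2, THEN conjunct2]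
  \<comment> \<open>At most half a lap, so that a zero velocity would contradict
    injectivity.\<close>
  define b' c' where "b' = max b (a - 1/2)" and "c' = min c (a + 1/2)"
  have "b' < a" "a < c'" using *(1,2) by (auto simp: b'_def c'_def)
  have u: "G s = G a + (s - a) *\<^sub>R u" if "s \<in> {b'..a}" for s
    by (rule *(3)[rule_format]) (use that in \<open>simp add: b'_def\<close>)
  have v: "G s = G a + (s - a) *\<^sub>R v" if "s \<in> {a..c'}" for s
    by (rule *(4)[rule_format]) (use that in \<open>simp add: c'_def\<close>)
  have "G t - G s = (t - s) *\<^sub>R u" if "s \<in> {b'..a}" "t \<in> {b'..a}" for s t
    unfolding u[OF that(1)] u[OF that(2)] by (simp add: algebra_simps)
  moreover have "G t - G s = (t - s) *\<^sub>R v" if "s \<in> {a..c'}" "t \<in> {a..c'}" for s t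
    unfolding v[OF that(1)] v[OF that(2)] by (simp add: algebra_simps)
  moreover have "u \<noteq> 0"
  proof
    assume "u = 0"
    then have "G b' = G a" using u[of b'] \<open>b' < a\<close> by simp
    moreover have "a < b' + 1" by (simp add: b'_def max_def)
    ultimately show False using neq[of b' a] \<open>b' < a\<close> by simp
  qed
  moreover have "v \<noteq> 0"
  proof
    assume "v = 0"
    then have "G c' = G a" using v[of c'] \<open>a < c'\<close> by simp
    moreover have "c' < a + 1" by (simp add: c'_def min_def)
    ultimately show False using neq[of a c'] \<open>a < c'\<close> by simp
  qed
  ultimately show thesis
    using that[of b' u c' v] \<open>b' < a\<close> \<open>a < c'\<close> by (simp add: seg_def)
qed

lemma seg_less: "seg a b v \<Longrightarrow> a < b" and seg_nz: "seg a b v \<Longrightarrow> v \<noteq> 0"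
  by (auto simp: seg_def)

lemma seg_sub: "seg a b v \<Longrightarrow> a \<le> a' \<Longrightarrow> a' < b' \<Longrightarrow> b' \<le> b \<Longrightarrow> seg a' b' v"
  by (auto simp: seg_def)

lemma slope_seg:
  assumes "seg a b v" "s \<in> {a..b}" "t \<in> {a..b}"
  shows "slope x t v = slope x s v + (t - s) * (v \<bullet> v)"
proof -
  have "slope x t v - slope x s v = (G t - G s) \<bullet> v" by (simp add: slope_def inner_diff_left)
  also have "G t - G s = (t - s) *\<^sub>R v" using assms unfolding seg_def by blast
  finally show ?thesis by simp
qed

text \<open>Difference of squares: on a segment the two squared distances differ by
  \<open>t - s\<close> times the sum of the two slopes.\<close>

lemma phi_less_iff:
  assumes "seg a b v" "s \<in> {a..b}" "t \<in> {a..b}" "s < t"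
  shows "phi x s < phi x t \<longleftrightarrow> 0 < slope x s v + slope x t v"
proof -
  have "phi x s < phi x t \<longleftrightarrow> (G s - G x) \<bullet> (G s - G x) < (G t - G x) \<bullet> (G t - G x)"
    by (simp add: dist_fun_def dist_norm norm_minus_commute[of "G x"] norm_lt)
  also have "\<dots> \<longleftrightarrow> 0 < (G t - G s) \<bullet> ((G s - G x) + (G t - G x))"
    by (simp only: inner_add_right inner_diff_left inner_diff_right) (simp add: inner_commute, linarith)
  also have "G t - G s = (t - s) *\<^sub>R v" using assms unfolding seg_def by blast
  also have "0 < (t - s) *\<^sub>R v \<bullet> ((G s - G x) + (G t - G x)) \<longleftrightarrow> 0 < slope x s v + slope x t v"
    using \<open>s < t\<close>
    by (simp only: inner_scaleR_left inner_add_right slope_def inner_commute[of v] distrib_left[symmetric] zero_less_mult_iff) simp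
  finally show ?thesis .
qed

lemma phi_greater_iff:
  assumes "seg a b v" "s \<in> {a..b}" "t \<in> {a..b}" "s < t"
  shows "phi x t < phi x s \<longleftrightarrow> slope x s v + slope x t v < 0"
proof -
  have "phi x t < phi x s \<longleftrightarrow> (G t - G x) \<bullet> (G t - G x) < (G s - G x) \<bullet> (G s - G x)"
    by (simp add: dist_fun_def dist_norm norm_minus_commute[of "G x"] norm_lt)
  also have "\<dots> \<longleftrightarrow> (G t - G s) \<bullet> ((G s - G x) + (G t - G x)) < 0"
    by (simp only: inner_add_right inner_diff_left inner_diff_right) (simp add: inner_commute, linarith)
  also have "G t - G s = (t - s) *\<^sub>R v" using assms unfolding seg_def by blast
  also have "(t - s) *\<^sub>R v \<bullet> ((G s - G x) + (G t - G x)) < 0 \<longleftrightarrow> slope x s v + slope x t v < 0"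
    using \<open>s < t\<close>
    by (simp only: inner_scaleR_left inner_add_right slope_def inner_commute[of v] distrib_left[symmetric] mult_less_0_iff) simp
  finally show ?thesis .
qed

lemma seg_inc: 
  assumes "seg a b v" "0 \<le> slope x a v" shows "inc x a b"
  unfolding inc_def
proof (intro allI impI)
  fix s t assume *: "a \<le> s \<and> s < t \<and> t \<le> b"
  have "0 \<le> slope x s v" "0 < slope x t v"
    using slope_seg[OF assms(1), of a s x] slope_seg[OF assms(1), of a t x] assms(2) * seg_nz[OF assms(1)]
    by (auto intro!: add_nonneg_pos)
  then show "phi x s < phi x t" using phi_less_iff[OF assms(1), of s t x] * by auto
qed

lemma seg_dec: 
  assumes "seg a b v" "slope x b v \<le> 0" shows "dec x a b"
  unfolding dec_def
proof (intro allI impI)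
  fix s t assume *: "a \<le> s \<and> s < t \<and> t \<le> b"
  have "slope x s v < 0" "slope x t v \<le> 0"
    using slope_seg[OF assms(1), of b s x] slope_seg[OF assms(1), of b t x] assms(2) * seg_nz[OF assms(1)]
    by (auto intro!: add_nonpos_neg add_nonpos_nonpos mult_neg_pos mult_nonpos_nonneg)
  then show "phi x t < phi x s" using phi_greater_iff[OF assms(1), of s t x] * by auto
qed

text \<open>At \<open>a\<close> itself the slope may vanish, and then a small move of the human can
  make it positive. Short of \<open>a\<close> it is strictly negative, which persists.\<close>

lemma seg_dec_robust:
  assumes "seg b a u" "slope x a u \<le> 0" "b < c" "c < a"
  shows "\<forall>\<^sub>F y in nhds x. dec y b c"
proof -
  have "slope x c u = slope x a u + (c - a) * (u \<bullet> u)"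
    using assms by (intro slope_seg[OF assms(1)]) auto
  moreover have "(c - a) * (u \<bullet> u) < 0" using assms seg_nz by (intro mult_neg_pos) auto
  ultimately have "slope x c u < 0" using assms(2) by linarith
  then show ?thesis
    by (rule eventually_mono[OF eventually_slope_neg])
      (use assms seg_sub[OF assms(1), of b c] in \<open>auto intro: seg_dec\<close>)
qed

lemma seg_dec_short:
  assumes "seg a c v" "slope x a v < 0"
  obtains c' where "a < c'" "c' \<le> c" "\<forall>\<^sub>F y in nhds x. dec y a c'"
proof -
  have "v \<bullet> v > 0" using seg_nz[OF assms(1)] by simp
  \<comment> \<open>Up to here the slope has lost at most half of its negative value at
    \<open>a\<close>.\<close>
  define c' where "c' = min c (a - slope x a v / (2 * (v \<bullet> v)))"
  have c': "a < c'" "c' \<le> c" using seg_less[OF assms(1)] assms(2) \<open>v \<bullet> v > 0\<close>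
    by (auto simp: c'_def field_simps)
  have "slope x c' v = slope x a v + (c' - a) * (v \<bullet> v)"
    using c' by (intro slope_seg[OF assms(1)]) auto
  also have "(c' - a) * (v \<bullet> v) \<le> (- slope x a v / (2 * (v \<bullet> v))) * (v \<bullet> v)"
    using \<open>v \<bullet> v > 0\<close> by (intro mult_right_mono) (auto simp: c'_def)
  also have "\<dots> = - slope x a v / 2" using \<open>v \<bullet> v > 0\<close> by simp
  finally have "slope x c' v < 0" using assms(2) by simp
  then have "\<forall>\<^sub>F y in nhds x. dec y a c'"
    by (rule eventually_mono[OF eventually_slope_neg])
      (use c' seg_sub[OF assms(1), of a c'] in \<open>auto intro: seg_dec\<close>)
  then show thesis using that c' by blast
qed

lemma not_locmin_inc: "inc x a b \<Longrightarrow> a < p \<Longrightarrow> p \<le> b \<Longrightarrow> \<not> locmin (phi x) p"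
proof
  assume *: "inc x a b" "a < p" "p \<le> b" "locmin (phi x) p"
  then obtain e where e: "e > 0" "\<And>s. \<bar>s - p\<bar> < e \<Longrightarrow> phi x p \<le> phi x s" by (auto simp: locmin_def)
  have "phi x p \<le> phi x (max a (p - e/2))" using e(1) * by (intro e(2)) auto
  moreover have "phi x (max a (p - e/2)) < phi x p" using * e(1) by (auto simp: inc_def)
  ultimately show False by simp
qed

lemma not_locmin_dec: "dec x a b \<Longrightarrow> a \<le> p \<Longrightarrow> p < b \<Longrightarrow> \<not> locmin (phi x) p"
proof
  assume *: "dec x a b" "a \<le> p" "p < b" "locmin (phi x) p"
  then obtain e where e: "e > 0" "\<And>s. \<bar>s - p\<bar> < e \<Longrightarrow> phi x p \<le> phi x s" by (auto simp: locmin_def)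
  have "phi x p \<le> phi x (min b (p + e/2))" using e(1) * by (intro e(2)) auto
  moreover have "phi x (min b (p + e/2)) < phi x p" using * e(1) by (auto simp: dec_def)
  ultimately show False by simp
qed

lemma locminI:
  assumes "dec x a p" "inc x p b" "a < p" "p < b"
  shows "locmin (phi x) p"
  unfolding locmin_def
proof (intro exI conjI allI impI)
  show "min (p - a) (b - p) > 0" using assms by auto
  fix s assume *: "\<bar>s - p\<bar> < min (p - a) (b - p)"
  show "phi x p \<le> phi x s"
  proof (cases s p rule: linorder_cases)
    case less
    then have "phi x p < phi x s" using assms(1) * by (auto simp: dec_def)
    then show ?thesis by simp
  next
    case greater
    then have "phi x p < phi x s" using assms(2) * by (auto simp: inc_def)
    then show ?thesis by simp
  qed simp
qed

lemma locmin_slope_right: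
  assumes "locmin (phi x) p" "seg p c v" shows "0 \<le> slope x p v"
proof (rule ccontr)
  assume "\<not> ?thesis"
  then have "slope x p v < 0" by simp
  then obtain c' where c': "p < c'" "\<forall>\<^sub>F y in nhds x. dec y p c'" using seg_dec_short[OF assms(2)] by blast
  have "dec x p c'" using eventually_nhds_x_imp_x[OF c'(2)] .
  then show False using not_locmin_dec[of x p c' p] assms(1) c'(1) by simp
qed

lemma inc_short:
  assumes "seg b a u" "slope x a u > 0"
  obtains b' where "b \<le> b'" "b' < a" "inc x b' a"
proof -
  have "u \<bullet> u > 0" using seg_nz[OF assms(1)] by simp
  define q where "q = slope x a u / (u \<bullet> u)"
  have q: "q * (u \<bullet> u) = slope x a u" "q > 0" using \<open>u \<bullet> u > 0\<close> assms(2) by (simp_all add: q_def)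
  define b' where "b' = max b (a - q)"
  have b': "b' < a" "b \<le> b'" "a - b' \<le> q" using seg_less[OF assms(1)] q by (auto simp: b'_def)
  have "slope x b' u = slope x a u + (b' - a) * (u \<bullet> u)"
    by (rule slope_seg[OF assms(1)]) (use b' in auto)
  also have "\<dots> = (q - (a - b')) * (u \<bullet> u)" by (simp add: q left_diff_distrib)
  finally have "0 \<le> slope x b' u" using \<open>u \<bullet> u > 0\<close> b' by simp
  then have "inc x b' a" using b' seg_sub[OF assms(1), of b' a] by (auto intro: seg_inc)
  then show thesis using that b' by blast
qed

lemma locmin_slope_left:
  assumes "locmin (phi x) p" "seg b p u" shows "slope x p u \<le> 0"
proof (rule ccontr)
  assume "\<not> ?thesis"
  then have "0 < slope x p u" by simp
  then obtain b' where "b' < p" "inc x b' p" using inc_short[OF assms(2)] by blast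
  then show False using not_locmin_inc[of x b' p p] assms(1) by blast
qed

lemma locmin_iff:
  assumes "seg b p u" "seg p c v"
  shows "locmin (phi x) p \<longleftrightarrow> slope x p u \<le> 0 \<and> 0 \<le> slope x p v"
proof
  assume "locmin (phi x) p"
  then show "slope x p u \<le> 0 \<and> 0 \<le> slope x p v"
    using locmin_slope_right[OF _ assms(2)] locmin_slope_left[OF _ assms(1)] by simp
next
  assume "slope x p u \<le> 0 \<and> 0 \<le> slope x p v"
  then show "locmin (phi x) p"
    using locminI[OF seg_dec[OF assms(1)] seg_inc[OF assms(2)]] seg_less[OF assms(1)] seg_less[OF assms(2)] by simp
qed

lemma locmin_inside:
  assumes "seg a b v" "a < p" "p < b"
  shows "locmin (phi x) p \<longleftrightarrow> slope x p v = 0"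
proof -
  have s: "seg a p v" "seg p b v" using seg_sub[OF assms(1)] assms(2,3) by simp_all
  show ?thesis unfolding locmin_iff[OF s] by auto
qed

text \<open>Whatever the signs of the one-sided slopes, the distance is strictly monotone for a
  while on either side of \<open>p\<close>. This makes suprema of sets of stable positions
  attained.\<close>

lemma locmin_isolated:
  "\<exists>e>0. \<forall>y. y \<noteq> p \<and> \<bar>y - p\<bar> < e \<longrightarrow> \<not> locmin (phi x) y"
proof -
  obtain b c u v where s: "seg b p u" "seg p c v" by (rule segs_at[of p])
  have "\<exists>c'>p. inc x p c' \<or> dec x p c'"
  proof (cases "slope x p v < 0")
    case True
    then obtain c' where c': "p < c'" "\<forall>\<^sub>F y in nhds x. dec y p c'" using seg_dec_short[OF s(2)] by blast
    then show ?thesis using eventually_nhds_x_imp_x[OF c'(2)] by blast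
  next
    case False
    then have "inc x p c" by (intro seg_inc[OF s(2)]) simp
    then show ?thesis using seg_less[OF s(2)] by blast
  qed
  then obtain c' where c': "c' > p" "inc x p c' \<or> dec x p c'" by blast
  have "\<exists>b'<p. inc x b' p \<or> dec x b' p"
  proof (cases "slope x p u > 0")
    case True
    then show ?thesis using inc_short[OF s(1)] by metis
  next
    case False
    then have "dec x b p" by (intro seg_dec[OF s(1)]) simp
    then show ?thesis using seg_less[OF s(1)] by blast
  qed
  then obtain b' where b': "b' < p" "inc x b' p \<or> dec x b' p" by blast
  show ?thesis
  proof (intro exI conjI allI impI)
    show "0 < min (p - b') (c' - p)" using b'(1) c'(1) by simp
    fix y assume "y \<noteq> p \<and> \<bar>y - p\<bar> < min (p - b') (c' - p)"
    then consider "b' < y" "y < p" | "p < y" "y < c'" by linarith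
    then show "\<not> locmin (phi x) y"
    proof cases
      case 1
      then show ?thesis using b'(2) not_locmin_inc[of x b' p y] not_locmin_dec[of x b' p y] by linarith
    next
      case 2
      then show ?thesis using c'(2) not_locmin_inc[of x p c' y] not_locmin_dec[of x p c' y] by linarith
    qed
  qed
qed

lemma phi_periodic: "phi x (p + 1) = phi x p"
  using periodic by (simp add: dist_fun_def)

lemma dec_extend:
  assumes "dec x a b" "dec x b c" shows "dec x a c"
  unfolding dec_def
proof (intro allI impI)
  fix s t assume *: "a \<le> s \<and> s < t \<and> t \<le> c"
  show "phi x t < phi x s"
  proof (cases "s < b \<and> b < t")
    case True
    then have "phi x b < phi x s" "phi x t < phi x b" using assms * by (auto simp: dec_def)
    then show ?thesis by simp
  next
    case False
    then show ?thesis using assms * by (auto simp: dec_def)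
  qed
qed

lemma inc_extend:
  assumes "inc x a b" "inc x b c" shows "inc x a c"
  unfolding inc_def
proof (intro allI impI)
  fix s t assume *: "a \<le> s \<and> s < t \<and> t \<le> c"
  show "phi x s < phi x t"
  proof (cases "s < b \<and> b < t")
    case True
    then have "phi x s < phi x b" "phi x b < phi x t" using assms * by (auto simp: inc_def)
    then show ?thesis by simp
  next
    case False
    then show ?thesis using assms * by (auto simp: inc_def)
  qed
qed

end

section \<open>Runs of the puppy\<close>

text \<open>Consider the infimum of the times at which \<open>f\<close> is below \<open>c\<close>.
  Right continuity forces \<open>f < c\<close> already there, while the left limit is still at least
  \<open>c\<close>; such a jump is excluded by \<open>left\<close>.\<close>

lemma barrier:
  fixes f c :: "real \<Rightarrow> real"
  assumes c: "continuous_on {0..1} c"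
    and right: "\<And>t. t \<in> {0..<1} \<Longrightarrow> (f \<longlongrightarrow> f t) (at_right t)"
    and left: "\<And>t. t \<in> {0<..1} \<Longrightarrow> \<exists>l. (f \<longlongrightarrow> l) (at_left t) \<and> (c t \<le> l \<longrightarrow> c t \<le> f t)"
    and neq: "\<And>t. t \<in> {0..1} \<Longrightarrow> f t \<noteq> c t"
    and start: "c 0 < f 0" and t: "t \<in> {0..1}"
  shows "c t < f t"
proof (rule ccontr)
  assume "\<not> c t < f t"
  define S where "S = {t \<in> {0..1}. f t < c t}"
  have "S \<noteq> {}" using t neq[OF t] \<open>\<not> c t < f t\<close> by (force simp: S_def)
  have bdd: "bdd_below S" by (auto simp: S_def intro: bdd_belowI[of _ 0])
  define a where "a = Inf S"
  have "a \<in> {0..1}"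
  proof -
    obtain s where "s \<in> S" using \<open>S \<noteq> {}\<close> by blast
    then have "a \<le> 1" using cInf_lower[OF _ bdd, of s] by (auto simp: S_def a_def)
    moreover have "0 \<le> a" unfolding a_def using \<open>S \<noteq> {}\<close> by (intro cInf_greatest) (auto simp: S_def)
    ultimately show ?thesis by simp
  qed
  have cc: "(c \<longlongrightarrow> c a) (at a within {0..1})" using c \<open>a \<in> {0..1}\<close> by (auto simp: continuous_on_def)
  have before: "c s < f s" if "0 \<le> s" "s < a" for s
    using that cInf_lower[OF _ bdd, of s] neq[of s] \<open>a \<in> {0..1}\<close> by (force simp: S_def a_def)
  have "f a < c a"
  proof (rule ccontr)
    assume "\<not> f a < c a"
    then have "c a < f a" using neq[OF \<open>a \<in> {0..1}\<close>] by simp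
    have "a \<notin> S" using \<open>\<not> f a < c a\<close> by (simp add: S_def)
    obtain s0 where "s0 \<in> S" using \<open>S \<noteq> {}\<close> by blast
    then have "a \<le> s0" using cInf_lower[OF _ bdd] by (simp add: a_def)
    then have "a < s0" using \<open>a \<notin> S\<close> \<open>s0 \<in> S\<close> by (metis order_le_less)
    then have "a < 1" using \<open>s0 \<in> S\<close> by (simp add: S_def)
    have "(c \<longlongrightarrow> c a) (at a within {a..1})"
      by (rule tendsto_within_subset[OF cc]) (use \<open>a \<in> {0..1}\<close> in auto)
    then have "(c \<longlongrightarrow> c a) (at_right a)" using \<open>a < 1\<close> by (simp add: at_within_Icc_at_right)
    moreover have "(f \<longlongrightarrow> f a) (at_right a)" using right \<open>a < 1\<close> \<open>a \<in> {0..1}\<close> by simp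
    ultimately have "\<forall>\<^sub>F s in at_right a. 0 < f s - c s"
      using \<open>c a < f a\<close> by (intro order_tendstoD(1)[of _ "f a - c a"] tendsto_diff) auto
    then obtain b where b: "b > a" "\<And>s. a < s \<Longrightarrow> s < b \<Longrightarrow> c s < f s"
      by (auto simp: eventually_at_right_field)
    have "b \<le> a" unfolding a_def
    proof (rule cInf_greatest[OF \<open>S \<noteq> {}\<close>])
      fix s assume "s \<in> S"
      then have "a \<le> s" "f s < c s" using cInf_lower[OF _ bdd] by (auto simp: S_def a_def)
      then show "b \<le> s" using b(2)[of s] \<open>a \<notin> S\<close> \<open>s \<in> S\<close> by (metis less_asym not_le order_le_less)
    qed
    then show False using b(1) by simp
  qed
  then have "0 < a" using start \<open>a \<in> {0..1}\<close> by (cases "a = 0") auto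
  obtain l where l: "(f \<longlongrightarrow> l) (at_left a)" "c a \<le> l \<longrightarrow> c a \<le> f a"
    using left[of a] \<open>0 < a\<close> \<open>a \<in> {0..1}\<close> by auto
  have "(c \<longlongrightarrow> c a) (at a within {0..a})"
    by (rule tendsto_within_subset[OF cc]) (use \<open>a \<in> {0..1}\<close> in auto)
  then have "(c \<longlongrightarrow> c a) (at_left a)" using \<open>0 < a\<close> by (simp add: at_within_Icc_at_left)
  moreover have "\<forall>\<^sub>F s in at_left a. c s \<le> f s"
    using before \<open>0 < a\<close> by (auto simp: eventually_at_left_field intro!: exI[of _ 0] less_imp_le)
  ultimately have "c a \<le> l"
    by (intro tendsto_le[OF _ l(1)]) (auto simp: trivial_limit_at_left_real)
  then show False using l(2) \<open>f a < c a\<close> by simp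
qed

lemma locmin_reflect: "locmin (\<lambda>s. f (- s)) p \<longleftrightarrow> locmin f (- p)"
proof -
  have "(\<forall>s. \<bar>s - p\<bar> < e \<longrightarrow> f (- p) \<le> f (- s)) \<longleftrightarrow> (\<forall>s. \<bar>s + p\<bar> < e \<longrightarrow> f (- p) \<le> f s)" for e
  proof (intro iffI allI impI)
    fix s assume *: "\<forall>s. \<bar>s - p\<bar> < e \<longrightarrow> f (- p) \<le> f (- s)" "\<bar>s + p\<bar> < e"
    have "\<bar>- s - p\<bar> < e" using *(2) by linarith
    then show "f (- p) \<le> f s" using *(1)[rule_format, of "- s"] by simp
  next
    fix s assume *: "\<forall>s. \<bar>s + p\<bar> < e \<longrightarrow> f (- p) \<le> f s" "\<bar>s - p\<bar> < e"
    have "\<bar>- s + p\<bar> < e" using *(2) by linarith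
    then show "f (- p) \<le> f (- s)" using *(1)[rule_format, of "- s"] by simp
  qed
  then show ?thesis by (simp add: locmin_def)
qed

lemma puppy_run_reflect: "puppy_run (\<lambda>s. f (- s)) a b \<longleftrightarrow> puppy_run f (- a) (- b)"
proof -
  have all_minus: "(\<forall>u v. P u v) \<longleftrightarrow> (\<forall>u v. P (- v) (- u))" for P :: "real \<Rightarrow> real \<Rightarrow> bool"
    by (metis minus_minus)
  show ?thesis
    unfolding puppy_run_def locmin_reflect
    by (subst (1 2) all_minus) (auto simp: minus_le_iff le_minus_iff)
qed

context pl_track
begin

lemma puppy_run_cases:
  "puppy_run (phi x) a b \<longleftrightarrow> (b = a \<or> a < b \<and> dec x a b \<or> b < a \<and> inc x b a) \<and> locmin (phi x) b"
  by (auto simp: puppy_run_def dec_def inc_def)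

lemma run_from_locmin: "puppy_run (phi x) a b \<Longrightarrow> locmin (phi x) a \<Longrightarrow> b = a"
  using not_locmin_dec[of x a b a] not_locmin_inc[of x b a a] by (auto simp: puppy_run_cases)

lemma dec_limit:
  assumes "\<And>y. a < y \<Longrightarrow> y < b \<Longrightarrow> dec x a y" shows "dec x a b"
  unfolding dec_def
proof (intro allI impI)
  fix s t assume *: "a \<le> s \<and> s < t \<and> t \<le> b"
  show "phi x t < phi x s"
  proof (cases "t < b")
    case True
    then show ?thesis using assms[of t] * by (auto simp: dec_def)
  next
    case False
    then have "t = b" using * by simp
    define m where "m = (s + b) / 2"
    have m: "s < m" "m < b" "a < m" using * \<open>t = b\<close> by (auto simp: m_def)
    have "phi x m < phi x s" using assms[OF m(3,2)] m * by (auto simp: dec_def)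
    moreover have "phi x b \<le> phi x m"
    proof (rule tendsto_upperbound)
      have "continuous_on UNIV (phi x)" by (intro continuous_intros)
      then have "(phi x \<longlongrightarrow> phi x b) (at b)" by (auto simp: continuous_on_eq_continuous_at isCont_def)
      then show "(phi x \<longlongrightarrow> phi x b) (at_left b)" by (rule tendsto_within_subset) simp
      have "phi x y < phi x m" if "m < y" "y < b" for y
        using assms[of y] that m by (auto simp: dec_def)
      then show "\<forall>\<^sub>F y in at_left b. phi x y \<le> phi x m"
        using \<open>m < b\<close> by (auto simp: eventually_at_left_field intro!: exI[of _ m] less_imp_le)
    qed simp
    ultimately show ?thesis using \<open>t = b\<close> by simp
  qed
qed

lemma inc_limit:
  assumes "\<And>y. a < y \<Longrightarrow> y < b \<Longrightarrow> inc x a y" shows "inc x a b"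
  unfolding inc_def
proof (intro allI impI)
  fix s t assume *: "a \<le> s \<and> s < t \<and> t \<le> b"
  show "phi x s < phi x t"
  proof (cases "t < b")
    case True
    then show ?thesis using assms[of t] * by (auto simp: inc_def)
  next
    case False
    then have "t = b" using * by simp
    define m where "m = (s + b) / 2"
    have m: "s < m" "m < b" "a < m" using * \<open>t = b\<close> by (auto simp: m_def)
    have "phi x s < phi x m" using assms[OF m(3,2)] m * by (auto simp: inc_def)
    moreover have "phi x m \<le> phi x b"
    proof (rule tendsto_lowerbound)
      have "continuous_on UNIV (phi x)" by (intro continuous_intros)
      then have "(phi x \<longlongrightarrow> phi x b) (at b)" by (auto simp: continuous_on_eq_continuous_at isCont_def)
      then show "(phi x \<longlongrightarrow> phi x b) (at_left b)" by (rule tendsto_within_subset) simp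
      have "phi x m < phi x y" if "m < y" "y < b" for y
        using assms[of y] that m by (auto simp: inc_def)
      then show "\<forall>\<^sub>F y in at_left b. phi x m \<le> phi x y"
        using \<open>m < b\<close> by (auto simp: eventually_at_left_field intro!: exI[of _ m] less_imp_le)
    qed simp
    ultimately show ?thesis using \<open>t = b\<close> by simp
  qed
qed

lemma inc_sub: "inc x a b \<Longrightarrow> a \<le> a' \<Longrightarrow> b' \<le> b \<Longrightarrow> inc x a' b'"
  by (auto simp: inc_def)

lemma dec_sub: "dec x a b \<Longrightarrow> a \<le> a' \<Longrightarrow> b' \<le> b \<Longrightarrow> dec x a' b'"
  by (auto simp: dec_def)

section \<open>Existence of runs and of a peak above a stable position\<close>

text \<open>The run ends at the supremum of the points up to which the distance decreases; this is
  at most a lap away, because a lap restores the distance. There the right slope cannot be negative,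
  or the decrease would continue.\<close>

lemma run_exists_dec:
  assumes "dec x a c'" "a < c'"
  shows "\<exists>b. puppy_run (phi x) a b"
proof -
  define S where "S = {y. a < y \<and> dec x a y}"
  have "c' \<in> S" using assms by (simp add: S_def)
  have up: "y \<le> a + 1" if "y \<in> S" for y
  proof (rule ccontr)
    assume "\<not> y \<le> a + 1"
    then have "phi x (a + 1) < phi x a" using that by (auto simp: S_def dec_def)
    then show False using phi_periodic by simp
  qed
  then have bdd: "bdd_above S" by (rule bdd_aboveI)
  define z where "z = Sup S"
  have "c' \<le> z" unfolding z_def using \<open>c' \<in> S\<close> bdd by (rule cSup_upper)
  then have "a < z" using assms(2) by simp
  have "dec x a z"
  proof (rule dec_limit)
    fix y assume "a < y" "y < z"
    then obtain y' where y': "y' \<in> S" "y < y'" using less_cSupD[of S y] \<open>c' \<in> S\<close> unfolding z_def by blast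
    then have "dec x a y'" by (simp add: S_def)
    then show "dec x a y" by (rule dec_sub) (use y' in simp_all)
  qed
  obtain b c u v where s: "seg b z u" "seg z c v" by (rule segs_at[of z])
  have "\<not> slope x z v < 0"
  proof
    assume "slope x z v < 0"
    then obtain z' where z': "z < z'" "\<forall>\<^sub>F y in nhds x. dec y z z'" using seg_dec_short[OF s(2)] by blast
    then have "dec x a z'" using dec_extend[OF \<open>dec x a z\<close>] eventually_nhds_x_imp_x[OF z'(2)] by simp
    then have "z' \<le> z" unfolding z_def using \<open>a < z\<close> z' by (intro cSup_upper bdd) (auto simp: S_def)
    then show False using z' by simp
  qed
  then have "inc x z c" using seg_inc[OF s(2)] by simp
  then have "locmin (phi x) z" using locminI[OF \<open>dec x a z\<close> _ \<open>a < z\<close> seg_less[OF s(2)]] by simp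
  then show ?thesis using \<open>dec x a z\<close> \<open>a < z\<close> by (auto simp: puppy_run_cases)
qed

lemma reflected: "pl_track (\<lambda>s. G (- s))"
proof
  show "continuous_on UNIV (\<lambda>s. G (- s))" by (intro continuous_intros)
  show "G (- (s + 1)) = G (- s)" for s using periodic[of "- s - 1"] by simp
  show "s - t \<in> \<int>" if "G (- s) = G (- t)" for s t
    using inj[OF that] by (metis Ints_minus minus_diff_eq minus_diff_minus)
  show "\<exists>b c u v. b < a \<and> a < c \<and> (\<forall>s\<in>{b..a}. G (- s) = G (- a) + (s - a) *\<^sub>R u)
    \<and> (\<forall>s\<in>{a..c}. G (- s) = G (- a) + (s - a) *\<^sub>R v)" for a
  proof -
    obtain b c u v where s: "seg b (- a) u" "seg (- a) c v" by (rule segs_at[of "- a"])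
    have "\<forall>s\<in>{- c..a}. G (- s) = G (- a) + (s - a) *\<^sub>R (- v)"
    proof
      fix s assume "s \<in> {- c..a}"
      then have "G (- s) - G (- a) = (- s - (- a)) *\<^sub>R v" using s(2) by (simp add: seg_def)
      then show "G (- s) = G (- a) + (s - a) *\<^sub>R (- v)" by (simp add: algebra_simps)
    qed
    moreover have "\<forall>s\<in>{a..- b}. G (- s) = G (- a) + (s - a) *\<^sub>R (- u)"
    proof
      fix s assume "s \<in> {a..- b}"
      then have "G (- s) - G (- a) = (- s - (- a)) *\<^sub>R u" using s(1) by (simp add: seg_def)
      then show "G (- s) = G (- a) + (s - a) *\<^sub>R (- u)" by (simp add: algebra_simps)
    qed
    moreover have "- c < a" "a < - b" using seg_less[OF s(1)] seg_less[OF s(2)] by simp_all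
    ultimately show ?thesis by blast
  qed
qed

lemma run_exists: "\<exists>b. puppy_run (phi x) a b"
proof (cases "locmin (phi x) a")
  case True
  then show ?thesis by (auto simp: puppy_run_cases)
next
  case False
  interpret R: pl_track "\<lambda>s. G (- s)" by (rule reflected)
  obtain b c u v where s: "seg b a u" "seg a c v" by (rule segs_at[of a])
  consider "slope x a v < 0" | "slope x a u > 0"
    using False unfolding locmin_iff[OF s] by linarith
  then show ?thesis
  proof cases
    case 1
    then obtain c' where c': "a < c'" "\<forall>\<^sub>F y in nhds x. dec y a c'" by (rule seg_dec_short[OF s(2)])
    then show ?thesis using run_exists_dec eventually_nhds_x_imp_x by blast
  next
    case 2
    then obtain b' where b': "b' < a" "inc x b' a" by (rule inc_short[OF s(1)])
    have "R.dec (- x) (- a) (- b')"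
      unfolding R.dec_def
    proof (intro allI impI)
      fix u v assume "- a \<le> u \<and> u < v \<and> v \<le> - b'"
      then have "phi x (- v) < phi x (- u)" using b'(2) by (simp add: inc_def)
      then show "R.phi (- x) v < R.phi (- x) u" by (simp add: dist_fun_def)
    qed
    then obtain z where "puppy_run (R.phi (- x)) (- a) z" using R.run_exists_dec b'(1) by fastforce
    moreover have "R.phi (- x) = (\<lambda>s. phi x (- s))" by (simp add: dist_fun_def fun_eq_iff)
    ultimately have "puppy_run (phi x) a (- z)" by (simp add: puppy_run_reflect)
    then show ?thesis by blast
  qed
qed

text \<open>The distance is zero at \<open>x + 1\<close>, so an increase that starts at
  \<open>p\<close> stops before. It stops where the right slope is negative.\<close>

lemma next_max:
  assumes "locmin (phi x) p" "x < p" "p < x + 1"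
  obtains M M' where "p < M" "M < x + 1" "inc x p M" "M < M'" "dec x M M'"
proof -
  have pos: "phi x (x + 1) < phi x p"
    using neq[OF assms(2,3)] periodic by (simp add: dist_fun_def)
  obtain b c u v where s: "seg b p u" "seg p c v" by (rule segs_at[of p])
  define S where "S = {y. p < y \<and> inc x p y}"
  have "inc x p c" using locmin_slope_right[OF assms(1) s(2)] seg_inc[OF s(2)] by simp
  then have "c \<in> S" using seg_less[OF s(2)] by (simp add: S_def)
  have up: "y < x + 1" if "y \<in> S" for y
  proof (rule ccontr)
    assume "\<not> y < x + 1"
    then have "phi x p < phi x (x + 1)" using that assms by (auto simp: S_def inc_def)
    then show False using pos by simp
  qed
  then have bdd: "bdd_above S" using less_imp_le by (intro bdd_aboveI[of _ "x + 1"]) blast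
  define z where "z = Sup S"
  have "c \<le> z" unfolding z_def using \<open>c \<in> S\<close> bdd by (rule cSup_upper)
  then have "p < z" using seg_less[OF s(2)] by simp
  have "inc x p z"
  proof (rule inc_limit)
    fix y assume "p < y" "y < z"
    then obtain y' where y': "y' \<in> S" "y < y'" using less_cSupD[of S y] \<open>c \<in> S\<close> unfolding z_def by blast
    then have "inc x p y'" by (simp add: S_def)
    then show "inc x p y" by (rule inc_sub) (use y' in simp_all)
  qed
  then have "z \<in> S" using \<open>p < z\<close> by (simp add: S_def)
  obtain b c u v where s: "seg b z u" "seg z c v" by (rule segs_at[of z])
  have "slope x z v < 0"
  proof (rule ccontr)
    assume "\<not> slope x z v < 0"
    then have "inc x z c" using seg_inc[OF s(2)] by simp
    then have "c \<in> S" using inc_extend[OF \<open>inc x p z\<close>] seg_less[OF s(2)] \<open>p < z\<close> by (simp add: S_def)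
    then have "c \<le> z" unfolding z_def using bdd by (rule cSup_upper)
    then show False using seg_less[OF s(2)] by simp
  qed
  then obtain z' where z': "z < z'" "\<forall>\<^sub>F y in nhds x. dec y z z'" using seg_dec_short[OF s(2)] by blast
  show thesis
    by (rule that[OF \<open>p < z\<close> up[OF \<open>z \<in> S\<close>] \<open>inc x p z\<close> z'(1) eventually_nhds_x_imp_x[OF z'(2)]])
qed

end

section \<open>Existence of responses\<close>

text \<open>Applied to the slopes at a fixed puppy position: for small positive times that position
  is either always or never stable.\<close>

lemma affine_sign:
  fixes A B :: real
  shows "\<exists>d>0. \<forall>t t'. 0 < t \<and> t < d \<and> 0 < t' \<and> t' < d \<and> A + t * B \<le> 0 \<longrightarrow> A + t' * B \<le> 0"
proof (cases "A = 0")
  case True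
  then show ?thesis by (intro exI[of _ 1]) (auto simp: mult_le_0_iff)
next
  case False
  define d where "d = \<bar>A\<bar> / (\<bar>B\<bar> + 1)"
  have "d > 0" using False by (simp add: d_def)
  have small: "\<bar>t * B\<bar> < \<bar>A\<bar>" if "0 < t" "t < d" for t
  proof -
    have "\<bar>t * B\<bar> \<le> t * (\<bar>B\<bar> + 1)" using that by (simp add: abs_mult)
    also have "\<dots> < d * (\<bar>B\<bar> + 1)" using that by (intro mult_strict_right_mono) auto
    also have "\<dots> = \<bar>A\<bar>" by (simp add: d_def)
    finally show ?thesis .
  qed
  have "A + t' * B \<le> 0" if "0 < t" "t < d" "0 < t'" "t' < d" "A + t * B \<le> 0" for t t'
    using small[OF that(1,2)] small[OF that(3,4)] that(5) by linarith
  then show ?thesis using \<open>d > 0\<close> by blast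
qed

text \<open>Up to sign the expression is the slope at time \<open>t\<close> of the walk and offset
  \<open>s\<close> of the puppy, with \<open>V\<close> the squared speed of the segment. If
  \<open>A\<close> is nonzero, small terms cannot cancel it; otherwise the zeros form a ray. The
  bound \<open>m\<close> keeps the ray on the segment.\<close>

lemma affine_zero_branch:
  fixes A B V m :: real
  assumes "V > 0" "m > 0"
  shows "\<exists>d>0. \<exists>e>0. \<forall>t s. 0 < t \<and> t < d \<and> 0 < s \<and> s < e \<and> A + t * B + s * V = 0 \<longrightarrow>
    A = 0 \<and> s = (- B / V) * t \<and> 0 < - B / V \<and> (- B / V) * d \<le> m"
proof (cases "A = 0")
  case True
  define d where "d = m * V / (\<bar>B\<bar> + 1)"
  have "d > 0" using assms by (simp add: d_def)
  have "s = (- B / V) * t \<and> 0 < - B / V \<and> (- B / V) * d \<le> m" if "0 < t" "0 < s" "t * B + s * V = 0" for t s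
  proof (intro conjI)
    show s: "s = (- B / V) * t" using that assms by (simp add: field_simps)
    then have "0 < (- B / V) * t" using that(2) by (simp only:)
    then show "0 < - B / V" using that(1) by (rule zero_less_mult_pos2)
    have "(- B / V) * d = m * (- B / (\<bar>B\<bar> + 1))" using assms by (simp add: d_def)
    also have "- B / (\<bar>B\<bar> + 1) \<le> 1" by (subst divide_le_eq_1_pos) linarith+
    then have "m * (- B / (\<bar>B\<bar> + 1)) \<le> m * 1" using assms by (intro mult_left_mono) auto
    finally show "(- B / V) * d \<le> m" by simp
  qed
  then show ?thesis using \<open>d > 0\<close> True by (intro exI[of _ d] conjI exI[of _ 1]) auto
next
  case False
  define d where "d = \<bar>A\<bar> / 3 / (\<bar>B\<bar> + 1)"
  define e where "e = \<bar>A\<bar> / (3 * V)"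
  have pos: "d > 0" "e > 0" using False assms by (simp_all add: d_def e_def)
  have "A + t * B + s * V \<noteq> 0" if "0 < t" "t < d" "0 < s" "s < e" for t s
  proof -
    have "\<bar>t * B\<bar> \<le> t * (\<bar>B\<bar> + 1)" using that by (simp add: abs_mult)
    also have "\<dots> < d * (\<bar>B\<bar> + 1)" using that by (intro mult_strict_right_mono) auto
    also have "\<bar>B\<bar> + 1 \<noteq> 0" by linarith
    then have "d * (\<bar>B\<bar> + 1) = \<bar>A\<bar> / 3"
      by (rule nonzero_eq_divide_eq[THEN iffD1]) (simp only: d_def)
    finally have 1: "\<bar>t * B\<bar> < \<bar>A\<bar> / 3" .
    have "s * V < e * V" using that assms by simp
    also have "\<dots> = \<bar>A\<bar> / 3" using assms by (simp add: e_def)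
    finally have 2: "s * V < \<bar>A\<bar> / 3" .
    have "0 < s * V" using that assms by simp
    then show ?thesis using 1 2 False by linarith
  qed
  then show ?thesis using pos by (intro exI[of _ d] conjI exI[of _ e]) auto
qed

context pl_track
begin

text \<open>The final time is left out of the hypothesis: the arc may end at a point that is no
  longer stable, and a run is appended there.\<close>

lemma response_along_arc:
  assumes "\<And>t. 0 \<le> t \<Longrightarrow> t < 1 \<Longrightarrow> locmin (phi (x + t * d)) (q + k * t)"
  shows "\<exists>f. puppy_response G x d q f"
proof -
  obtain r where r: "puppy_run (phi (x + d)) (q + k) r" using run_exists by blast
  define f where "f t = (if t < 1 then q + k * t else r)" for t
  have lim: "((\<lambda>t. q + k * t) \<longlongrightarrow> q + k * t) (at t within S)" for t S
    by (intro tendsto_intros)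
  have "locmin (phi (x + t * d)) (f t)" if "t \<in> {0..1}" for t
    using assms[of t] r that by (cases "t = 1") (auto simp: f_def puppy_run_cases)
  moreover have "(f \<longlongrightarrow> f t) (at_right t)" if "t \<in> {0..<1}" for t
  proof (rule Lim_transform_eventually)
    show "((\<lambda>t. q + k * t) \<longlongrightarrow> f t) (at_right t)" using lim that by (simp add: f_def)
    show "\<forall>\<^sub>F s in at_right t. q + k * s = f s"
      using that by (auto simp: eventually_at_right_field f_def intro!: exI[of _ 1])
  qed
  moreover have "\<exists>l. (f \<longlongrightarrow> l) (at_left t) \<and> puppy_run (phi (x + t * d)) l (f t)" if "t \<in> {0<..1}" for t
  proof (intro exI conjI)
    show "(f \<longlongrightarrow> q + k * t) (at_left t)"
    proof (rule Lim_transform_eventually[OF lim])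
      show "\<forall>\<^sub>F s in at_left t. q + k * s = f s"
        using that by (auto simp: eventually_at_left_field f_def intro!: exI[of _ 0])
    qed
    show "puppy_run (phi (x + t * d)) (q + k * t) (f t)"
      using assms[of t] r that by (cases "t = 1") (auto simp: f_def puppy_run_cases)
  qed
  moreover have "puppy_run (phi x) q (f 0)" using assms[of 0] by (simp add: f_def puppy_run_cases)
  ultimately have "puppy_response G x d q f" by (simp add: puppy_response_def)
  then show ?thesis by blast
qed

text \<open>The human leaves \<open>x\<close> in direction \<open>sg\<close> with velocity
  \<open>w\<close>. A stable position near \<open>p\<close> is \<open>p\<close> itself or a foot
  point on one of the adjacent segments, and foot points move linearly in time. Since
  \<open>d\<close> is chosen before \<open>t\<close> and \<open>y\<close>, the arc through
  \<open>y\<close> is stable all the way back to time 0, exclusively.\<close>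

lemma local_arcs:
  assumes "0 < d0" and w: "\<And>t. 0 \<le> t \<Longrightarrow> t \<le> d0 \<Longrightarrow> G (x + sg * t) = G x + t *\<^sub>R w"
  shows "\<exists>d>0. \<exists>e>0. \<forall>t y. 0 < t \<and> t < d \<and> \<bar>y - p\<bar> < e \<and> locmin (phi (x + sg * t)) y \<longrightarrow>
    (\<exists>k. y = p + k * t \<and> (\<forall>t'. 0 < t' \<and> t' < d \<longrightarrow> locmin (phi (x + sg * t')) (p + k * t')))"
proof -
  obtain b c u v where s: "seg b p u" "seg p c v" by (rule segs_at[of p])
  have slope_w: "slope (x + sg * t) y z = slope x y z + t * (- (w \<bullet> z))" if "0 \<le> t" "t \<le> d0" for t y z
    by (simp add: slope_def w[OF that] inner_diff_left inner_add_left)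
  have V: "v \<bullet> v > 0" "u \<bullet> u > 0" using seg_nz[OF s(1)] seg_nz[OF s(2)] by simp_all
  have len: "(c - p) / 2 > 0" "(p - b) / 2 > 0" using seg_less[OF s(1)] seg_less[OF s(2)] by simp_all
  then have len2: "(c - p) / 2 < c - p" "(p - b) / 2 < p - b" by simp_all
  obtain d1 e1 where right: "d1 > 0" "e1 > 0"
    "\<And>t r. 0 < t \<Longrightarrow> t < d1 \<Longrightarrow> 0 < r \<Longrightarrow> r < e1 \<Longrightarrow> slope x p v + t * (- (w \<bullet> v)) + r * (v \<bullet> v) = 0 \<Longrightarrow>
      slope x p v = 0 \<and> r = (- (- (w \<bullet> v)) / (v \<bullet> v)) * t \<and> 0 < - (- (w \<bullet> v)) / (v \<bullet> v)
      \<and> (- (- (w \<bullet> v)) / (v \<bullet> v)) * d1 \<le> (c - p) / 2"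
    using affine_zero_branch[OF V(1) len(1), of "slope x p v" "- (w \<bullet> v)"] by metis
  obtain d2 e2 where left: "d2 > 0" "e2 > 0"
    "\<And>t r. 0 < t \<Longrightarrow> t < d2 \<Longrightarrow> 0 < r \<Longrightarrow> r < e2 \<Longrightarrow> - slope x p u + t * (w \<bullet> u) + r * (u \<bullet> u) = 0 \<Longrightarrow>
      - slope x p u = 0 \<and> r = (- (w \<bullet> u) / (u \<bullet> u)) * t \<and> 0 < - (w \<bullet> u) / (u \<bullet> u)
      \<and> (- (w \<bullet> u) / (u \<bullet> u)) * d2 \<le> (p - b) / 2"
    using affine_zero_branch[OF V(2) len(2), of "- slope x p u" "w \<bullet> u"] by metis
  obtain d3 where d3: "d3 > 0" "\<And>t t'. 0 < t \<Longrightarrow> t < d3 \<Longrightarrow> 0 < t' \<Longrightarrow> t' < d3 \<Longrightarrow>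
      slope x p u + t * (- (w \<bullet> u)) \<le> 0 \<Longrightarrow> slope x p u + t' * (- (w \<bullet> u)) \<le> 0"
    using affine_sign[of "slope x p u" "- (w \<bullet> u)"] by metis
  obtain d4 where d4: "d4 > 0" "\<And>t t'. 0 < t \<Longrightarrow> t < d4 \<Longrightarrow> 0 < t' \<Longrightarrow> t' < d4 \<Longrightarrow>
      - slope x p v + t * (w \<bullet> v) \<le> 0 \<Longrightarrow> - slope x p v + t' * (w \<bullet> v) \<le> 0"
    using affine_sign[of "- slope x p v" "w \<bullet> v"] by metis
  define d where "d = Min {d0, d1, d2, d3, d4}"
  define e where "e = Min {e1, e2, c - p, p - b}"
  have d: "d > 0" "d \<le> d0" "d \<le> d1" "d \<le> d2" "d \<le> d3" "d \<le> d4"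
    using \<open>0 < d0\<close> right left d3 d4 by (simp_all add: d_def)
  have e: "e > 0" "e \<le> e1" "e \<le> e2" "e \<le> c - p" "e \<le> p - b"
    using right left len by (simp_all add: e_def)
  have "\<exists>k. y = p + k * t \<and> (\<forall>t'. 0 < t' \<and> t' < d \<longrightarrow> locmin (phi (x + sg * t')) (p + k * t'))"
    if t: "0 < t" "t < d" and y: "\<bar>y - p\<bar> < e" and lm: "locmin (phi (x + sg * t)) y" for t y
  proof (cases y p rule: linorder_cases)
    case less
    have "b < y" using y e by linarith
    have "slope (x + sg * t) y u = 0" using lm locmin_inside[OF s(1) \<open>b < y\<close> less] by simp
    moreover have "slope x y u = slope x p u + (y - p) * (u \<bullet> u)"
      by (rule slope_seg[OF s(1)]) (use \<open>b < y\<close> less in auto)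
    ultimately have "slope x p u + (y - p) * (u \<bullet> u) + t * (- (w \<bullet> u)) = 0"
      using slope_w[of t y u] t d by simp
    moreover have "(p - y) * (u \<bullet> u) = - ((y - p) * (u \<bullet> u))" by (simp add: left_diff_distrib)
    ultimately have "- slope x p u + t * (w \<bullet> u) + (p - y) * (u \<bullet> u) = 0" by simp
    note k = left(3)[OF t(1) _ _ _ this]
    define k where "k = - (- (w \<bullet> u) / (u \<bullet> u))"
    have k: "slope x p u = 0" "p - y = - k * t" "k < 0" "- k * d2 \<le> (p - b) / 2"
      using k t d less y e by (auto simp: k_def)
    have "locmin (phi (x + sg * t')) (p + k * t')" if t': "0 < t'" "t' < d" for t'
    proof -
      have "- k * t' \<le> - k * d2" using k(3) t' d by (intro mult_left_mono) auto
      also note k(4)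
      also note len2(2)
      finally have "- k * t' < p - b" .
      then have 1: "b < p + k * t'" by simp
      have 2: "p + k * t' < p" using k(3) t' by (simp add: mult_less_0_iff)
      have "slope x (p + k * t') u = slope x p u + (p + k * t' - p) * (u \<bullet> u)"
        by (rule slope_seg[OF s(1)]) (use 1 2 in auto)
      then have "slope (x + sg * t') (p + k * t') u = k * t' * (u \<bullet> u) + t' * (- (w \<bullet> u))"
        using slope_w[of t' "p + k * t'" u] t' d k(1) by simp
      also have "\<dots> = 0" using V by (simp add: k_def)
      finally show ?thesis using locmin_inside[OF s(1) 1 2] by simp
    qed
    then show ?thesis using k(2) by (intro exI[of _ k]) auto
  next
    case equal
    have iff: "locmin (phi (x + sg * t')) p \<longleftrightarrow>
      slope x p u + t' * (- (w \<bullet> u)) \<le> 0 \<and> - slope x p v + t' * (w \<bullet> v) \<le> 0" if "0 < t'" "t' < d" for t'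
      unfolding locmin_iff[OF s] using slope_w[of t' p u] slope_w[of t' p v] that d by auto
    have "locmin (phi (x + sg * t')) p" if t': "0 < t'" "t' < d" for t'
      using iff[OF t] iff[OF t'] lm equal d3(2)[of t t'] d4(2)[of t t'] t t' d by auto
    then show ?thesis using equal by (intro exI[of _ 0]) auto
  next
    case greater
    have "y < c" using y e by linarith
    have "slope (x + sg * t) y v = 0" using lm locmin_inside[OF s(2) greater \<open>y < c\<close>] by simp
    moreover have "slope x y v = slope x p v + (y - p) * (v \<bullet> v)"
      by (rule slope_seg[OF s(2)]) (use \<open>y < c\<close> greater in auto)
    ultimately have "slope x p v + t * (- (w \<bullet> v)) + (y - p) * (v \<bullet> v) = 0"
      using slope_w[of t y v] t d by simp
    note k = right(3)[OF t(1) _ _ _ this]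
    define k where "k = (w \<bullet> v) / (v \<bullet> v)"
    have k: "slope x p v = 0" "y - p = k * t" "0 < k" "k * d1 \<le> (c - p) / 2"
      using k t d greater y e by (auto simp: k_def)
    have "locmin (phi (x + sg * t')) (p + k * t')" if t': "0 < t'" "t' < d" for t'
    proof -
      have "k * t' \<le> k * d1" using k(3) t' d by (intro mult_left_mono) auto
      also note k(4)
      also note len2(1)
      finally have 1: "p + k * t' < c" by simp
      have 2: "p < p + k * t'" using k(3) t' by simp
      have "slope x (p + k * t') v = slope x p v + (p + k * t' - p) * (v \<bullet> v)"
        by (rule slope_seg[OF s(2)]) (use 1 2 in auto)
      then have "slope (x + sg * t') (p + k * t') v = k * t' * (v \<bullet> v) + t' * (- (w \<bullet> v))"
        using slope_w[of t' "p + k * t'" v] t' d k(1) by simp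
      also have "\<dots> = 0" using V by (simp add: k_def)
      finally show ?thesis using locmin_inside[OF s(2) 2 1] by simp
    qed
    then show ?thesis using k(2) by (intro exI[of _ k]) auto
  qed
  then show ?thesis using d(1) e(1) by blast
qed

text \<open>A stable \<open>p\<close> ceases to be stable at once only if a one-sided slope is zero
  and the walk gives it the wrong sign; then a foot point is dragged from \<open>p\<close> along
  that segment.\<close>

lemma arc_from:
  assumes "0 < d0" and w: "\<And>t. 0 \<le> t \<Longrightarrow> t \<le> d0 \<Longrightarrow> G (x + sg * t) = G x + t *\<^sub>R w"
    and lm: "locmin (phi x) p"
  shows "\<exists>d>0. \<exists>k. \<forall>t. 0 \<le> t \<and> t < d \<longrightarrow> locmin (phi (x + sg * t)) (p + k * t)"
proof -
  obtain b c u v where s: "seg b p u" "seg p c v" by (rule segs_at[of p])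
  have slope_w: "slope (x + sg * t) y z = slope x y z - t * (w \<bullet> z)" if "0 \<le> t" "t \<le> d0" for t y z
    by (simp add: slope_def w[OF that] inner_diff_left inner_add_left)
  have V: "v \<bullet> v > 0" "u \<bullet> u > 0" using seg_nz[OF s(1)] seg_nz[OF s(2)] by simp_all
  have L: "slope x p u \<le> 0" and R: "0 \<le> slope x p v" using lm unfolding locmin_iff[OF s] by simp_all
  have small: "\<exists>d>0. \<forall>t. 0 \<le> t \<and> t < d \<longrightarrow> k * t < m" if "m > 0" for k m :: real
  proof (intro exI[of _ "m / (\<bar>k\<bar> + 1)"] conjI allI impI)
    fix t assume t: "0 \<le> t \<and> t < m / (\<bar>k\<bar> + 1)"
    have "k * t \<le> (\<bar>k\<bar> + 1) * t" using t by (intro mult_right_mono) auto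
    also have "\<dots> < m" using t by (simp add: field_simps)
    finally show "k * t < m" .
  qed (use that in simp)
  consider "slope x p v = 0" "w \<bullet> v > 0" | "slope x p u = 0" "w \<bullet> u < 0"
    | "slope x p v > 0 \<or> w \<bullet> v \<le> 0" "slope x p u < 0 \<or> w \<bullet> u \<ge> 0" using L R by linarith
  then show ?thesis
  proof cases
    case 1
    define k where "k = (w \<bullet> v) / (v \<bullet> v)"
    have "k > 0" using 1 V by (simp add: k_def)
    obtain d where d: "d > 0" "\<And>t. 0 \<le> t \<Longrightarrow> t < d \<Longrightarrow> k * t < c - p"
      using small[of "c - p" k] seg_less[OF s(2)] by auto
    have "locmin (phi (x + sg * t)) (p + k * t)" if t: "0 \<le> t" "t < min d d0" for t
    proof (cases "t = 0")
      case False
      have *: "p < p + k * t" "p + k * t < c" using \<open>k > 0\<close> False t d(2)[of t] by auto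
      have "slope x (p + k * t) v = slope x p v + (p + k * t - p) * (v \<bullet> v)"
        by (rule slope_seg[OF s(2)]) (use * in auto)
      then have "slope (x + sg * t) (p + k * t) v = 0"
        using slope_w[of t "p + k * t" v] t 1 V by (simp add: k_def)
      then show ?thesis using locmin_inside[OF s(2) *] by simp
    qed (use lm in simp)
    then show ?thesis using d(1) \<open>0 < d0\<close> by (intro exI[of _ "min d d0"] conjI exI[of _ k]) auto
  next
    case 2
    define k where "k = (w \<bullet> u) / (u \<bullet> u)"
    have "k < 0" using 2 V by (simp add: k_def divide_neg_pos)
    obtain d where d: "d > 0" "\<And>t. 0 \<le> t \<Longrightarrow> t < d \<Longrightarrow> - k * t < p - b"
      using small[of "p - b" "- k"] seg_less[OF s(1)] by auto
    have "locmin (phi (x + sg * t)) (p + k * t)" if t: "0 \<le> t" "t < min d d0" for t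
    proof (cases "t = 0")
      case False
      have *: "b < p + k * t" "p + k * t < p"
        using \<open>k < 0\<close> False t d(2)[of t] by (auto simp: mult_less_0_iff)
      have "slope x (p + k * t) u = slope x p u + (p + k * t - p) * (u \<bullet> u)"
        by (rule slope_seg[OF s(1)]) (use * in auto)
      then have "slope (x + sg * t) (p + k * t) u = 0"
        using slope_w[of t "p + k * t" u] t 2 V by (simp add: k_def)
      then show ?thesis using locmin_inside[OF s(1) *] by simp
    qed (use lm in simp)
    then show ?thesis using d(1) \<open>0 < d0\<close> by (intro exI[of _ "min d d0"] conjI exI[of _ k]) auto
  next
    case 3
    obtain d1 where d1: "d1 > 0" "\<And>t. 0 \<le> t \<Longrightarrow> t < d1 \<Longrightarrow> t * (w \<bullet> v) \<le> slope x p v"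
    proof (cases "slope x p v > 0")
      case True
      then show thesis using small[OF True, of "w \<bullet> v"] that by (metis less_imp_le mult.commute)
    next
      case False
      then have "w \<bullet> v \<le> 0" using 3 by simp
      then show thesis using that[of 1] R by (metis mult_nonneg_nonpos order_trans zero_less_one)
    qed
    obtain d2 where d2: "d2 > 0" "\<And>t. 0 \<le> t \<Longrightarrow> t < d2 \<Longrightarrow> t * - (w \<bullet> u) \<le> - slope x p u"
    proof (cases "slope x p u < 0")
      case True
      then have "- slope x p u > 0" by simp
      then show thesis using small[of "- slope x p u" "- (w \<bullet> u)"] that by (metis less_imp_le mult.commute)
    next
      case False
      then have "- (w \<bullet> u) \<le> 0" using 3 by simp
      moreover have "0 \<le> - slope x p u" using L by simp
      ultimately show thesis using that[of 1] by (metis mult_nonneg_nonpos order_trans zero_less_one)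
    qed
    have "locmin (phi (x + sg * t)) (p + 0 * t)" if t: "0 \<le> t" "t < min d0 (min d1 d2)" for t
      using locmin_iff[OF s, of "x + sg * t"] slope_w[of t p u] slope_w[of t p v] d1(2)[of t] d2(2)[of t] t
      by auto
    then show ?thesis using d1(1) d2(1) \<open>0 < d0\<close>
      by (intro exI[of _ "min d0 (min d1 d2)"] conjI exI[of _ 0]) auto
  qed
qed

lemma sides:
  obtains d0 w w' where "d0 > 0" "\<And>t. 0 \<le> t \<Longrightarrow> t \<le> d0 \<Longrightarrow> G (x + 1 * t) = G x + t *\<^sub>R w"
    "\<And>t. 0 \<le> t \<Longrightarrow> t \<le> d0 \<Longrightarrow> G (x + (-1) * t) = G x + t *\<^sub>R w'"
proof -
  obtain b c u v where s: "seg b x u" "seg x c v" by (rule segs_at[of x])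
  show thesis
  proof (rule that[of "min (c - x) (x - b)" v "- u"])
    show "0 < min (c - x) (x - b)" using seg_less[OF s(1)] seg_less[OF s(2)] by simp
    fix t assume t: "0 \<le> t" "t \<le> min (c - x) (x - b)"
    have "G (x + t) - G x = (x + t - x) *\<^sub>R v" using s(2) t unfolding seg_def by auto
    then show "G (x + 1 * t) = G x + t *\<^sub>R v" by (simp add: algebra_simps)
    have "G (x - t) - G x = (x - t - x) *\<^sub>R u" using s(1) t unfolding seg_def by auto
    then show "G (x + (-1) * t) = G x + t *\<^sub>R (- u)" by (simp add: algebra_simps)
  qed
qed

lemma nhds_sides:
  assumes "\<exists>d>0. \<forall>t. 0 < t \<and> t < d \<longrightarrow> P (x + 1 * t)"
    and "\<exists>d>0. \<forall>t. 0 < t \<and> t < d \<longrightarrow> P (x + (-1) * t)" and "P x"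
  shows "\<forall>\<^sub>F y in nhds (x :: real). P y"
proof -
  obtain d1 d2 where d: "d1 > 0" "\<And>t. 0 < t \<Longrightarrow> t < d1 \<Longrightarrow> P (x + 1 * t)"
    "d2 > 0" "\<And>t. 0 < t \<Longrightarrow> t < d2 \<Longrightarrow> P (x + (-1) * t)" using assms by metis
  have "P y" if "dist y x < min d1 d2" for y
  proof (cases y x rule: linorder_cases)
    case less
    then show ?thesis using d(4)[of "x - y"] that by (simp add: dist_real_def)
  next
    case greater
    then show ?thesis using d(2)[of "y - x"] that by (simp add: dist_real_def)
  qed (use assms(3) in simp)
  then show ?thesis unfolding eventually_nhds_metric using d(1,3) by (meson min_less_iff_conj)
qed

lemma response_from:
  assumes "locmin (phi x) p"
  shows "\<forall>\<^sub>F y in nhds x. \<exists>f. puppy_response G x (y - x) p f"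
proof -
  obtain d0 w w' where d0: "d0 > 0" and w: "\<And>t. 0 \<le> t \<Longrightarrow> t \<le> d0 \<Longrightarrow> G (x + 1 * t) = G x + t *\<^sub>R w"
    and w': "\<And>t. 0 \<le> t \<Longrightarrow> t \<le> d0 \<Longrightarrow> G (x + (-1) * t) = G x + t *\<^sub>R w'" using sides[of x] by metis
  have *: "\<exists>d>0. \<forall>t. 0 < t \<and> t < d \<longrightarrow> (\<exists>f. puppy_response G x (x + sg * t - x) p f)"
    if W: "\<And>t. 0 \<le> t \<Longrightarrow> t \<le> d0 \<Longrightarrow> G (x + sg * t) = G x + t *\<^sub>R W" for sg W
  proof -
    obtain d k where d: "d > 0" "\<And>t. 0 \<le> t \<Longrightarrow> t < d \<Longrightarrow> locmin (phi (x + sg * t)) (p + k * t)"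
      using arc_from[OF d0 W assms] by metis
    have "\<exists>f. puppy_response G x (x + sg * t - x) p f" if t: "0 < t" "t < d" for t
    proof (rule response_along_arc[of _ _ _ "k * t"])
      fix r :: real assume r: "0 \<le> r" "r < 1"
      have "r * t < d" using r t mult_left_le_one_le[of t r] by linarith
      then have "locmin (phi (x + sg * (r * t))) (p + k * (r * t))" using r t by (intro d(2)) auto
      then show "locmin (phi (x + r * (x + sg * t - x))) (p + k * t * r)" by (simp add: ac_simps)
    qed
    then show ?thesis using d(1) by blast
  qed
  show ?thesis
    by (rule nhds_sides[OF *[of 1 w] *[of "-1" w']])
      (use w w' response_along_arc[of x 0 p 0] assms in auto)
qed

text \<open>Here an arc is traversed backwards: as the human approaches \<open>x\<close>, the puppy
  follows it to its base point and makes a final run. Compactness makes the neighbourhood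
  independent of the puppy position; the range contains every strip between \<open>y\<close> and
  \<open>y + 1\<close> with \<open>y\<close> within 1 of \<open>x\<close>.\<close>

lemma response_to:
  "\<forall>\<^sub>F y in nhds x. \<forall>p\<in>{x - 1..x + 2}. locmin (phi y) p \<longrightarrow> (\<exists>f. puppy_response G y (x - y) p f)"
proof -
  define K where "K = {x - 1..x + 2}"
  obtain d0 w w' where d0: "d0 > 0" and w: "\<And>t. 0 \<le> t \<Longrightarrow> t \<le> d0 \<Longrightarrow> G (x + 1 * t) = G x + t *\<^sub>R w"
    and w': "\<And>t. 0 \<le> t \<Longrightarrow> t \<le> d0 \<Longrightarrow> G (x + (-1) * t) = G x + t *\<^sub>R w'" using sides[of x] by metis
  have *: "\<exists>d>0. \<forall>t. 0 < t \<and> t < d \<longrightarrow>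
      (\<forall>y\<in>K. locmin (phi (x + sg * t)) y \<longrightarrow> (\<exists>f. puppy_response G (x + sg * t) (x - (x + sg * t)) y f))"
    if W: "\<And>t. 0 \<le> t \<Longrightarrow> t \<le> d0 \<Longrightarrow> G (x + sg * t) = G x + t *\<^sub>R W" for sg W
  proof -
    have "\<forall>p. \<exists>d e. d > 0 \<and> e > 0 \<and> (\<forall>t y. 0 < t \<and> t < d \<and> \<bar>y - p\<bar> < e \<and> locmin (phi (x + sg * t)) y \<longrightarrow>
      (\<exists>k. y = p + k * t \<and> (\<forall>t'. 0 < t' \<and> t' < d \<longrightarrow> locmin (phi (x + sg * t')) (p + k * t'))))"
      using local_arcs[OF d0 W] by metis
    then obtain D E where DE: "\<And>p. D p > 0" "\<And>p. E p > 0"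
      "\<And>p t y. 0 < t \<Longrightarrow> t < D p \<Longrightarrow> \<bar>y - p\<bar> < E p \<Longrightarrow> locmin (phi (x + sg * t)) y \<Longrightarrow>
      (\<exists>k. y = p + k * t \<and> (\<forall>t'. 0 < t' \<and> t' < D p \<longrightarrow> locmin (phi (x + sg * t')) (p + k * t')))"
      by metis
    have "compact K" by (simp add: K_def)
    then obtain P where P: "P \<subseteq> K" "finite P" "K \<subseteq> (\<Union>p\<in>P. ball p (E p))"
    proof (rule compactE_image[of K K "\<lambda>p. ball p (E p)"])
      show "K \<subseteq> (\<Union>c\<in>K. ball c (E c))" using DE(2) by auto
    qed auto
    define d where "d = Min (insert 1 (D ` P))"
    have "d > 0" using P(2) DE(1) by (simp add: d_def)
    have dP: "d \<le> D p" if "p \<in> P" for p using P(2) that by (simp add: d_def)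
    have "\<exists>f. puppy_response G (x + sg * t) (x - (x + sg * t)) y f"
      if t: "0 < t" "t < d" and "y \<in> K" and lm: "locmin (phi (x + sg * t)) y" for t y
    proof -
      obtain p where p: "p \<in> P" "\<bar>y - p\<bar> < E p"
        using P(3) \<open>y \<in> K\<close> by (auto simp: dist_real_def abs_minus_commute)
      have "t < D p" using t dP[OF p(1)] by simp
      obtain k where k: "y = p + k * t"
        "\<And>t'. 0 < t' \<Longrightarrow> t' < D p \<Longrightarrow> locmin (phi (x + sg * t')) (p + k * t')"
        using DE(3)[OF t(1) \<open>t < D p\<close> p(2) lm] by blast
      show ?thesis
      proof (rule response_along_arc[of _ _ _ "- k * t"])
        fix r :: real assume r: "0 \<le> r" "r < 1"
        \<comment> \<open>The parameter distance between the human and \<open>x\<close> at time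
          \<open>r\<close>.\<close>
        define t' where "t' = t * (1 - r)"
        have "0 < t'" "t' \<le> t" using r t by (auto simp: t'_def mult_left_le)
        then have "locmin (phi (x + sg * t')) (p + k * t')" using \<open>t < D p\<close> by (intro k(2)) auto
        moreover have "x + sg * t + r * (x - (x + sg * t)) = x + sg * t'" "y + - k * t * r = p + k * t'"
          by (simp_all add: t'_def k(1) algebra_simps)
        ultimately show "locmin (phi (x + sg * t + r * (x - (x + sg * t)))) (y + - k * t * r)" by (simp only:)
      qed
    qed
    then show ?thesis using \<open>d > 0\<close> by blast
  qed
  show ?thesis
    unfolding K_def[symmetric]
    by (rule nhds_sides[OF *[of 1 w] *[of "-1" w']])
      (use w w' response_along_arc[of x 0 _ 0] in auto)
qed

end

section \<open>Traps\<close>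

text \<open>One good response per move is demanded, because \<open>human_wins\<close> requires
  success against all responses and its failure supplies one. Moves without any response are exempt,
  as \<open>human_wins\<close> does not admit them.\<close>

definition trap :: "(real \<Rightarrow> complex) \<Rightarrow> (real \<Rightarrow> real \<Rightarrow> bool) \<Rightarrow> bool" where
  "trap G T \<longleftrightarrow> (\<forall>x q. T x q \<longrightarrow> locmin (dist_fun G x) q \<and>
     (\<forall>d. (\<exists>f. puppy_response G x d q f) \<longrightarrow>
        (\<exists>f. puppy_response G x d q f \<and> (\<forall>t\<in>{0..1}. G (x + t * d) \<noteq> G (f t)) \<and> T (x + d) (f 1))))"

lemma eventually_dist_less: "0 < e \<Longrightarrow> \<forall>\<^sub>F y in nhds x. dist y x < e"
  by (auto simp: eventually_nhds_metric)

locale puppy_trap = pl_track +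
  fixes T :: "real \<Rightarrow> real \<Rightarrow> bool"
  assumes trap: "trap G T"
begin

definition trapped :: "real \<Rightarrow> real set" where
  "trapped x = {p. T x p \<and> x < p \<and> p < x + 1}"

lemma trapped_locmin: "p \<in> trapped x \<Longrightarrow> locmin (phi x) p"
  using trap by (simp add: trapped_def trap_def)

text \<open>The puppy stays between the human and the human one lap later: on these edges it would
  be caught, and a run cannot cross them, since the distance there is zero and cannot decrease
  further.\<close>

lemma trap_step:
  assumes p: "p \<in> trapped x" and ex: "\<exists>f. puppy_response G x d p f"
  obtains f where "puppy_response G x d p f" "f 1 \<in> trapped (x + d)"
proof -
  obtain f where f: "puppy_response G x d p f" "\<And>t. t \<in> {0..1} \<Longrightarrow> G (x + t * d) \<noteq> G (f t)" "T (x + d) (f 1)"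
    using trap p ex unfolding trap_def trapped_def by blast
  have "f 0 = p" using f(1) run_from_locmin[OF _ trapped_locmin[OF p]] by (simp add: puppy_response_def)
  have right: "(f \<longlongrightarrow> f t) (at_right t)" if "t \<in> {0..<1}" for t
    using f(1) that by (simp add: puppy_response_def)
  have left: "\<exists>l. (f \<longlongrightarrow> l) (at_left t) \<and> puppy_run (phi (x + t * d)) l (f t)" if "t \<in> {0<..1}" for t
    using f(1) that by (simp add: puppy_response_def)
  have zero: "phi y y = 0" "phi y (y + 1) = 0" for y using periodic by (simp_all add: dist_fun_def)
  have nonneg: "0 \<le> phi y s" for y s by (simp add: dist_fun_def)
  have "x + 1 * d < f 1"
  proof (rule barrier[of "\<lambda>t. x + t * d" f 1, OF _ right])
    fix t :: real assume t: "t \<in> {0<..1}"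
    obtain l where l: "(f \<longlongrightarrow> l) (at_left t)" "puppy_run (phi (x + t * d)) l (f t)" using left[OF t] by blast
    have "x + t * d \<le> f t" if "x + t * d \<le> l"
    proof (rule ccontr)
      assume "\<not> x + t * d \<le> f t"
      then have "phi (x + t * d) (f t) < phi (x + t * d) (x + t * d)"
        using l(2) that by (auto simp: puppy_run_cases inc_def)
      then show False using zero nonneg[of "x + t * d" "f t"] by simp
    qed
    then show "\<exists>l. (f \<longlongrightarrow> l) (at_left t) \<and> (x + t * d \<le> l \<longrightarrow> x + t * d \<le> f t)" using l by blast
  next
    fix t :: real assume "t \<in> {0..1}"
    then show "f t \<noteq> x + t * d" using f(2)[of t] by auto
  qed (use p f(2) \<open>f 0 = p\<close> in \<open>auto simp: trapped_def intro!: continuous_intros\<close>)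
  moreover have "- (x + 1 * d + 1) < - f 1"
  proof (rule barrier[of "\<lambda>t. - (x + t * d + 1)" "\<lambda>t. - f t" 1])
    fix t :: real assume t: "t \<in> {0<..1}"
    obtain l where l: "(f \<longlongrightarrow> l) (at_left t)" "puppy_run (phi (x + t * d)) l (f t)" using left[OF t] by blast
    have "f t \<le> x + t * d + 1" if "l \<le> x + t * d + 1"
    proof (rule ccontr)
      assume "\<not> f t \<le> x + t * d + 1"
      then have "phi (x + t * d) (f t) < phi (x + t * d) (x + t * d + 1)"
        using l(2) that by (auto simp: puppy_run_cases dec_def)
      then show False using zero nonneg[of "x + t * d" "f t"] by simp
    qed
    then show "\<exists>l. ((\<lambda>t. - f t) \<longlongrightarrow> l) (at_left t) \<and> (- (x + t * d + 1) \<le> l \<longrightarrow> - (x + t * d + 1) \<le> - f t)"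
      using tendsto_minus[OF l(1)] by (intro exI[of _ "- l"]) auto
  next
    fix t :: real assume "t \<in> {0..1}"
    then have "G (x + t * d + 1) \<noteq> G (f t)" using f(2) periodic by simp
    then have "x + t * d + 1 \<noteq> f t" by auto
    then show "- f t \<noteq> - (x + t * d + 1)" by linarith
  qed (use p right \<open>f 0 = p\<close> in \<open>auto simp: trapped_def intro!: continuous_intros tendsto_minus\<close>)
  ultimately have "f 1 \<in> trapped (x + d)" using f(3) by (simp add: trapped_def)
  then show thesis using that f(1) by blast
qed

text \<open>No stable position lies in \<open>{a..<b}\<close>, and a run back across the gate would
  have to decrease the distance in the direction in which it increases.\<close>

lemma gate:
  assumes f: "puppy_response G x d q f" and q: "locmin (phi x) q" "a \<le> q" and "a < b"
    and dec: "\<And>t. t \<in> {0..1} \<Longrightarrow> dec (x + t * d) a b"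
  shows "b \<le> f 1"
proof -
  \<comment> \<open>The barrier is placed inside the gate: a backward run may well start at
    \<open>a\<close>, but one from \<open>c\<close> or beyond overlaps
    \<open>{a..c}\<close>.\<close>
  define c where "c = (a + b) / 2"
  have c: "a < c" "c < b" using \<open>a < b\<close> by (simp_all add: c_def)
  have "f 0 = q" using f run_from_locmin[OF _ q(1)] by (simp add: puppy_response_def)
  have lm: "locmin (phi (x + t * d)) (f t)" if "t \<in> {0..1}" for t
    using f that by (simp add: puppy_response_def)
  have out: "f t < a \<or> b \<le> f t" if "t \<in> {0..1}" for t
    using not_locmin_dec[OF dec[OF that], of "f t"] lm[OF that] by linarith
  have "c < f 1"
  proof (rule barrier[of "\<lambda>_. c" f 1])
    show "(f \<longlongrightarrow> f t) (at_right t)" if "t \<in> {0..<1}" for t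
      using f that by (simp add: puppy_response_def)
    show "c < f 0" using out[of 0] q(2) c \<open>f 0 = q\<close> by simp
    show "f t \<noteq> c" if "t \<in> {0..1}" for t using out[OF that] c by auto
    fix t :: real assume t: "t \<in> {0<..1}"
    then have "\<exists>l. (f \<longlongrightarrow> l) (at_left t) \<and> puppy_run (phi (x + t * d)) l (f t)"
      using f by (simp add: puppy_response_def)
    then obtain l where l: "(f \<longlongrightarrow> l) (at_left t)" "puppy_run (phi (x + t * d)) l (f t)" by blast
    have "c \<le> f t" if "c \<le> l"
    proof (rule ccontr)
      assume "\<not> c \<le> f t"
      then have "inc (x + t * d) (f t) l" using l(2) that by (auto simp: puppy_run_cases)
      then have "phi (x + t * d) (max (f t) a) < phi (x + t * d) c"
        using that \<open>\<not> c \<le> f t\<close> c by (auto simp: inc_def)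
      moreover have "phi (x + t * d) c < phi (x + t * d) (max (f t) a)"
        using dec[of t] t \<open>\<not> c \<le> f t\<close> c by (auto simp: dec_def)
      ultimately show False by simp
    qed
    then show "\<exists>l. (f \<longlongrightarrow> l) (at_left t) \<and> (c \<le> l \<longrightarrow> c \<le> f t)" using l by blast
  qed auto
  then show ?thesis using out[of 1] c by auto
qed

lemma trapped_from:
  assumes "p \<in> trapped x" shows "\<forall>\<^sub>F y in nhds x. trapped y \<noteq> {}"
  using response_from[OF trapped_locmin[OF assms]]
proof eventually_elim
  case (elim y)
  obtain f where "f 1 \<in> trapped (x + (y - x))" by (rule trap_step[OF assms elim])
  then show ?case by auto
qed

lemma trapped_range: "\<forall>\<^sub>F y in nhds x. trapped y \<subseteq> {x - 1..x + 2}"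
proof -
  have "\<forall>\<^sub>F y in nhds x. dist y x < 1" by (rule eventually_dist_less) simp
  then show ?thesis by eventually_elim (auto simp: trapped_def dist_real_def)
qed

lemma gate_from:
  assumes p: "p \<in> trapped x" "a \<le> p" and ab: "a < b" "\<forall>\<^sub>F y in nhds x. dec y a b"
  shows "\<forall>\<^sub>F y in nhds x. \<exists>p'\<in>trapped y. b \<le> p'"
proof -
  obtain e where e: "e > 0" "\<And>y. dist y x < e \<Longrightarrow> dec y a b"
    using ab(2) unfolding eventually_nhds_metric by blast
  have "\<forall>\<^sub>F y in nhds x. dist y x < e" using e(1) by (rule eventually_dist_less)
  with response_from[OF trapped_locmin[OF p(1)]] show ?thesis
  proof eventually_elim
    case (elim y)
    obtain f where f: "puppy_response G x (y - x) p f" "f 1 \<in> trapped (x + (y - x))"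
      by (rule trap_step[OF p(1) elim(1)])
    have "b \<le> f 1"
    proof (rule gate[OF f(1) trapped_locmin[OF p(1)] p(2) ab(1)])
      fix t :: real assume t: "t \<in> {0..1}"
      have "\<bar>t * (y - x)\<bar> \<le> \<bar>y - x\<bar>" using t by (simp add: abs_mult mult_left_le_one_le)
      then show "dec (x + t * (y - x)) a b" using elim(2) by (intro e(2)) (simp add: dist_real_def)
    qed
    then show ?case using f(2) by auto
  qed
qed

lemma gate_to:
  assumes ab: "a < b" "\<forall>\<^sub>F y in nhds x. dec y a b"
  shows "\<forall>\<^sub>F y in nhds x. \<forall>p\<in>trapped y. a \<le> p \<longrightarrow> (\<exists>p'\<in>trapped x. b \<le> p')"
proof -
  obtain e where e: "e > 0" "\<And>y. dist y x < e \<Longrightarrow> dec y a b"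
    using ab(2) unfolding eventually_nhds_metric by blast
  have "\<forall>\<^sub>F y in nhds x. dist y x < e" using e(1) by (rule eventually_dist_less)
  with response_to[of x] trapped_range[of x] show ?thesis
  proof eventually_elim
    case (elim y)
    show ?case
    proof (intro ballI impI)
      fix p assume p: "p \<in> trapped y" "a \<le> p"
      then have "\<exists>f. puppy_response G y (x - y) p f" using elim trapped_locmin by blast
      then obtain f where f: "puppy_response G y (x - y) p f" "f 1 \<in> trapped (y + (x - y))"
        by (rule trap_step[OF p(1)])
      have "b \<le> f 1"
      proof (rule gate[OF f(1) trapped_locmin[OF p(1)] p(2) ab(1)])
        fix t :: real assume t: "t \<in> {0..1}"
        have "\<bar>(1 - t) * (y - x)\<bar> \<le> \<bar>y - x\<bar>" using t by (simp add: abs_mult mult_left_le_one_le)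
        moreover have "y + t * (x - y) - x = (1 - t) * (y - x)" by (simp add: algebra_simps)
        ultimately show "dec (y + t * (x - y)) a b" using elim(3) by (intro e(2)) (simp add: dist_real_def)
      qed
      then show "\<exists>p'\<in>trapped x. b \<le> p'" using f(2) by auto
    qed
  qed
qed

text \<open>The human positions with a trapped puppy form an open set by moves away from a member.
  The complement is open too: a trapped puppy near \<open>x\<close> could be led to
  \<open>x\<close>.\<close>

lemma trapped_nonempty:
  assumes "trapped x0 \<noteq> {}" shows "trapped x \<noteq> {}"
proof -
  define S where "S = {x. trapped x \<noteq> {}}"
  have open_iff: "open A \<longleftrightarrow> (\<forall>x\<in>A. \<forall>\<^sub>F y in nhds x. y \<in> A)" for A :: "real set"
    by (simp add: open_dist eventually_nhds_metric)
  have "open S"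
    unfolding open_iff
  proof
    fix x assume "x \<in> S"
    then obtain p where "p \<in> trapped x" unfolding S_def by blast
    then show "\<forall>\<^sub>F y in nhds x. y \<in> S" unfolding S_def mem_Collect_eq by (rule trapped_from)
  qed
  moreover have "open (- S)"
    unfolding open_iff
  proof
    fix x assume x: "x \<in> - S"
    show "\<forall>\<^sub>F y in nhds x. y \<in> - S"
      using response_to[of x] trapped_range[of x]
    proof eventually_elim
      case (elim y)
      show ?case
      proof (rule ccontr)
        assume "\<not> y \<in> - S"
        then obtain p where p: "p \<in> trapped y" unfolding S_def by blast
        then have "\<exists>f. puppy_response G y (x - y) p f" using elim trapped_locmin by blast
        then obtain f where "f 1 \<in> trapped (y + (x - y))" by (rule trap_step[OF p])
        then have "f 1 \<in> trapped x" by simp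
        then show False using x unfolding S_def by blast
      qed
    qed
  qed
  ultimately have "S = {} \<or> S = UNIV" using clopen[of S] by (simp add: closed_def)
  then show ?thesis using assms by (auto simp: S_def)
qed

section \<open>The topmost trapped position and the peak above it\<close>

definition is_top :: "real \<Rightarrow> real \<Rightarrow> bool" where
  "is_top x p \<longleftrightarrow> p \<in> trapped x \<and> (\<forall>p'\<in>trapped x. p' \<le> p)"

text \<open>Stable positions are isolated, so one of them close enough to the supremum is the
  supremum.\<close>

lemma top_exists:
  assumes "trapped x \<noteq> {}" shows "\<exists>p. is_top x p"
proof -
  have bdd: "bdd_above (trapped x)" by (rule bdd_aboveI[of _ "x + 1"]) (auto simp: trapped_def)
  define s where "s = Sup (trapped x)"
  have up: "p \<le> s" if "p \<in> trapped x" for p unfolding s_def using that bdd by (rule cSup_upper)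
  obtain e where e: "e > 0" "\<And>y. y \<noteq> s \<Longrightarrow> \<bar>y - s\<bar> < e \<Longrightarrow> \<not> locmin (phi x) y"
    using locmin_isolated[of s x] by blast
  obtain p where p: "p \<in> trapped x" "s - e < p"
    using less_cSupD[OF assms, of "s - e"] e(1) by (auto simp: s_def)
  then have "p = s" using e(2)[of p] trapped_locmin[of p x] up[of p] by (cases "p = s") auto
  then show ?thesis using p up by (auto simp: is_top_def)
qed

lemma top_unique: "is_top x p \<Longrightarrow> is_top x p' \<Longrightarrow> p = p'"
  by (auto simp: is_top_def intro: antisym)

text \<open>Just to the left of a stable position there is a gate that survives small moves of the
  human, and the puppy cannot fall back through it. For the top this is lower
  semicontinuity.\<close>

lemma top_lower:
  assumes p: "p \<in> trapped x" and c: "c < p"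
  shows "\<forall>\<^sub>F y in nhds x. \<exists>p'\<in>trapped y. c < p'"
proof -
  obtain b a u v where s: "seg b p u" "seg p a v" by (rule segs_at[of p])
  have L: "slope x p u \<le> 0" using locmin_slope_left[OF trapped_locmin[OF p] s(1)] .
  define c1 where "c1 = (max b c + p) / 2"
  define c2 where "c2 = (c1 + p) / 2"
  have c12: "b < c1" "c < c1" "c1 < c2" "c2 < p"
    using seg_less[OF s(1)] c by (auto simp: c1_def c2_def max_def)
  have "\<forall>\<^sub>F y in nhds x. dec y b c2" using seg_dec_robust[OF s(1) L] c12 by simp
  then have "\<forall>\<^sub>F y in nhds x. dec y c1 c2" by (rule eventually_mono) (use c12 in \<open>auto intro: dec_sub\<close>)
  then have "\<forall>\<^sub>F y in nhds x. \<exists>p'\<in>trapped y. c2 \<le> p'" using c12 by (intro gate_from[OF p]) auto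
  moreover have "c < c2" using c12 by simp
  ultimately show ?thesis by (auto elim!: eventually_mono intro: less_le_trans)
qed

definition next_peak :: "real \<Rightarrow> real \<Rightarrow> real \<Rightarrow> bool" where
  "next_peak x p M \<longleftrightarrow> p < M \<and> M < x + 1 \<and> inc x p M \<and> (\<exists>M'>M. dec x M M')"

lemma next_peak_exists: "p \<in> trapped x \<Longrightarrow> \<exists>M. next_peak x p M"
  using next_max[OF trapped_locmin] by (simp add: next_peak_def trapped_def) metis

lemma peak_slopes:
  assumes "next_peak x p M" "seg b M u" "seg M c v"
  shows "slope x M u > 0" "slope x M v < 0"
proof -
  obtain M' where M: "p < M" "inc x p M" "M' > M" "dec x M M'" using assms(1) by (auto simp: next_peak_def)
  show "slope x M u > 0"
  proof (rule ccontr)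
    assume "\<not> slope x M u > 0"
    then have "dec x b M" using seg_dec[OF assms(2)] by simp
    then have "phi x M < phi x (max b p)" using M seg_less[OF assms(2)] by (auto simp: dec_def)
    moreover have "phi x (max b p) < phi x M" using M seg_less[OF assms(2)] by (auto simp: inc_def)
    ultimately show False by simp
  qed
  show "slope x M v < 0"
  proof (rule ccontr)
    assume "\<not> slope x M v < 0"
    then have "inc x M c" using seg_inc[OF assms(3)] by simp
    then have "phi x M < phi x (min c M')" using M seg_less[OF assms(3)] by (auto simp: inc_def)
    moreover have "phi x (min c M') < phi x M" using M seg_less[OF assms(3)] by (auto simp: dec_def)
    ultimately show False by simp
  qed
qed

text \<open>A peak needs slopes of opposite signs for its two velocities, which agree inside a
  segment. So peaks occur only at vertices.\<close>

lemma peak_not_inside: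
  assumes "next_peak x p M" "seg a b v" "a < M" "M < b" shows False
proof -
  have "seg a M v" "seg M b v" using seg_sub[OF assms(2)] assms(3,4) by simp_all
  then show False using peak_slopes[OF assms(1)] by fastforce
qed

text \<open>To the right of the peak there is a gate. A trapped puppy at or above \<open>M\<close>
  would be led by a walk to \<open>x\<close> beyond the gate, hence above the top.\<close>

lemma top_below_peak:
  assumes "is_top x p" "next_peak x p M"
  shows "\<forall>\<^sub>F y in nhds x. \<forall>p'\<in>trapped y. p' < M"
proof -
  obtain b c u v where s: "seg b M u" "seg M c v" by (rule segs_at[of M])
  obtain c' where c': "M < c'" "\<forall>\<^sub>F y in nhds x. dec y M c'"
    by (rule seg_dec_short[OF s(2) peak_slopes(2)[OF assms(2) s]])
  show ?thesis
    using gate_to[OF c']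
  proof eventually_elim
    case (elim y)
    show ?case
    proof (rule ballI, rule ccontr)
      fix p' assume "p' \<in> trapped y" "\<not> p' < M"
      moreover have "M \<le> p'" using \<open>\<not> p' < M\<close> by simp
      ultimately obtain q where "q \<in> trapped x" "c' \<le> q" using elim by blast
      then show False using assms c' by (force simp: is_top_def next_peak_def)
    qed
  qed
qed

lemma parallel:
  fixes u v z :: complex
  assumes "z \<noteq> 0" "z \<bullet> u = 0" "z \<bullet> v = 0" "v \<noteq> 0"
  shows "\<exists>l. u = l *\<^sub>R v"
proof -
  have 1: "Re z * Re u + Im z * Im u = 0" "Re z * Re v + Im z * Im v = 0"
    using assms by (simp_all add: inner_complex_def)
  have cross: "Re u * Im v = Im u * Re v"
  proof (cases "Re z = 0")
    case True
    then have "Im z \<noteq> 0" using assms(1) by (auto simp: complex_eq_iff)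
    then show ?thesis using 1 True by simp
  next
    case False
    have "Re z * (Re u * Im v - Im u * Re v) = (Re z * Re u) * Im v - Im u * (Re z * Re v)"
      by (simp add: algebra_simps)
    also have "Re z * Re u = - (Im z * Im u)" using 1 by linarith
    also have "Re z * Re v = - (Im z * Im v)" using 1 by linarith
    finally have "Re z * (Re u * Im v - Im u * Re v) = 0" by (simp add: algebra_simps)
    then show ?thesis using False by simp
  qed
  define n where "n = Re v * Re v + Im v * Im v"
  have "n \<noteq> 0" using assms(4) by (auto simp: n_def complex_eq_iff sum_squares_eq_zero_iff)
  define m where "m = Re u * Re v + Im u * Im v"
  have "Re u * n = m * Re v" "Im u * n = m * Im v"
    unfolding n_def m_def using cross by algebra+
  then have "u = (m / n) *\<^sub>R v" using \<open>n \<noteq> 0\<close> by (simp add: complex_eq_iff field_simps)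
  then show ?thesis by blast
qed

text \<open>Otherwise the second segment would retrace the first, against injectivity.\<close>

lemma no_backtrack:
  assumes "seg b a u" "seg a c v" "u = l *\<^sub>R v" shows "l > 0"
proof (rule ccontr)
  assume "\<not> l > 0"
  moreover have "l \<noteq> 0" using assms(3) seg_nz[OF assms(1)] by auto
  ultimately have "l < 0" by simp
  define k where "k = - l"
  have "k > 0" using \<open>l < 0\<close> by (simp add: k_def)
  \<comment> \<open>The first two bounds keep the coinciding points on their segments, the third
    keeps them less than a lap apart.\<close>
  define s where "s = min (a - b) (min ((c - a) / k) (1 / 2 / (1 + k)))"
  have "s > 0" using seg_less[OF assms(1)] seg_less[OF assms(2)] \<open>k > 0\<close> by (simp add: s_def)
  have "s \<le> a - b" "s \<le> (c - a) / k" "s \<le> 1 / 2 / (1 + k)" by (simp_all add: s_def)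
  then have s: "s \<le> a - b" "s * k \<le> c - a" "s * (1 + k) \<le> 1 / 2"
    using \<open>k > 0\<close> by (simp_all only: pos_le_divide_eq add_pos_pos zero_less_one)
  have "G (a - s) - G a = (a - s - a) *\<^sub>R u"
    using assms(1) s(1) \<open>s > 0\<close> unfolding seg_def by auto
  also have "\<dots> = (a + s * k - a) *\<^sub>R v" by (simp add: assms(3) k_def)
  also have "\<dots> = G (a + s * k) - G a"
    using assms(2) s(2) \<open>s > 0\<close> \<open>k > 0\<close> unfolding seg_def by auto
  finally have "G (a - s) = G (a + s * k)" by simp
  moreover have "0 < s * k" using \<open>s > 0\<close> \<open>k > 0\<close> by simp
  then have "a - s < a + s * k" using \<open>s > 0\<close> by linarith
  moreover have "a + s * k < a - s + 1" using s(3) by (simp add: algebra_simps)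
  ultimately show False using neq by blast
qed

end

section \<open>The curve above a trap\<close>

text \<open>Near each point a constant works. A partition of unity for a finite subcover blends the
  constants; the blend lies between the least and the greatest constant in use at the point, both of
  which are admissible there.\<close>

lemma continuous_selection:
  fixes P :: "real \<Rightarrow> real \<Rightarrow> bool"
  assumes loc: "\<And>x. x \<in> {A..B} \<Longrightarrow> \<exists>r. \<forall>\<^sub>F y in nhds x. P y r"
    and conv: "\<And>y r1 r r2. P y r1 \<Longrightarrow> P y r2 \<Longrightarrow> r1 \<le> r \<Longrightarrow> r \<le> r2 \<Longrightarrow> P y r"
  obtains f where "continuous_on {A..B} f" "\<And>x. x \<in> {A..B} \<Longrightarrow> P x (f x)"
proof -
  define C where "C = {V. open V \<and> (\<exists>r. \<forall>y\<in>V. P y r)}"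
  have "{A..B} \<subseteq> \<Union>C"
  proof
    fix x assume "x \<in> {A..B}"
    then obtain r where "\<forall>\<^sub>F y in nhds x. P y r" using loc by blast
    then obtain V where "open V" "x \<in> V" "\<forall>y\<in>V. P y r" unfolding eventually_nhds by blast
    then show "x \<in> \<Union>C" unfolding C_def by blast
  qed
  then obtain D where D: "D \<subseteq> C" "finite D" "{A..B} \<subseteq> \<Union>D"
  proof (rule compactE[OF compact_Icc])
    show "open V" if "V \<in> C" for V using that by (simp add: C_def)
  qed
  have openD: "open V" if "V \<in> D" for V using D(1) that unfolding C_def by blast
  have "\<forall>V\<in>D. \<exists>r. \<forall>y\<in>V. P y r" using D(1) unfolding C_def by blast
  then obtain \<rho> where \<rho>: "\<And>V y. V \<in> D \<Longrightarrow> y \<in> V \<Longrightarrow> P y (\<rho> V)" by metis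
  have fin: "\<exists>V. open V \<and> x \<in> V \<and> finite {U \<in> D. U \<inter> V \<noteq> {}}" for x :: real
    using D(2) by (intro exI[of _ UNIV]) simp
  obtain F :: "real set \<Rightarrow> real \<Rightarrow> real" where
    F: "\<forall>U\<in>D. continuous_on {A..B} (F U) \<and> (\<forall>x\<in>{A..B}. 0 \<le> F U x)"
    "\<forall>U\<in>D. \<forall>x\<in>{A..B}. x \<notin> U \<longrightarrow> F U x = 0" "\<forall>x\<in>{A..B}. supp_sum (\<lambda>W. F W x) D = 1"
  proof (rule subordinate_partition_of_unity[OF D(3) openD fin])
    fix F :: "real set \<Rightarrow> real \<Rightarrow> real"
    assume a: "\<And>U. U \<in> D \<Longrightarrow> continuous_on {A..B} (F U) \<and> (\<forall>x\<in>{A..B}. 0 \<le> F U x)"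
      "\<And>x U. U \<in> D \<Longrightarrow> x \<in> {A..B} \<Longrightarrow> x \<notin> U \<Longrightarrow> F U x = 0"
      "\<And>x. x \<in> {A..B} \<Longrightarrow> supp_sum (\<lambda>W. F W x) D = 1"
    show thesis by (rule that[of F]) (use a in blast)+
  qed
  have restrict: "(\<Sum>V\<in>D. F V x * g V) = (\<Sum>V\<in>{V \<in> D. F V x \<noteq> 0}. F V x * g V)" for g x
    by (rule sum.mono_neutral_right) (use D(2) in auto)
  define f where "f x = (\<Sum>V\<in>D. F V x * \<rho> V)" for x
  show thesis
  proof (rule that[of f])
    show "continuous_on {A..B} f" unfolding f_def using F(1) by (intro continuous_intros) blast
    fix x assume x: "x \<in> {A..B}"
    define E where "E = {V \<in> D. F V x \<noteq> 0}"
    have "finite E" using D(2) by (simp add: E_def)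
    have E1: "(\<Sum>V\<in>E. F V x) = 1"
      using bspec[OF F(3) x] by (simp add: E_def supp_sum_def support_on_def)
    have "E \<noteq> {}" using E1 by (metis sum.empty zero_neq_one)
    have fE: "f x = (\<Sum>V\<in>E. F V x * \<rho> V)" unfolding f_def E_def by (rule restrict)
    have F0: "0 \<le> F V x" if "V \<in> E" for V using F(1) x that unfolding E_def by blast
    have PE: "P x (\<rho> V)" if "V \<in> E" for V
    proof (rule \<rho>)
      show "V \<in> D" "x \<in> V" using that F(2) x unfolding E_def by blast+
    qed
    have "Min (\<rho> ` E) \<in> \<rho> ` E" "Max (\<rho> ` E) \<in> \<rho> ` E"
      using \<open>finite E\<close> \<open>E \<noteq> {}\<close> by simp_all
    moreover have "P x r" if "r \<in> \<rho> ` E" for r using that by (rule imageE) (simp add: PE)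
    ultimately have "P x (Min (\<rho> ` E))" "P x (Max (\<rho> ` E))" by simp_all
    moreover have "Min (\<rho> ` E) \<le> f x"
    proof -
      have "Min (\<rho> ` E) = (\<Sum>V\<in>E. F V x * Min (\<rho> ` E))" by (simp add: sum_distrib_right[symmetric] E1)
      also have "\<dots> \<le> f x"
        unfolding fE using F0 \<open>finite E\<close> by (intro sum_mono mult_left_mono) auto
      finally show ?thesis .
    qed
    moreover have "f x \<le> Max (\<rho> ` E)"
    proof -
      have "f x \<le> (\<Sum>V\<in>E. F V x * Max (\<rho> ` E))"
        unfolding fE using F0 \<open>finite E\<close> by (intro sum_mono mult_left_mono) auto
      also have "\<dots> = Max (\<rho> ` E)" by (simp add: sum_distrib_right[symmetric] E1)
      finally show ?thesis .
    qed
    ultimately show "P x (f x)" by (rule conv)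
  qed
qed

context puppy_trap
begin

text \<open>A sequence violating the claim accumulates at a human position \<open>x0\<close> and a vertex \<open>w\<close>
  where a stable foot point runs into the peak. Walking to \<open>x0\<close> pushes the puppy past \<open>w\<close>,
  so by lower semicontinuity the top of the trap near \<open>x0\<close> lies beyond \<open>w\<close>, too.\<close>

lemma uniform_gap:
  assumes "trapped z \<noteq> {}"
  shows "\<exists>e>0. \<forall>x\<in>{A..B}. \<forall>p M. is_top x p \<and> next_peak x p M \<longrightarrow>
    (\<forall>\<^sub>F y in nhds x. \<forall>q. is_top y q \<longrightarrow> q + e < M)"
proof (rule ccontr)
  assume neg: "\<not> ?thesis"
  \<comment> \<open>The counterexample number \<open>n\<close>: close to \<open>x\<close> there is a
    \<open>y\<close> whose top \<open>q\<close> is below the peak \<open>M\<close> of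
    \<open>x\<close>, but by no more than \<open>1 / (n + 1)\<close>.\<close>
  have "\<exists>x p M y q. x \<in> {A..B} \<and> is_top x p \<and> next_peak x p M \<and> is_top y q \<and>
      M \<le> q + inverse (real (Suc n)) \<and> q < M \<and> dist y x < inverse (real (Suc n))" for n
  proof -
    define e where "e = inverse (real (Suc n))"
    have "e > 0" by (simp add: e_def)
    then obtain x p M where x: "x \<in> {A..B}" "is_top x p" "next_peak x p M"
      "\<not> (\<forall>\<^sub>F y in nhds x. \<forall>q. is_top y q \<longrightarrow> q + e < M)" using neg by blast
    have ev: "\<forall>\<^sub>F y in nhds x. (\<forall>p'\<in>trapped y. p' < M) \<and> dist y x < e"
      by (intro eventually_conj top_below_peak[OF x(2,3)] eventually_dist_less \<open>e > 0\<close>)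
    have "\<exists>y. ((\<forall>p'\<in>trapped y. p' < M) \<and> dist y x < e) \<and> \<not> (\<forall>q. is_top y q \<longrightarrow> q + e < M)"
    proof (rule ccontr)
      assume *: "\<not> ?thesis"
      have "\<forall>\<^sub>F y in nhds x. \<forall>q. is_top y q \<longrightarrow> q + e < M" by (rule eventually_mono[OF ev]) (use * in blast)
      then show False using x(4) by simp
    qed
    then obtain y q where y: "\<forall>p'\<in>trapped y. p' < M" "dist y x < e" "is_top y q" "\<not> q + e < M" by blast
    then have "q < M" "M \<le> q + e" by (simp_all add: is_top_def)
    then show ?thesis using x(1-3) y(2,3) unfolding e_def by blast
  qed
  then obtain X Pk M Y Q where seq: "\<And>n. X n \<in> {A..B}" "\<And>n. is_top (X n) (Pk n)" "\<And>n. next_peak (X n) (Pk n) (M n)"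
    "\<And>n. is_top (Y n) (Q n)" "\<And>n. M n \<le> Q n + inverse (real (Suc n))" "\<And>n. Q n < M n"
    "\<And>n. dist (Y n) (X n) < inverse (real (Suc n))"
    by metis
  have MI: "M n \<in> {A..B + 1}" for n
    using seq(1,2,3)[of n] by (auto simp: is_top_def next_peak_def trapped_def)
  have "compact ({A..B} \<times> {A..B + 1})" by (intro compact_Times compact_Icc)
  then obtain l r where l: "l \<in> {A..B} \<times> {A..B + 1}" "strict_mono r" "((\<lambda>n. (X n, M n)) \<circ> r) \<longlonglongrightarrow> l"
    using seq(1) MI unfolding compact_def by (metis (no_types, lifting) mem_Sigma_iff)
  define x0 w where "x0 = fst l" and "w = snd l"
  have Xlim: "(\<lambda>n. X (r n)) \<longlonglongrightarrow> x0" and Mlim: "(\<lambda>n. M (r n)) \<longlonglongrightarrow> w"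
    using tendsto_fst[OF l(3)] tendsto_snd[OF l(3)] by (simp_all add: x0_def w_def o_def)
  have inv: "(\<lambda>n. inverse (real (Suc (r n)))) \<longlonglongrightarrow> 0"
    using LIMSEQ_subseq_LIMSEQ[OF LIMSEQ_inverse_real_of_nat l(2)] by (simp add: o_def)
  have "(\<lambda>n. Y (r n) - X (r n)) \<longlonglongrightarrow> 0"
    by (rule Lim_null_comparison[OF _ inv]) (use seq(7) in \<open>auto simp: dist_real_def less_imp_le\<close>)
  from tendsto_add[OF this Xlim] have Ylim: "(\<lambda>n. Y (r n)) \<longlonglongrightarrow> x0" by simp
  have "(\<lambda>n. Q (r n) - M (r n)) \<longlonglongrightarrow> 0"
  proof (rule Lim_null_comparison[OF _ inv], intro always_eventually allI)
    show "norm (Q (r n) - M (r n)) \<le> inverse (real (Suc (r n)))" for n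
      using seq(5)[of "r n"] seq(6)[of "r n"] unfolding real_norm_def by linarith
  qed
  from tendsto_add[OF this Mlim] have Qlim: "(\<lambda>n. Q (r n)) \<longlonglongrightarrow> w" by simp

  obtain p0 where p0: "is_top x0 p0" using top_exists[OF trapped_nonempty[OF assms]] by blast
  \<comment> \<open>Otherwise \<open>top_lower\<close> would keep the tops \<open>Q (r n)\<close>,
    which tend to \<open>w\<close>, above some \<open>c > w\<close>.\<close>
  have "p0 \<le> w"
  proof (rule ccontr)
    assume "\<not> p0 \<le> w"
    then obtain c where c: "w < c" "c < p0" using dense[of w p0] by auto
    have "\<forall>\<^sub>F n in sequentially. \<exists>p'\<in>trapped (Y (r n)). c < p'"
      using top_lower[OF _ c(2)] p0 Ylim by (auto simp: is_top_def filterlim_iff)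
    moreover have "\<forall>\<^sub>F n in sequentially. Q (r n) < c" using Qlim c(1) by (rule order_tendstoD)
    ultimately have "\<forall>\<^sub>F n in sequentially. False"
    proof eventually_elim
      case (elim n)
      then show False using seq(4)[of "r n"] by (force simp: is_top_def)
    qed
    then show False by simp
  qed

  obtain b c u v where s: "seg b w u" "seg w c v" by (rule segs_at[of w])
  have bw: "b < w" "w < c" using seg_less s by auto
  have "\<forall>\<^sub>F n in sequentially. b < M (r n)" "\<forall>\<^sub>F n in sequentially. M (r n) < c"
    using order_tendstoD[OF Mlim] bw by auto
  \<comment> \<open>Peaks are vertices, and between \<open>b\<close> and \<open>c\<close> only
    \<open>w\<close> can be one.\<close>
  then have Mw: "\<forall>\<^sub>F n in sequentially. M (r n) = w"
  proof eventually_elim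
    case (elim n)
    show ?case
      using peak_not_inside[OF seq(3)[of "r n"] s(1)] peak_not_inside[OF seq(3)[of "r n"] s(2)] elim
      by (cases "M (r n)" w rule: linorder_cases) simp_all
  qed
  have slopes: "\<forall>\<^sub>F n in sequentially. 0 < slope (X (r n)) w u \<and> slope (X (r n)) w v < 0"
    using Mw
  proof eventually_elim
    case (elim n)
    have "next_peak (X (r n)) (Pk (r n)) w" using seq(3)[of "r n"] elim by simp
    from peak_slopes[OF this s] show ?case by simp
  qed
  have Qb: "\<forall>\<^sub>F n in sequentially. b < Q (r n)" using Qlim bw(1) by (rule order_tendstoD)
  \<comment> \<open>As \<open>Q (r n)\<close> is below the peak \<open>w\<close>, it lies inside the
    left segment, where stability means slope zero.\<close>
  with Mw have "\<forall>\<^sub>F n in sequentially. slope (Y (r n)) (Q (r n)) u = 0"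
  proof eventually_elim
    case (elim n)
    have "locmin (phi (Y (r n))) (Q (r n))" using seq(4)[of "r n"] trapped_locmin by (simp add: is_top_def)
    then show ?case using locmin_inside[OF s(1), of "Q (r n)"] seq(6)[of "r n"] elim by simp
  qed
  then have "(\<lambda>n. slope (Y (r n)) (Q (r n)) u) \<longlonglongrightarrow> 0" by (rule tendsto_eventually)
  then have L0: "slope x0 w u = 0"
    using tendsto_slope[OF Ylim Qlim, of u] LIMSEQ_unique by blast
  have "slope x0 w v \<le> 0"
  proof (rule tendsto_upperbound)
    show "(\<lambda>n. slope (X (r n)) w v) \<longlonglongrightarrow> slope x0 w v" by (intro tendsto_slope Xlim tendsto_const)
    show "\<forall>\<^sub>F n in sequentially. slope (X (r n)) w v \<le> 0"
      using slopes by eventually_elim simp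
  qed simp

  define c2 where "c2 = (b + w) / 2"
  have c2: "b < c2" "c2 < w" using bw by (simp_all add: c2_def)
  have "\<forall>\<^sub>F y in nhds x0. dec y b c2" using c2 L0 by (intro seg_dec_robust[OF s(1)]) auto
  from eventually_compose_filterlim[OF gate_to[OF c2(1) this] Ylim]
  have "\<forall>\<^sub>F n in sequentially. \<forall>p\<in>trapped (Y (r n)). b \<le> p \<longrightarrow> (\<exists>p'\<in>trapped x0. c2 \<le> p')"
    .
  with Qb have "\<forall>\<^sub>F n in sequentially. \<exists>p'\<in>trapped x0. c2 \<le> p'"
  proof eventually_elim
    case (elim n)
    have "Q (r n) \<in> trapped (Y (r n))" using seq(4) by (simp add: is_top_def)
    then show ?case using elim less_imp_le by blast
  qed
  then obtain p' where p': "p' \<in> trapped x0" "c2 \<le> p'" by auto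
  \<comment> \<open>There is no stable position from \<open>c2\<close> up to \<open>w\<close>, so
    \<open>p'\<close> can only be \<open>w\<close>.\<close>
  have "dec x0 b w" using L0 by (intro seg_dec[OF s(1)]) simp
  then have "\<not> p' < w" using not_locmin_dec[of x0 b w p'] trapped_locmin[OF p'(1)] p'(2) c2 by auto
  moreover have "p' \<le> w" using p0 p'(1) \<open>p0 \<le> w\<close> by (auto simp: is_top_def)
  ultimately have wT: "w \<in> trapped x0" using p'(1) by simp
  then have "slope x0 w v = 0"
    using locmin_slope_right[OF trapped_locmin[OF wT] s(2)] \<open>slope x0 w v \<le> 0\<close> by simp
  \<comment> \<open>Both segments at \<open>w\<close> are orthogonal to the line of sight from
    \<open>x0\<close>, hence parallel and equally oriented. Their slopes then agree in sign for
    every human position, contrary to \<open>slopes\<close>.\<close>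
  moreover have "G w - G x0 \<noteq> 0" using neq[of x0 w] wT by (auto simp: trapped_def)
  ultimately obtain k where k: "u = k *\<^sub>R v"
    using parallel[of "G w - G x0" u v] L0 seg_nz[OF s(2)] by (auto simp: slope_def)
  have "k > 0" using no_backtrack[OF s k] .
  obtain n where n: "0 < slope (X (r n)) w u" "slope (X (r n)) w v < 0"
    using slopes by (auto simp: eventually_sequentially)
  have "slope (X (r n)) w u = k * slope (X (r n)) w v" by (simp add: slope_def k)
  then show False using n \<open>k > 0\<close> by (simp add: zero_less_mult_iff)
qed

text \<open>All small \<open>e\<close> are covered, because the curves above and below the trap must
  share the same \<open>e\<close>. The bound \<open>e0\<close> is the uniform gap between nearby
  tops and the peak.\<close>

lemma upper_curve:
  assumes "trapped z \<noteq> {}"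
  shows "\<exists>e0>0. \<forall>e. 0 < e \<and> e \<le> e0 \<longrightarrow> (\<exists>f. continuous_on {A..B} f \<and>
    (\<forall>x\<in>{A..B}. (\<forall>p\<in>trapped x. p < f x) \<and> f x + e < x + 1 \<and> phi x (f x) < phi x (f x + e)))"
proof -
  obtain e0 where e0: "e0 > 0" "\<And>x p M. x \<in> {A..B} \<Longrightarrow> is_top x p \<Longrightarrow> next_peak x p M \<Longrightarrow>
    (\<forall>\<^sub>F y in nhds x. \<forall>q. is_top y q \<longrightarrow> q + e0 < M)"
    using uniform_gap[OF assms, of A B] by blast
  have "\<exists>f. continuous_on {A..B} f \<and>
    (\<forall>x\<in>{A..B}. (\<forall>p\<in>trapped x. p < f x) \<and> f x + e < x + 1 \<and> phi x (f x) < phi x (f x + e))"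
    if e: "0 < e" "e \<le> e0" for e
  proof -
    \<comment> \<open>Asking for the inequality on all of \<open>{p..r}\<close> makes the admissible
      \<open>r\<close> an interval, as \<open>continuous_selection\<close> needs.\<close>
    define P where "P y r \<longleftrightarrow> (\<exists>p. is_top y p \<and> p < r \<and> r + e < y + 1 \<and> (\<forall>v\<in>{p..r}. phi y v < phi y (v + e)))" for y r
    have loc: "\<exists>r. \<forall>\<^sub>F y in nhds x. P y r" if "x \<in> {A..B}" for x
    proof -
      obtain p where p: "is_top x p" using top_exists[OF trapped_nonempty[OF assms]] by blast
      then have pT: "p \<in> trapped x" by (simp add: is_top_def)
      then obtain M where M: "next_peak x p M" using next_peak_exists by blast
      note gap = e0(2)[OF that p M]
      \<comment> \<open>Shifting \<open>{p..r}\<close> by \<open>e\<close> then stays below the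
        peak, where the distance increases.\<close>
      define r where "r = M - e0"
      have "p < r" using eventually_nhds_x_imp_x[OF gap] p by (auto simp: r_def)
      define \<psi> where "\<psi> v = phi x (v + e) - phi x v" for v
      have cont\<psi>: "continuous_on S \<psi>" for S unfolding \<psi>_def by (intro continuous_intros)
      have pos: "\<psi> v > 0" if "v \<in> {p..r}" for v
        using M that e by (auto simp: \<psi>_def next_peak_def inc_def r_def)
      have "isCont \<psi> p" using cont\<psi>[of UNIV] by (simp add: continuous_on_eq_continuous_at)
      then have "\<forall>\<^sub>F v in nhds p. 0 < \<psi> v"
        using order_tendstoD(1)[of \<psi> "\<psi> p" "nhds p" 0] pos[of p] \<open>p < r\<close>
        by (simp add: isCont_def tendsto_at_iff_tendsto_nhds)
      then obtain k where k: "k > 0" "\<And>v. dist v p < k \<Longrightarrow> 0 < \<psi> v"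
        unfolding eventually_nhds_metric by blast
      \<comment> \<open>The top for a nearby human position may be slightly lower than
        \<open>p\<close>; the margin \<open>k / 2\<close> allows for it.\<close>
      define K where "K = {p - k / 2..r}"
      have posK: "\<psi> v > 0" if "v \<in> K" for v
      proof (cases "v < p")
        case True
        then have "dist v p < k" using that k(1) by (simp add: K_def dist_real_def)
        then show ?thesis by (rule k(2))
      next
        case False
        then show ?thesis using pos that by (simp add: K_def)
      qed
      have "K \<noteq> {}" "compact K" using \<open>p < r\<close> k(1) by (auto simp: K_def)
      then obtain v0 where v0: "v0 \<in> K" "\<And>v. v \<in> K \<Longrightarrow> \<psi> v0 \<le> \<psi> v"
        using continuous_attains_inf[OF _ _ cont\<psi>] by metis
      \<comment> \<open>Moving the human changes each of the two compared distances by at most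
        \<open>dist (G y) (G x)\<close>; hence half the minimum of \<open>\<psi>\<close>.\<close>
      have "((\<lambda>y. dist (G y) (G x)) \<longlongrightarrow> dist (G x) (G x)) (nhds x)"
        by (intro tendsto_dist tendsto_G tendsto_const filterlim_ident)
      then have "\<forall>\<^sub>F y in nhds x. dist (G y) (G x) < \<psi> v0 / 2"
        using posK[OF v0(1)] by (intro order_tendstoD(2)) auto
      moreover have "\<forall>\<^sub>F y in nhds x. \<exists>p'\<in>trapped y. p - k / 2 < p'"
        using k(1) by (intro top_lower[OF pT]) simp
      moreover have "M - 1 < x" using M by (simp add: next_peak_def)
      then have "\<forall>\<^sub>F y in nhds x. M - 1 < y"
        by (intro order_tendstoD(1)[OF filterlim_ident])
      ultimately have "\<forall>\<^sub>F y in nhds x. P y r"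
        using gap
      proof eventually_elim
        case (elim y)
        obtain p' where p': "p' \<in> trapped y" "p - k / 2 < p'" using elim(2) by blast
        obtain q where q: "is_top y q" using top_exists[OF trapped_nonempty[OF assms]] by blast
        have "q < r" using elim(4) q by (auto simp: r_def)
        have "p - k / 2 < q" using p' q by (auto simp: is_top_def)
        have "phi y v < phi y (v + e)" if "v \<in> {q..r}" for v
        proof -
          have "\<psi> v0 \<le> \<psi> v" using that \<open>p - k / 2 < q\<close> by (intro v0(2)) (simp add: K_def)
          moreover have "phi x (v + e) \<le> phi y (v + e) + dist (G y) (G x)"
            unfolding dist_fun_def by (metis add.commute dist_commute dist_triangle)
          moreover have "phi y v \<le> phi x v + dist (G y) (G x)"
            unfolding dist_fun_def by (metis add.commute dist_triangle)
          ultimately show ?thesis using elim(1) by (simp add: \<psi>_def)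
        qed
        moreover have "r + e < y + 1" using elim(3) e by (simp add: r_def)
        ultimately show ?case using q \<open>q < r\<close> by (auto simp: P_def)
      qed
      then show ?thesis by blast
    qed
    have conv: "P y r" if P: "P y r1" "P y r2" and r: "r1 \<le> r" "r \<le> r2" for y r1 r r2
    proof -
      obtain q1 where q1: "is_top y q1" "q1 < r1" using P(1) by (auto simp: P_def)
      obtain q2 where q2: "is_top y q2" "r2 + e < y + 1" "\<forall>v\<in>{q2..r2}. phi y v < phi y (v + e)"
        using P(2) by (auto simp: P_def)
      have "q2 = q1" using top_unique q1(1) q2(1) by blast
      then show ?thesis using q1 q2 r by (auto simp: P_def)
    qed
    obtain f where f: "continuous_on {A..B} f" "\<And>x. x \<in> {A..B} \<Longrightarrow> P x (f x)"
      by (rule continuous_selection[of A B P, OF loc conv]) auto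
    have "(\<forall>p\<in>trapped x. p < f x) \<and> f x + e < x + 1 \<and> phi x (f x) < phi x (f x + e)" if x: "x \<in> {A..B}" for x
    proof -
      obtain q where q: "is_top x q" "q < f x" "f x + e < x + 1" "\<forall>v\<in>{q..f x}. phi x v < phi x (v + e)"
        using f(2)[OF x] by (auto simp: P_def)
      then show ?thesis by (auto simp: is_top_def)
    qed
    then show ?thesis using f(1) by blast
  qed
  then show ?thesis using e0(1) by blast
qed

end

section \<open>Absence of traps\<close>

lemma response_reflect:
  assumes "puppy_response G x d q f"
  shows "puppy_response (\<lambda>s. G (- s)) (- x) (- d) (- q) (\<lambda>t. - f t)"
proof -
  have eq: "dist_fun (\<lambda>s. G (- s)) (- x + t * (- d)) = (\<lambda>s. dist_fun G (x + t * d) (- s))" for t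
    by (simp add: dist_fun_def fun_eq_iff add.commute)
  have eq0: "dist_fun (\<lambda>s. G (- s)) (- x) = (\<lambda>s. dist_fun G x (- s))"
    by (simp add: dist_fun_def fun_eq_iff)
  have "\<exists>l. ((\<lambda>t. - f t) \<longlongrightarrow> l) (at_left t) \<and> puppy_run (dist_fun G (x + t * d)) (- l) (f t)"
    if t: "t \<in> {0<..1}" for t
  proof -
    obtain l where "(f \<longlongrightarrow> l) (at_left t)" "puppy_run (dist_fun G (x + t * d)) l (f t)"
      using assms t unfolding puppy_response_def by blast
    then show ?thesis by (intro exI[of _ "- l"]) (simp add: tendsto_minus)
  qed
  moreover have "((\<lambda>t. - f t) \<longlongrightarrow> - f t) (at_right t)" if "t \<in> {0..<1}" for t
    using assms that by (simp add: puppy_response_def tendsto_minus)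
  ultimately show ?thesis
    using assms unfolding puppy_response_def eq eq0 locmin_reflect puppy_run_reflect by simp
qed

lemma trap_reflect:
  assumes "trap G T" shows "trap (\<lambda>s. G (- s)) (\<lambda>x q. T (- x) (- q))"
  unfolding trap_def
proof (intro allI impI conjI)
  fix x q assume T: "T (- x) (- q)"
  have eq: "dist_fun (\<lambda>s. G (- s)) x = (\<lambda>s. dist_fun G (- x) (- s))"
    by (simp add: dist_fun_def fun_eq_iff)
  show "locmin (dist_fun (\<lambda>s. G (- s)) x) q"
    unfolding eq locmin_reflect using assms T by (simp add: trap_def)
  fix d assume "\<exists>f. puppy_response (\<lambda>s. G (- s)) x d q f"
  then obtain f where "puppy_response (\<lambda>s. G (- s)) x d q f" by blast
  from response_reflect[OF this] have "\<exists>f. puppy_response G (- x) (- d) (- q) f" by auto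
  then obtain f' where f': "puppy_response G (- x) (- d) (- q) f'"
    "\<And>t. t \<in> {0..1} \<Longrightarrow> G (- x + t * - d) \<noteq> G (f' t)" "T (- x + - d) (f' 1)"
    using assms T unfolding trap_def by blast
  show "\<exists>f. puppy_response (\<lambda>s. G (- s)) x d q f \<and> (\<forall>t\<in>{0..1}. G (- (x + t * d)) \<noteq> G (- f t)) \<and>
    T (- (x + d)) (- f 1)"
    using response_reflect[OF f'(1)] f'(2,3) by (intro exI[of _ "\<lambda>t. - f' t"]) simp
qed

context closed_curve
begin

section \<open>Invariance under shifting the puppy by whole laps\<close>

lemma locmin_shift: "locmin (dist_fun G x) (q + of_int k) \<longleftrightarrow> locmin (dist_fun G x) q"
proof -
  have *: "dist_fun G x (s + of_int k) = dist_fun G x s" for s by (simp add: dist_fun_def periodic_int)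
  have "(\<forall>s. \<bar>s - (q + of_int k)\<bar> < e \<longrightarrow> dist_fun G x q \<le> dist_fun G x s) \<longleftrightarrow>
    (\<forall>s. \<bar>s - q\<bar> < e \<longrightarrow> dist_fun G x q \<le> dist_fun G x s)" for e
  proof (intro iffI allI impI)
    fix s assume a: "\<forall>s. \<bar>s - (q + of_int k)\<bar> < e \<longrightarrow> dist_fun G x q \<le> dist_fun G x s" "\<bar>s - q\<bar> < e"
    show "dist_fun G x q \<le> dist_fun G x s" using a(1)[rule_format, of "s + of_int k"] a(2) * by simp
  next
    fix s assume a: "\<forall>s. \<bar>s - q\<bar> < e \<longrightarrow> dist_fun G x q \<le> dist_fun G x s" "\<bar>s - (q + of_int k)\<bar> < e"
    have "\<bar>s - of_int k - q\<bar> < e" using a(2) by (simp add: algebra_simps)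
    then show "dist_fun G x q \<le> dist_fun G x s"
      using a(1)[rule_format, of "s - of_int k"] *[of "s - of_int k"] by simp
  qed
  then show ?thesis unfolding locmin_def * by simp
qed

lemma puppy_run_shift:
  assumes "puppy_run (dist_fun G x) a b" shows "puppy_run (dist_fun G x) (a + of_int k) (b + of_int k)"
proof -
  have *: "dist_fun G x (s - of_int k) = dist_fun G x s" for s
    using periodic_int[of s "- k"] by (simp add: dist_fun_def)
  consider "b = a" "locmin (dist_fun G x) a"
    | "a < b" "\<forall>u v. a \<le> u \<and> u < v \<and> v \<le> b \<longrightarrow> dist_fun G x v < dist_fun G x u" "locmin (dist_fun G x) b"
    | "b < a" "\<forall>u v. b \<le> u \<and> u < v \<and> v \<le> a \<longrightarrow> dist_fun G x u < dist_fun G x v" "locmin (dist_fun G x) b"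
    using assms unfolding puppy_run_def by blast
  then show ?thesis
  proof cases
    case 1
    then show ?thesis by (simp add: puppy_run_def locmin_shift)
  next
    case 2
    have "dist_fun G x v < dist_fun G x u" if "a + of_int k \<le> u" "u < v" "v \<le> b + of_int k" for u v
      using 2(2)[rule_format, of "u - of_int k" "v - of_int k"] that by (simp add: *)
    then show ?thesis using 2 by (simp add: puppy_run_def locmin_shift)
  next
    case 3
    have "dist_fun G x u < dist_fun G x v" if "b + of_int k \<le> u" "u < v" "v \<le> a + of_int k" for u v
      using 3(2)[rule_format, of "u - of_int k" "v - of_int k"] that by (simp add: *)
    then show ?thesis using 3 by (simp add: puppy_run_def locmin_shift)
  qed
qed

lemma response_shift:
  assumes "puppy_response G x d q f"
  shows "puppy_response G x d (q + of_int k) (\<lambda>t. f t + of_int k)"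
proof -
  have "\<exists>l. ((\<lambda>t. f t + of_int k) \<longlongrightarrow> l) (at_left t) \<and> puppy_run (dist_fun G (x + t * d)) l (f t + of_int k)"
    if t: "t \<in> {0<..1}" for t
  proof -
    obtain l where l: "(f \<longlongrightarrow> l) (at_left t)" "puppy_run (dist_fun G (x + t * d)) l (f t)"
      using assms t unfolding puppy_response_def by blast
    have "((\<lambda>t. f t + of_int k) \<longlongrightarrow> l + of_int k) (at_left t)" by (intro tendsto_intros l(1))
    then show ?thesis using puppy_run_shift[OF l(2)] by blast
  qed
  moreover have "((\<lambda>t. f t + of_int k) \<longlongrightarrow> f t + of_int k) (at_right t)" if "t \<in> {0..<1}" for t
    using assms that by (intro tendsto_intros) (simp add: puppy_response_def)
  ultimately show ?thesis
    using assms unfolding puppy_response_def locmin_shift by (simp add: puppy_run_shift)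
qed

lemma trap_shift:
  assumes "trap G T" shows "trap G (\<lambda>x q. T x (q + of_int k))"
  unfolding trap_def
proof (intro allI impI conjI)
  fix x q assume T: "T x (q + of_int k)"
  then show "locmin (dist_fun G x) q" using assms locmin_shift[of x q k] by (simp add: trap_def)
  fix d assume "\<exists>f. puppy_response G x d q f"
  then obtain f where "puppy_response G x d q f" by blast
  from response_shift[OF this] have "\<exists>f. puppy_response G x d (q + of_int k) f" by blast
  then obtain f' where f': "puppy_response G x d (q + of_int k) f'"
    "\<And>t. t \<in> {0..1} \<Longrightarrow> G (x + t * d) \<noteq> G (f' t)" "T (x + d) (f' 1)"
    using assms T unfolding trap_def by blast
  have "puppy_response G x d q (\<lambda>t. f' t + of_int (- k))"
    using response_shift[OF f'(1), of "- k"] by simp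
  then show "\<exists>f. puppy_response G x d q f \<and> (\<forall>t\<in>{0..1}. G (x + t * d) \<noteq> G (f t)) \<and>
    T (x + d) (f 1 + of_int k)"
    using f'(2,3) periodic_int[of _ "- k"] by (intro exI[of _ "\<lambda>t. f' t + of_int (- k)"]) simp
qed

end

context pl_track
begin

text \<open>The curves just above the top and just below the bottom of a trap contradict
  \<open>no_crossing_curves\<close>; the latter is obtained by reversing the track.\<close>

lemma no_trap:
  assumes "trap G T" shows "\<not> T x q"
proof
  assume T: "T x q"
  then have lm: "locmin (phi x) q" using assms by (simp add: trap_def)
  have "\<exists>f. puppy_response G x 0 q f" using response_along_arc[of x 0 q 0] lm by simp
  then obtain f where f: "puppy_response G x 0 q f" "\<forall>t\<in>{0..1}. G (x + t * 0) \<noteq> G (f t)"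
    using assms T unfolding trap_def by blast
  have "f 0 = q" using f(1) run_from_locmin[OF _ lm] by (simp add: puppy_response_def)
  then have Gne: "G x \<noteq> G q" using f(2) by force
  define k where "k = \<lfloor>q - x\<rfloor>"
  have "q - x \<noteq> of_int k" using periodic_int[of x k] Gne by (metis add_diff_cancel_left' diff_add_cancel add.commute)
  then have k: "x < q - of_int k" "q - of_int k < x + 1" unfolding k_def by linarith+
  define T1 where "T1 x q = T x (q + of_int k)" for x q
  interpret P: puppy_trap G T1
    by unfold_locales (use trap_shift[OF assms] in \<open>simp add: T1_def[abs_def]\<close>)
  have ne: "P.trapped x \<noteq> {}" using T k by (auto simp: P.trapped_def T1_def intro!: exI[of _ "q - of_int k"])
  interpret R: pl_track "\<lambda>s. G (- s)" by (rule reflected)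
  \<comment> \<open>With \<open>1 - q\<close> the strip between \<open>x\<close> and
    \<open>x + 1\<close> is reflected onto the strip between \<open>- x\<close> and
    \<open>- x + 1\<close>.\<close>
  define T2 where "T2 x q = T1 (- x) (1 - q)" for x q
  interpret Q: puppy_trap "\<lambda>s. G (- s)" T2
  proof unfold_locales
    have "trap (\<lambda>s. G (- s)) (\<lambda>x q. T1 (- x) (- (q + of_int (- 1))))"
      by (rule R.trap_shift[OF trap_reflect[OF P.trap]])
    then show "trap (\<lambda>s. G (- s)) T2" by (simp add: T2_def[abs_def])
  qed
  have trapped2: "p \<in> Q.trapped (- y) \<longleftrightarrow> 1 - p \<in> P.trapped y" for y p
    by (auto simp: Q.trapped_def P.trapped_def T2_def)
  have ne2: "Q.trapped (- x) \<noteq> {}" using ne trapped2[of "1 - _" x] by fastforce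
  obtain e1 where e1: "e1 > 0" "\<And>e. 0 < e \<Longrightarrow> e \<le> e1 \<Longrightarrow> \<exists>f. continuous_on {-1..2} f \<and>
    (\<forall>x\<in>{-1..2}. (\<forall>p\<in>P.trapped x. p < f x) \<and> f x + e < x + 1 \<and> phi x (f x) < phi x (f x + e))"
    using P.upper_curve[OF ne, of "-1" 2] by blast
  obtain e2 where e2: "e2 > 0" "\<And>e. 0 < e \<Longrightarrow> e \<le> e2 \<Longrightarrow> \<exists>f. continuous_on {-2..1} f \<and>
    (\<forall>x\<in>{-2..1}. (\<forall>p\<in>Q.trapped x. p < f x) \<and> f x + e < x + 1 \<and> R.phi x (f x) < R.phi x (f x + e))"
    using Q.upper_curve[OF ne2, of "-2" 1] by blast
  define e where "e = min e1 e2"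
  have e: "0 < e" "e \<le> e1" "e \<le> e2" using e1 e2 by (simp_all add: e_def)
  obtain f where f: "continuous_on {-1..2} f" "\<forall>x\<in>{-1..2}. (\<forall>p\<in>P.trapped x. p < f x) \<and> f x + e < x + 1 \<and>
    phi x (f x) < phi x (f x + e)" using e1(2)[OF e(1,2)] by blast
  obtain g where g: "continuous_on {-2..1} g" "\<forall>x\<in>{-2..1}. (\<forall>p\<in>Q.trapped x. p < g x) \<and> g x + e < x + 1 \<and>
    R.phi x (g x) < R.phi x (g x + e)" using e2(2)[OF e(1,3)] by blast
  \<comment> \<open>Reflection turns the pair \<open>g\<close>, \<open>g + e\<close> into
    \<open>g' + e\<close>, \<open>g'\<close>; subtracting \<open>e\<close> makes the lower one the
    base point.\<close>
  define g' where "g' x = 1 - g (- x) - e" for x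
  show False
  proof (rule no_crossing_curves[OF e(1) _ f(1)])
    show "continuous_on {-1..2} g'"
      unfolding g'_def by (intro continuous_intros continuous_on_compose2[OF g(1)]) auto
    fix y :: real assume y: "y \<in> {-1..2}"
    have gy: "\<forall>p\<in>Q.trapped (- y). p < g (- y)" "g (- y) + e < - y + 1"
      "R.phi (- y) (g (- y)) < R.phi (- y) (g (- y) + e)"
      using bspec[OF g(2), of "- y"] y by auto
    have fy: "\<forall>p\<in>P.trapped y. p < f y" "f y + e < y + 1" "phi y (f y) < phi y (f y + e)"
      using bspec[OF f(2) y] by auto
    obtain p where p: "p \<in> P.trapped y" using P.trapped_nonempty[OF ne] by blast
    have "p < f y" using fy(1) p by blast
    have "1 - p \<in> Q.trapped (- y)" using trapped2[of "1 - p" y] p by simp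
    then have "1 - p < g (- y)" using gy(1) by blast
    then show "y < g' y \<and> g' y < f y \<and> f y + e < y + 1"
      using \<open>p < f y\<close> fy(2) gy(2) e(1) by (simp add: g'_def)
    have "G (- g (- y)) = G (g' y + e)" using periodic[of "- g (- y)"] by (simp add: g'_def add.commute)
    moreover have "G (- (g (- y) + e)) = G (g' y)"
      using periodic[of "- (g (- y) + e)"] by (simp add: g'_def algebra_simps)
    ultimately show "dist (G y) (G (g' y + e)) < dist (G y) (G (g' y))"
      using gy(3) by (simp add: dist_fun_def)
    show "dist (G y) (G (f y)) < dist (G y) (G (f y + e))" using fy(3) by (simp add: dist_fun_def)
  qed
qed

theorem human_wins_everywhere: "human_wins G x q"
proof (rule ccontr)
  define T where "T x q \<longleftrightarrow> locmin (phi x) q \<and> \<not> human_wins G x q" for x q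
  have step: "\<exists>f. puppy_response G x d q f \<and> (\<forall>t\<in>{0..1}. G (x + t * d) \<noteq> G (f t)) \<and> T (x + d) (f 1)"
    if nw: "\<not> human_wins G x q" and ex: "\<exists>f. puppy_response G x d q f" for x q d
  proof -
    obtain f where f: "puppy_response G x d q f" "\<forall>t\<in>{0..1}. G (x + t * d) \<noteq> G (f t)"
      "\<not> human_wins G (x + d) (f 1)"
      using human_wins.move[OF ex] nw by blast
    have "locmin (phi (x + 1 * d)) (f 1)"
      using f(1) unfolding puppy_response_def by (meson atLeastAtMost_iff order_refl zero_le_one)
    then show ?thesis using f by (auto simp: T_def)
  qed
  have "trap G T" unfolding trap_def using step by (auto simp: T_def)
  assume nw: "\<not> human_wins G x q"
  \<comment> \<open>A move of length zero lets the puppy settle, since membership in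
    \<open>T\<close> includes stability.\<close>
  obtain b where "puppy_run (phi x) q b" using run_exists by blast
  then have "puppy_response G x 0 q (\<lambda>_. b)"
    by (auto simp: puppy_response_def puppy_run_cases intro!: exI[of _ b])
  then have "\<exists>f. puppy_response G x 0 q f" by blast
  from step[OF nw this] obtain f :: "real \<Rightarrow> real" where "T (x + 0) (f 1)" by blast
  then show False using no_trap[OF \<open>trap G T\<close>] by blast
qed

end

section \<open>Polygons\<close>

text \<open>Each piece lies on one side of its parameter and within \<open>{0..1}\<close>, so
  velocities may change at the joints when paths are concatenated or continued periodically.\<close>

definition pl_path :: "(real \<Rightarrow> complex) \<Rightarrow> bool" where
  "pl_path g \<longleftrightarrow>
    (\<forall>a. 0 \<le> a \<and> a < 1 \<longrightarrow> (\<exists>c v. a < c \<and> c \<le> 1 \<and> (\<forall>s\<in>{a..c}. g s = g a + (s - a) *\<^sub>R v))) \<and>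
    (\<forall>a. 0 < a \<and> a \<le> 1 \<longrightarrow> (\<exists>b u. b < a \<and> 0 \<le> b \<and> (\<forall>s\<in>{b..a}. g s = g a + (s - a) *\<^sub>R u)))"

lemma pl_path_linepath: "pl_path (linepath a b)"
proof -
  have "linepath a b s = linepath a b t + (s - t) *\<^sub>R (b - a)" for s t
    by (simp add: linepath_def algebra_simps)
  then show ?thesis unfolding pl_path_def by (meson order_refl)
qed

lemma pl_path_join:
  assumes g: "pl_path g" and h: "pl_path h" and "pathfinish g = pathstart h"
  shows "pl_path (g +++ h)"
proof -
  have L: "(g +++ h) s = g (2 * s)" if "s \<le> 1/2" for s using that by (simp add: joinpaths_def)
  have R: "(g +++ h) s = h (2 * s - 1)" if "1/2 \<le> s" for s
  proof (cases "s = 1/2")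
    case True
    show ?thesis unfolding True using assms(3) by (simp add: joinpaths_def pathfinish_def pathstart_def)
  next
    case False
    then show ?thesis using that by (simp add: joinpaths_def)
  qed
  show ?thesis
    unfolding pl_path_def
  proof (intro conjI allI impI)
    fix a :: real assume a: "0 \<le> a \<and> a < 1"
    show "\<exists>c v. a < c \<and> c \<le> 1 \<and> (\<forall>s\<in>{a..c}. (g +++ h) s = (g +++ h) a + (s - a) *\<^sub>R v)"
    proof (cases "a < 1/2")
      case True
      then have "0 \<le> 2 * a" "2 * a < 1" using a by auto
      then obtain c v where c: "2 * a < c" "c \<le> 1" "\<forall>s\<in>{2 * a..c}. g s = g (2 * a) + (s - 2 * a) *\<^sub>R v"
        using g unfolding pl_path_def by blast
      have X: "(g +++ h) s = (g +++ h) a + (s - a) *\<^sub>R (2 *\<^sub>R v)" if "s \<in> {a..c / 2}" for s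
      proof -
        have "g (2 * s) = g (2 * a) + (2 * s - 2 * a) *\<^sub>R v"
          by (rule bspec[OF c(3)]) (use that in auto)
        then show ?thesis using L[of s] L[of a] that c(1,2) True by (simp add: algebra_simps)
      qed
      have "a < c / 2" "c / 2 \<le> 1" using a c(1,2) by auto
      then show ?thesis by (intro exI[of _ "c / 2"] exI[of _ "2 *\<^sub>R v"] conjI ballI) (assumption | erule X)+
    next
      case False
      then have "0 \<le> 2 * a - 1" "2 * a - 1 < 1" using a by auto
      then obtain c v where c: "2 * a - 1 < c" "c \<le> 1"
        "\<forall>s\<in>{2 * a - 1..c}. h s = h (2 * a - 1) + (s - (2 * a - 1)) *\<^sub>R v"
        using h unfolding pl_path_def by blast
      have X: "(g +++ h) s = (g +++ h) a + (s - a) *\<^sub>R (2 *\<^sub>R v)" if "s \<in> {a..(c + 1) / 2}" for s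
      proof -
        have "h (2 * s - 1) = h (2 * a - 1) + (2 * s - 1 - (2 * a - 1)) *\<^sub>R v"
          by (rule bspec[OF c(3)]) (use that in auto)
        then show ?thesis using R[of s] R[of a] that False by (simp add: algebra_simps)
      qed
      have "a < (c + 1) / 2" "(c + 1) / 2 \<le> 1" using a c(1,2) by auto
      then show ?thesis by (intro exI[of _ "(c + 1) / 2"] exI[of _ "2 *\<^sub>R v"] conjI ballI) (assumption | erule X)+
    qed
  next
    fix a :: real assume a: "0 < a \<and> a \<le> 1"
    show "\<exists>b u. b < a \<and> 0 \<le> b \<and> (\<forall>s\<in>{b..a}. (g +++ h) s = (g +++ h) a + (s - a) *\<^sub>R u)"
    proof (cases "a \<le> 1/2")
      case True
      then have "0 < 2 * a" "2 * a \<le> 1" using a by auto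
      then obtain b u where b: "b < 2 * a" "0 \<le> b" "\<forall>s\<in>{b..2 * a}. g s = g (2 * a) + (s - 2 * a) *\<^sub>R u"
        using g unfolding pl_path_def by blast
      have X: "(g +++ h) s = (g +++ h) a + (s - a) *\<^sub>R (2 *\<^sub>R u)" if "s \<in> {b / 2..a}" for s
      proof -
        have "g (2 * s) = g (2 * a) + (2 * s - 2 * a) *\<^sub>R u"
          by (rule bspec[OF b(3)]) (use that in auto)
        then show ?thesis using L[of s] L[of a] that True by (simp add: algebra_simps)
      qed
      have "b / 2 < a" "0 \<le> b / 2" using a b(1,2) by auto
      then show ?thesis by (intro exI[of _ "b / 2"] exI[of _ "2 *\<^sub>R u"] conjI ballI) (assumption | erule X)+
    next
      case False
      then have "0 < 2 * a - 1" "2 * a - 1 \<le> 1" using a by auto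
      then obtain b u where b: "b < 2 * a - 1" "0 \<le> b"
        "\<forall>s\<in>{b..2 * a - 1}. h s = h (2 * a - 1) + (s - (2 * a - 1)) *\<^sub>R u"
        using h unfolding pl_path_def by blast
      have X: "(g +++ h) s = (g +++ h) a + (s - a) *\<^sub>R (2 *\<^sub>R u)" if "s \<in> {(b + 1) / 2..a}" for s
      proof -
        have "h (2 * s - 1) = h (2 * a - 1) + (2 * s - 1 - (2 * a - 1)) *\<^sub>R u"
          by (rule bspec[OF b(3)]) (use that in auto)
        then show ?thesis using R[of s] R[of a] that b(1,2) False by (simp add: algebra_simps)
      qed
      have "(b + 1) / 2 < a" "0 \<le> (b + 1) / 2" using a b(1,2) by auto
      then show ?thesis by (intro exI[of _ "(b + 1) / 2"] exI[of _ "2 *\<^sub>R u"] conjI ballI) (assumption | erule X)+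
    qed
  qed
qed

lemma polyline_start: "polyline (v # vs) 0 = v"
  by (induction "v # vs" arbitrary: v vs rule: polyline.induct) (auto simp: linepath_def joinpaths_def)

lemma polyline_finish: "vs \<noteq> [] \<Longrightarrow> polyline vs 1 = last vs"
  by (induction vs rule: polyline.induct) (auto simp: linepath_def joinpaths_def)

lemma pl_path_polyline: "pl_path (polyline vs)"
proof (induction vs rule: polyline.induct)
  case (4 v w u vs)
  then show ?case
    using pl_path_join[OF pl_path_linepath, of "polyline (w # u # vs)" v w] polyline_start[of w "u # vs"]
    by (simp add: pathstart_def pathfinish_def linepath_def)
qed (simp_all only: polyline.simps pl_path_linepath)

lemma pl_track_track:
  assumes "simple_polygon vs"
  shows "pl_track (track vs)"
proof -
  define g where "g = polygon_path vs"
  have "vs \<noteq> []" and simple: "simple_path g" using assms by (auto simp: simple_polygon_def g_def)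
  then obtain v vs' where "vs = v # vs'" by (cases vs) auto
  then have closed: "g 0 = g 1"
    using polyline_start[of v "vs' @ [v]"] polyline_finish[of "vs @ [hd vs]"] by (simp add: g_def polygon_path_def)
  have pl_g: "pl_path g" by (simp add: g_def polygon_path_def pl_path_polyline)
  \<comment> \<open>The right end belongs to the piece because the polygon is closed, although
    \<open>frac\<close> has dropped to 0 there.\<close>
  have piece: "track vs s = g (s - of_int n)" if "of_int n \<le> s" "s \<le> of_int n + 1" for s n
  proof (cases "s = of_int n + 1")
    case True
    then show ?thesis using closed by (simp add: track_def g_def)
  next
    case False
    then have "\<lfloor>s\<rfloor> = n" using that by linarith
    then show ?thesis by (simp add: track_def g_def frac_def)
  qed
  have pl: "\<exists>b c u v. b < a \<and> a < c \<and> (\<forall>s\<in>{b..a}. track vs s = track vs a + (s - a) *\<^sub>R u)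
    \<and> (\<forall>s\<in>{a..c}. track vs s = track vs a + (s - a) *\<^sub>R v)" for a
  proof -
    have "\<exists>c>a. \<exists>v. \<forall>s\<in>{a..c}. track vs s = track vs a + (s - a) *\<^sub>R v"
    proof -
      define n where "n = \<lfloor>a\<rfloor>"
      have n: "0 \<le> a - of_int n" "a - of_int n < 1" unfolding n_def by linarith+
      then obtain c v where c: "a - of_int n < c" "c \<le> 1"
        "\<forall>s\<in>{a - of_int n..c}. g s = g (a - of_int n) + (s - (a - of_int n)) *\<^sub>R v"
        using pl_g unfolding pl_path_def by blast
      have X: "track vs s = track vs a + (s - a) *\<^sub>R v" if "s \<in> {a..c + of_int n}" for s
      proof -
        have "g (s - of_int n) = g (a - of_int n) + (s - of_int n - (a - of_int n)) *\<^sub>R v"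
          by (rule bspec[OF c(3)]) (use that in auto)
        moreover have "of_int n \<le> s" "s \<le> of_int n + 1" "of_int n \<le> a" "a \<le> of_int n + 1"
          using that c(2) n by auto
        ultimately show ?thesis using piece[of n s] piece[of n a] by simp
      qed
      have "a < c + of_int n" using c(1) by simp
      then show ?thesis by (intro exI[of _ "c + of_int n"] conjI exI[of _ v] ballI) (assumption | erule X)+
    qed
    moreover have "\<exists>b<a. \<exists>u. \<forall>s\<in>{b..a}. track vs s = track vs a + (s - a) *\<^sub>R u"
    proof -
      \<comment> \<open>For an integer \<open>a\<close> this is the preceding period, so that there
        is a piece to the left of \<open>a\<close>.\<close>
      define n where "n = \<lceil>a\<rceil> - 1"
      have n: "0 < a - of_int n" "a - of_int n \<le> 1" unfolding n_def by linarith+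
      then obtain b u where b: "b < a - of_int n" "0 \<le> b"
        "\<forall>s\<in>{b..a - of_int n}. g s = g (a - of_int n) + (s - (a - of_int n)) *\<^sub>R u"
        using pl_g unfolding pl_path_def by blast
      have X: "track vs s = track vs a + (s - a) *\<^sub>R u" if "s \<in> {b + of_int n..a}" for s
      proof -
        have "g (s - of_int n) = g (a - of_int n) + (s - of_int n - (a - of_int n)) *\<^sub>R u"
          by (rule bspec[OF b(3)]) (use that in auto)
        moreover have "of_int n \<le> s" "s \<le> of_int n + 1" "of_int n \<le> a" "a \<le> of_int n + 1"
          using that b(2) n by auto
        ultimately show ?thesis using piece[of n s] piece[of n a] by simp
      qed
      have "b + of_int n < a" using b(1) by simp
      then show ?thesis by (intro exI[of _ "b + of_int n"] conjI exI[of _ u] ballI) (assumption | erule X)+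
    qed
    ultimately show ?thesis by blast
  qed
  show ?thesis
  proof
    show "continuous_on UNIV (track vs)"
      unfolding continuous_on_eq_continuous_at[OF open_UNIV] continuous_at_split
    proof (intro ballI conjI)
      fix a :: real
      obtain b c u v where s: "b < a" "a < c" "\<forall>s\<in>{b..a}. track vs s = track vs a + (s - a) *\<^sub>R u"
        "\<forall>s\<in>{a..c}. track vs s = track vs a + (s - a) *\<^sub>R v"
        using pl[of a] by (elim exE conjE) (rule that)
      have lim: "((\<lambda>s. track vs a + (s - a) *\<^sub>R z) \<longlongrightarrow> track vs a) (at a within S)" for z S
        by (rule tendsto_eq_intros refl | simp)+
      have "\<forall>\<^sub>F s in at_left a. track vs a + (s - a) *\<^sub>R u = track vs s"
        using s(1) by (auto simp: eventually_at_left_field intro!: exI[of _ b] s(3)[rule_format, symmetric])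
      from Lim_transform_eventually[OF lim this] show "continuous (at_left a) (track vs)"
        by (simp add: continuous_within)
      have "\<forall>\<^sub>F s in at_right a. track vs a + (s - a) *\<^sub>R v = track vs s"
        using s(2) by (auto simp: eventually_at_right_field intro!: exI[of _ c] s(4)[rule_format, symmetric])
      from Lim_transform_eventually[OF lim this] show "continuous (at_right a) (track vs)"
        by (simp add: continuous_within)
    qed
    show "track vs (s + 1) = track vs s" for s by (simp add: track_def frac_def)
    show "s - t \<in> \<int>" if "track vs s = track vs t" for s t
    proof -
      \<comment> \<open>\<open>frac\<close> never takes the value 1, which rules out the coincidence
        of end points that \<open>loop_free\<close> permits.\<close>
      have "frac s \<in> {0..<1}" "frac t \<in> {0..<1}" by (simp_all add: frac_lt_1)
      moreover have "g (frac s) = g (frac t)" using that by (simp add: track_def g_def)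
      ultimately have "frac s = frac t"
        using simple unfolding simple_path_def loop_free_def
        by (metis atLeastAtMost_iff atLeastLessThan_iff less_imp_le less_irrefl)
      then have "s - t = of_int (\<lfloor>s\<rfloor> - \<lfloor>t\<rfloor>)" by (simp add: frac_def algebra_simps)
      then show ?thesis by simp
    qed
  qed (rule pl)
qed

theorem theorem14:
  fixes vs :: "complex list"
  assumes "simple_polygon vs"
  shows "\<forall>x q. human_wins (track vs) x q"
proof -
  interpret pl_track "track vs" using pl_track_track[OF assms] .
  show ?thesis using human_wins_everywhere by blast
qed

end
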